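(* Let $G$ be a discrete group (respectively, a pro-$p$-group) admitting a finite type presentation (respectively, finite type pro-$p$-presentation). Then quasirationality does not depend on the choice of the presentation and is a property of the group $G$ itself: if one finite type (pro-$p$-)presentation of $G$ is quasirational, then every other finite type (pro-$p$-)presentation of $G$ is quasirational as well.
   Context: A finite type presentation of a discrete group $G$ is an exact sequence $1\to R\to F\xrightarrow{\pi} G\to 1$ in which $F=F(X)$ is the free group on a finite set $X$ and $R$ is a normal subgroup of $F$ generated as a normal subgroup by finitely many elements. A finite type pro-$p$-presentation of a pro-$p$-group $G$ is such an exact sequence with $F=F(X)$ the free pro-$p$-group on a finite set $X$ and $R$ a closed normal subgroup topologically normally generated by finitely many elements. In the pro-$p$ case all subgroups generated by given elements (commutators, etc.) are understood to be closed and group rings are completed group rings. In the pro-$p$ case the prime $p$ is fixed; in the discrete case $p$ runs over all primes. Zassenhaus filtration: for a prime $p$ let $\Delta_p$ be the augmentation ideal of $\mathbb{F}_pF$ (the ordinary group ring in the discrete case, the completed one in the pro-$p$ case), and put $\mathcal{M}_n=\{f\in F\mid f-1\in\Delta_p^n\}$, where in the pro-$p$ case $\Delta_p^n$ denotes the closure of the $n$-th power of the ideal. Quasirational presentation: a finite type (pro-$p$-)presentation is called quasirational (a $QR$-presentation) if for every $n>0$ and every prime $p\ge 2$ (with $p$ the fixed prime in the pro-$p$ case; all primes $p$, with the corresponding $p$-Zassenhaus filtrations, in the discrete case) the $F/R\mathcal{M}_n$-module $R/[R,R\mathcal{M}_n]$ has no nontrivial $p$-torsion. *)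

theory Defs
  imports "HOL-Algebra.Generated_Groups" "HOL-Algebra.Ideal_Product" "HOL-Number_Theory.Residues"
    "HOL-Analysis.Analysis"
begin

section \<open>Subgroups generated by conjugates and by mixed commutators\<close>

definition normal_closure :: "('a, 'm) monoid_scheme \<Rightarrow> 'a set \<Rightarrow> 'a set" where
  "normal_closure G S =
     generate G (\<Union>g\<in>carrier G. \<Union>s\<in>S. {g \<otimes>\<^bsub>G\<^esub> s \<otimes>\<^bsub>G\<^esub> inv\<^bsub>G\<^esub> g})"

definition commutator_subgroup :: "('a, 'm) monoid_scheme \<Rightarrow> 'a set \<Rightarrow> 'a set \<Rightarrow> 'a set" where
  "commutator_subgroup G H K =
     generate G (\<Union>h\<in>H. \<Union>k\<in>K. {h \<otimes>\<^bsub>G\<^esub> k \<otimes>\<^bsub>G\<^esub> inv\<^bsub>G\<^esub> h \<otimes>\<^bsub>G\<^esub> inv\<^bsub>G\<^esub> k})"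

text \<open>Torsion of a module over a group ring is that of its underlying abelian group, which is
  written multiplicatively here.\<close>

definition p_torsion :: "nat \<Rightarrow> ('a, 'm) monoid_scheme \<Rightarrow> 'a set" where
  "p_torsion p A = {a \<in> carrier A. \<exists>k::nat. a [^]\<^bsub>A\<^esub> (p ^ k) = \<one>\<^bsub>A\<^esub>}"


section \<open>Free groups\<close>

text \<open>Elements of the free group on \<open>X\<close> are reduced words; the letter \<open>(x, True)\<close> is
  \<open>x\<close> and \<open>(x, False)\<close> is its inverse.\<close>

fun reduced_word :: "('x \<times> bool) list \<Rightarrow> bool" where
  "reduced_word (a # b # w) \<longleftrightarrow> \<not> (fst a = fst b \<and> snd a \<noteq> snd b) \<and> reduced_word (b # w)"
| "reduced_word _ \<longleftrightarrow> True"

fun push_letter :: "'x \<times> bool \<Rightarrow> ('x \<times> bool) list \<Rightarrow> ('x \<times> bool) list" where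
  "push_letter a [] = [a]"
| "push_letter a (b # w) = (if fst a = fst b \<and> snd a \<noteq> snd b then w else a # b # w)"

definition free_group :: "'x set \<Rightarrow> ('x \<times> bool) list monoid" where
  "free_group X =
     \<lparr>carrier = {w. reduced_word w \<and> fst ` set w \<subseteq> X},
      monoid.mult = (\<lambda>u v. foldr push_letter u v),
      one = []\<rparr>"


section \<open>Group rings and their augmentation ideals\<close>

definition group_ring ::
    "('r, 'n) ring_scheme \<Rightarrow> ('a, 'm) monoid_scheme \<Rightarrow> ('a \<Rightarrow> 'r) ring" where
  "group_ring K G =
     \<lparr>carrier = {f \<in> carrier G \<rightarrow>\<^sub>E carrier K. finite {x \<in> carrier G. f x \<noteq> \<zero>\<^bsub>K\<^esub>}},
      monoid.mult = (\<lambda>f g. \<lambda>x\<in>carrier G.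
                finsum K (\<lambda>y. f y \<otimes>\<^bsub>K\<^esub> g (inv\<^bsub>G\<^esub> y \<otimes>\<^bsub>G\<^esub> x)) {y \<in> carrier G. f y \<noteq> \<zero>\<^bsub>K\<^esub>}),
      one = (\<lambda>x\<in>carrier G. if x = \<one>\<^bsub>G\<^esub> then \<one>\<^bsub>K\<^esub> else \<zero>\<^bsub>K\<^esub>),
      zero = (\<lambda>x\<in>carrier G. \<zero>\<^bsub>K\<^esub>),
      add = (\<lambda>f g. \<lambda>x\<in>carrier G. f x \<oplus>\<^bsub>K\<^esub> g x)\<rparr>"

definition group_ring_of ::
    "('r, 'n) ring_scheme \<Rightarrow> ('a, 'm) monoid_scheme \<Rightarrow> 'a \<Rightarrow> ('a \<Rightarrow> 'r)" where
  "group_ring_of K G g = (\<lambda>x\<in>carrier G. if x = g then \<one>\<^bsub>K\<^esub> else \<zero>\<^bsub>K\<^esub>)"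

text \<open>The map of group rings induced by a group homomorphism \<open>\<phi>\<close> from \<open>G\<close> to \<open>H\<close>.\<close>

definition group_ring_map ::
    "('r, 'n) ring_scheme \<Rightarrow> ('a, 'm) monoid_scheme \<Rightarrow> ('b, 'k) monoid_scheme
      \<Rightarrow> ('a \<Rightarrow> 'b) \<Rightarrow> ('a \<Rightarrow> 'r) \<Rightarrow> ('b \<Rightarrow> 'r)" where
  "group_ring_map K G H \<phi> f =
     (\<lambda>y\<in>carrier H. finsum K f {x \<in> carrier G. f x \<noteq> \<zero>\<^bsub>K\<^esub> \<and> \<phi> x = y})"

definition augmentation ::
    "('r, 'n) ring_scheme \<Rightarrow> ('a, 'm) monoid_scheme \<Rightarrow> ('a \<Rightarrow> 'r) \<Rightarrow> 'r" where
  "augmentation K G f = finsum K f {x \<in> carrier G. f x \<noteq> \<zero>\<^bsub>K\<^esub>}"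

definition augmentation_ideal ::
    "('r, 'n) ring_scheme \<Rightarrow> ('a, 'm) monoid_scheme \<Rightarrow> ('a \<Rightarrow> 'r) set" where
  "augmentation_ideal K G = {f \<in> carrier (group_ring K G). augmentation K G f = \<zero>\<^bsub>K\<^esub>}"

fun ideal_power :: "('r, 'n) ring_scheme \<Rightarrow> 'r set \<Rightarrow> nat \<Rightarrow> 'r set" where
  "ideal_power K I 0 = carrier K"
| "ideal_power K I (Suc n) = ideal_prod K I (ideal_power K I n)"

abbreviation prime_field :: "nat \<Rightarrow> int ring" where
  "prime_field p \<equiv> residue_ring (int p)"

definition zassenhaus :: "nat \<Rightarrow> ('a, 'm) monoid_scheme \<Rightarrow> nat \<Rightarrow> 'a set" where
  "zassenhaus p F n =
     {f \<in> carrier F.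
        group_ring_of (prime_field p) F f \<ominus>\<^bsub>group_ring (prime_field p) F\<^esub> \<one>\<^bsub>group_ring (prime_field p) F\<^esub>
          \<in> ideal_power (group_ring (prime_field p) F) (augmentation_ideal (prime_field p) F) n}"


section \<open>Finite type presentations of discrete groups\<close>

text \<open>The exact sequence \<open>1 \<rightarrow> R \<rightarrow> F(X) \<rightarrow> G \<rightarrow> 1\<close>, with \<open>R\<close> a subgroup of \<open>F(X)\<close>.\<close>

definition finite_type_presentation ::
    "('g, 'm) monoid_scheme \<Rightarrow> 'x set \<Rightarrow> ('x \<times> bool) list set
      \<Rightarrow> (('x \<times> bool) list \<Rightarrow> 'g) \<Rightarrow> bool" where
  "finite_type_presentation G X R \<pi> \<longleftrightarrow>
     finite X \<and>
     \<pi> \<in> epi (free_group X) G \<and>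
     R = kernel (free_group X) G \<pi> \<and>
     (\<exists>S. finite S \<and> S \<subseteq> carrier (free_group X) \<and> R = normal_closure (free_group X) S)"

definition quasirational :: "'x set \<Rightarrow> ('x \<times> bool) list set \<Rightarrow> bool" where
  "quasirational X R \<longleftrightarrow>
     (let F = free_group X in
      \<forall>n>0. \<forall>p. prime p \<longrightarrow>
        (let A = (F\<lparr>carrier := R\<rparr>) Mod commutator_subgroup F R (R <#>\<^bsub>F\<^esub> zassenhaus p F n)
         in p_torsion p A = {\<one>\<^bsub>A\<^esub>}))"


section \<open>Inverse limits over sets of normal subgroups\<close>

text \<open>The systems are indexed by a set \<open>I\<close> of normal subgroups; for \<open>N \<subseteq> M\<close> the transition
  map is \<open>\<theta> N M\<close> from \<open>A N\<close> to \<open>A M\<close>. The limit carries the topology induced from the product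
  of the discrete spaces \<open>A N\<close>.\<close>

definition limit_carrier ::
    "'a set set \<Rightarrow> ('a set \<Rightarrow> 'b set) \<Rightarrow> ('a set \<Rightarrow> 'a set \<Rightarrow> 'b \<Rightarrow> 'b) \<Rightarrow> ('a set \<Rightarrow> 'b) set" where
  "limit_carrier I A \<theta> =
     {x \<in> (\<Pi>\<^sub>E N\<in>I. A N). \<forall>N\<in>I. \<forall>M\<in>I. N \<subseteq> M \<longrightarrow> \<theta> N M (x N) = x M}"

definition limit_topology ::
    "'a set set \<Rightarrow> ('a set \<Rightarrow> 'b set) \<Rightarrow> ('a set \<Rightarrow> 'a set \<Rightarrow> 'b \<Rightarrow> 'b) \<Rightarrow> ('a set \<Rightarrow> 'b) topology" where
  "limit_topology I A \<theta> =
     subtopology (product_topology (\<lambda>N. discrete_topology (A N)) I) (limit_carrier I A \<theta>)"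

text \<open>The canonical map from \<open>G/N\<close> to \<open>G/M\<close> sends a coset \<open>C\<close> of \<open>N\<close> to \<open>MC\<close>.\<close>

definition quotient_map_of :: "('a, 'm) monoid_scheme \<Rightarrow> 'a set \<Rightarrow> 'a set \<Rightarrow> 'a set \<Rightarrow> 'a set" where
  "quotient_map_of G N M C = M <#>\<^bsub>G\<^esub> C"


section \<open>Pro-\<open>p\<close>-groups and free pro-\<open>p\<close>-groups\<close>

definition topological_group :: "('a, 'm) monoid_scheme \<Rightarrow> 'a topology \<Rightarrow> bool" where
  "topological_group G T \<longleftrightarrow>
     group G \<and> topspace T = carrier G \<and>
     continuous_map (prod_topology T T) T (\<lambda>(x, y). x \<otimes>\<^bsub>G\<^esub> y) \<and>
     continuous_map T T (\<lambda>x. inv\<^bsub>G\<^esub> x)"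

definition profinite_group :: "('a, 'm) monoid_scheme \<Rightarrow> 'a topology \<Rightarrow> bool" where
  "profinite_group G T \<longleftrightarrow>
     topological_group G T \<and> compact_space T \<and> Hausdorff_space T \<and>
     (\<forall>W. openin T W \<and> \<one>\<^bsub>G\<^esub> \<in> W \<longrightarrow> (\<exists>U. subgroup U G \<and> openin T U \<and> U \<subseteq> W))"

text \<open>Since \<^term>\<open>card\<close> is zero on infinite sets, having index a power of the prime \<open>p\<close> includes
  having finite index.\<close>

definition p_power_index :: "nat \<Rightarrow> ('a, 'm) monoid_scheme \<Rightarrow> 'a set \<Rightarrow> bool" where
  "p_power_index p G N \<longleftrightarrow> (\<exists>k::nat. card (rcosets\<^bsub>G\<^esub> N) = p ^ k)"

definition pro_p_group :: "nat \<Rightarrow> ('a, 'm) monoid_scheme \<Rightarrow> 'a topology \<Rightarrow> bool" where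
  "pro_p_group p G T \<longleftrightarrow>
     profinite_group G T \<and> (\<forall>U. U \<lhd> G \<and> openin T U \<longrightarrow> p_power_index p G U)"

definition p_power_normal :: "nat \<Rightarrow> ('a, 'm) monoid_scheme \<Rightarrow> 'a set set" where
  "p_power_normal p G = {N. N \<lhd> G \<and> p_power_index p G N}"

text \<open>For finite \<open>X\<close>, the free pro-\<open>p\<close>-group on \<open>X\<close> is the inverse limit of the finite
  \<open>p\<close>-quotients of the free group on \<open>X\<close> (Serre, Galois Cohomology, I.1.5).\<close>

type_synonym 'x pro_word = "('x \<times> bool) list set \<Rightarrow> ('x \<times> bool) list set"

definition free_pro_p :: "nat \<Rightarrow> 'x set \<Rightarrow> 'x pro_word monoid" where
  "free_pro_p p X =
     (let F = free_group X; I = p_power_normal p F in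
      \<lparr>carrier = limit_carrier I (\<lambda>N. carrier (F Mod N)) (quotient_map_of F),
       monoid.mult = (\<lambda>x y. \<lambda>N\<in>I. x N \<otimes>\<^bsub>F Mod N\<^esub> y N),
       one = (\<lambda>N\<in>I. \<one>\<^bsub>F Mod N\<^esub>)\<rparr>)"

definition free_pro_p_topology :: "nat \<Rightarrow> 'x set \<Rightarrow> 'x pro_word topology" where
  "free_pro_p_topology p X =
     (let F = free_group X in
      limit_topology (p_power_normal p F) (\<lambda>N. carrier (F Mod N)) (quotient_map_of F))"


section \<open>Completed group rings\<close>

definition open_normal :: "('a, 'm) monoid_scheme \<Rightarrow> 'a topology \<Rightarrow> 'a set set" where
  "open_normal G T = {U. U \<lhd> G \<and> openin T U}"

definition completed_transition ::
    "('r, 'n) ring_scheme \<Rightarrow> ('a, 'm) monoid_scheme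
      \<Rightarrow> 'a set \<Rightarrow> 'a set \<Rightarrow> ('a set \<Rightarrow> 'r) \<Rightarrow> ('a set \<Rightarrow> 'r)" where
  "completed_transition K G U V = group_ring_map K (G Mod U) (G Mod V) (quotient_map_of G U V)"

definition completed_group_ring ::
    "('r, 'n) ring_scheme \<Rightarrow> ('a, 'm) monoid_scheme \<Rightarrow> 'a topology
      \<Rightarrow> ('a set \<Rightarrow> 'a set \<Rightarrow> 'r) ring" where
  "completed_group_ring K G T =
     (let I = open_normal G T; A = (\<lambda>U. group_ring K (G Mod U)) in
      \<lparr>carrier = limit_carrier I (\<lambda>U. carrier (A U)) (completed_transition K G),
       monoid.mult = (\<lambda>x y. \<lambda>U\<in>I. x U \<otimes>\<^bsub>A U\<^esub> y U),
       one = (\<lambda>U\<in>I. \<one>\<^bsub>A U\<^esub>),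
       zero = (\<lambda>U\<in>I. \<zero>\<^bsub>A U\<^esub>),
       add = (\<lambda>x y. \<lambda>U\<in>I. x U \<oplus>\<^bsub>A U\<^esub> y U)\<rparr>)"

text \<open>This is the profinite topology when \<open>K\<close> is finite, since then so is each \<open>K[G/U]\<close>.\<close>

definition completed_group_ring_topology ::
    "('r, 'n) ring_scheme \<Rightarrow> ('a, 'm) monoid_scheme \<Rightarrow> 'a topology
      \<Rightarrow> ('a set \<Rightarrow> 'a set \<Rightarrow> 'r) topology" where
  "completed_group_ring_topology K G T =
     limit_topology (open_normal G T) (\<lambda>U. carrier (group_ring K (G Mod U)))
       (completed_transition K G)"

definition completed_group_ring_of ::
    "('r, 'n) ring_scheme \<Rightarrow> ('a, 'm) monoid_scheme \<Rightarrow> 'a topology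
      \<Rightarrow> 'a \<Rightarrow> ('a set \<Rightarrow> 'a set \<Rightarrow> 'r)" where
  "completed_group_ring_of K G T g =
     (\<lambda>U\<in>open_normal G T. group_ring_of K (G Mod U) (U #>\<^bsub>G\<^esub> g))"

text \<open>The transition maps preserve augmentations, so all components of an element have the same
  augmentation; the component at \<open>U = G\<close> is the augmentation map to \<open>K[G/G] = K\<close>.\<close>

definition completed_augmentation ::
    "('r, 'n) ring_scheme \<Rightarrow> ('a, 'm) monoid_scheme \<Rightarrow> ('a set \<Rightarrow> 'a set \<Rightarrow> 'r) \<Rightarrow> 'r" where
  "completed_augmentation K G x = augmentation K (G Mod carrier G) (x (carrier G))"

definition completed_augmentation_ideal ::
    "('r, 'n) ring_scheme \<Rightarrow> ('a, 'm) monoid_scheme \<Rightarrow> 'a topology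
      \<Rightarrow> ('a set \<Rightarrow> 'a set \<Rightarrow> 'r) set" where
  "completed_augmentation_ideal K G T =
     {x \<in> carrier (completed_group_ring K G T). completed_augmentation K G x = \<zero>\<^bsub>K\<^esub>}"

definition pro_p_zassenhaus ::
    "nat \<Rightarrow> ('a, 'm) monoid_scheme \<Rightarrow> 'a topology \<Rightarrow> nat \<Rightarrow> 'a set" where
  "pro_p_zassenhaus p F T n =
     (let K = prime_field p; A = completed_group_ring K F T in
      {f \<in> carrier F.
         completed_group_ring_of K F T f \<ominus>\<^bsub>A\<^esub> \<one>\<^bsub>A\<^esub>
           \<in> completed_group_ring_topology K F T closure_of
               ideal_power A (completed_augmentation_ideal K F T) n})"


section \<open>Finite type pro-\<open>p\<close>-presentations\<close>

definition finite_type_pro_p_presentation ::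
    "nat \<Rightarrow> ('g, 'm) monoid_scheme \<Rightarrow> 'g topology \<Rightarrow> 'x set \<Rightarrow> 'x pro_word set
      \<Rightarrow> ('x pro_word \<Rightarrow> 'g) \<Rightarrow> bool" where
  "finite_type_pro_p_presentation p G T X R \<pi> \<longleftrightarrow>
     finite X \<and>
     \<pi> \<in> epi (free_pro_p p X) G \<and>
     continuous_map (free_pro_p_topology p X) T \<pi> \<and>
     R = kernel (free_pro_p p X) G \<pi> \<and>
     (\<exists>S. finite S \<and> S \<subseteq> carrier (free_pro_p p X) \<and>
          R = free_pro_p_topology p X closure_of normal_closure (free_pro_p p X) S)"

definition pro_p_quasirational :: "nat \<Rightarrow> 'x set \<Rightarrow> 'x pro_word set \<Rightarrow> bool" where
  "pro_p_quasirational p X R \<longleftrightarrow>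
     (let F = free_pro_p p X; T = free_pro_p_topology p X in
      \<forall>n>0.
        (let A = (F\<lparr>carrier := R\<rparr>) Mod
                   (T closure_of commutator_subgroup F R (R <#>\<^bsub>F\<^esub> pro_p_zassenhaus p F T n))
         in p_torsion p A = {\<one>\<^bsub>A\<^esub>}))"

end

theory Submission
  imports Defs "HOL-Algebra.Sylow"
begin

text \<open>
  Let \<open>F\<^sub>i/R\<^sub>i\<close> for \<open>i = 1, 2\<close> be two presentations of \<open>G\<close>, and fix \<open>n\<close> and \<open>p\<close>. Write \<open>M\<^sub>i\<close>
  for the \<open>n\<close>-th term of the Zassenhaus filtration of \<open>F\<^sub>i\<close> and \<open>C\<^sub>i = [R\<^sub>i, R\<^sub>i M\<^sub>i]\<close>, closed up in the
  pro-\<open>p\<close> case. Freeness gives homomorphisms \<open>s\<close> from \<open>F\<^sub>1\<close> to \<open>F\<^sub>2\<close> and \<open>t\<close> from \<open>F\<^sub>2\<close> to \<open>F\<^sub>1\<close> that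
  induce the identity on \<open>G\<close> (\<open>free_group_lift\<close>, \<open>free_pro_p_lift\<close>). They respect the Zassenhaus
  filtrations because group rings are functorial (\<open>zassenhaus_hom\<close>, \<open>pro_p_zassenhaus_hom\<close>), hence
  map \<open>C\<^sub>1\<close> into \<open>C\<^sub>2\<close> and \<open>C\<^sub>2\<close> into \<open>C\<^sub>1\<close>. Suppose that \<open>r \<in> R\<^sub>2\<close> has a \<open>p\<close>-power in \<open>C\<^sub>2\<close>. Then so
  has \<open>t r\<close> in \<open>C\<^sub>1\<close>, so \<open>t r \<in> C\<^sub>1\<close> when the first presentation is quasirational, and \<open>e r \<in> C\<^sub>2\<close>
  for \<open>e = s \<circ> t\<close>. It remains to see that \<open>r\<inverse> e(r) \<in> C\<^sub>2\<close>: the endomorphism \<open>e\<close> acts as the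
  identity on the torsion of \<open>R\<^sub>2/C\<^sub>2\<close>.

  The map \<open>\<delta>(w) = w\<inverse> e(w)\<close> from \<open>F\<^sub>2\<close> to the abelian group \<open>A = R\<^sub>2/C\<^sub>2\<close> is a crossed homomorphism,
  so that by Fox calculus it factors, on relations, through a free module over a group ring, which
  has no torsion. The proof below is a combinatorial form of this. Let \<open>D\<close> be the centralizer of
  \<open>A\<close> in \<open>F\<^sub>2\<close>, a normal subgroup that contains \<open>R\<^sub>2 M\<^sub>2\<close>. A word \<open>w\<close> spells a path in the Schreier
  graph of \<open>D\<close>, and its flow counts, with signs, how often the path runs through each edge. Then
  \<open>\<delta>(w)\<close> is the product of translates of the elements \<open>\<delta>(x)\<close>, one for each edge and with the flow as
  exponent (\<open>eq_on_flow_kernel\<close>). On \<open>D\<close> the flow is a homomorphism to a torsion-free abelian group.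
  It vanishes on \<open>C\<^sub>2 \<subseteq> [D, D]\<close>, hence on \<open>r\<close>, and so \<open>\<delta>(r) = 1\<close>.

  In the pro-\<open>p\<close> case all this is done in a finite quotient of the discrete free group, where \<open>A\<close>
  has exponent \<open>p\<^sup>j\<close> and only the flow modulo a power of \<open>p\<close> matters. The words of \<open>D\<close> whose flow
  is divisible by \<open>p\<^sup>k p\<^sup>j\<close> form a normal subgroup of \<open>p\<close>-power index
  (\<open>p_power_normal_flow_kernel\<close>), that is, an open condition on the free pro-\<open>p\<close>-group. Hence it
  passes from commutators to the closure of the subgroup that they generate
  (\<open>endomorphism_fixes_torsion_modulo\<close>).
\<close>

section \<open>Free groups\<close>

lemma reduced_word_tail: "reduced_word (a # w) \<Longrightarrow> reduced_word w"
  by (cases w) auto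

lemma push_letter_reduced: "reduced_word w \<Longrightarrow> reduced_word (push_letter a w)"
  by (cases w) (auto dest: reduced_word_tail)

lemma push_letter_of_reduced: "reduced_word (a # w) \<Longrightarrow> push_letter a w = a # w"
  by (cases w) auto

lemma push_letter_cancel:
  assumes "reduced_word w"
  shows "push_letter (x, \<not> b) (push_letter (x, b) w) = w"
proof (cases w)
  case Nil
  then show ?thesis by simp
next
  case (Cons c v)
  obtain y d where c: "c = (y, d)" by (cases c)
  show ?thesis
  proof (cases v)
    case Nil
    then show ?thesis using Cons c by auto
  next
    case (Cons e u)
    obtain z f where e: "e = (z, f)" by (cases e)
    then show ?thesis using \<open>w = c # v\<close> Cons c e assms by auto
  qed
qed

lemma foldr_push_reduced: "reduced_word w \<Longrightarrow> reduced_word (foldr push_letter u w)"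
  by (induction u) (auto simp: push_letter_reduced)

text \<open>This says that \<open>u \<mapsto> foldr push_letter u\<close> is an action of the free group on reduced words, which
  is where associativity comes from (van der Waerden's trick).\<close>

lemma foldr_push_push:
  assumes "reduced_word u" "reduced_word w"
  shows "foldr push_letter (push_letter a u) w = push_letter a (foldr push_letter u w)"
proof (cases u)
  case Nil
  then show ?thesis by simp
next
  case (Cons b v)
  obtain x c where a: "a = (x, c)" by (cases a)
  show ?thesis
  proof (cases "fst a = fst b \<and> snd a \<noteq> snd b")
    case True
    then have b: "b = (x, \<not> c)" using a by (cases b) auto
    have "push_letter a (foldr push_letter u w) = foldr push_letter v w"
      using push_letter_cancel[of "foldr push_letter v w" x "\<not> c"] foldr_push_reduced[OF assms(2)]
      by (simp add: Cons a b)
    then show ?thesis using True Cons by simp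
  next
    case False
    then show ?thesis using Cons by auto
  qed
qed

lemma foldr_push_foldr:
  assumes "reduced_word v" "reduced_word w"
  shows "foldr push_letter (foldr push_letter u v) w = foldr push_letter u (foldr push_letter v w)"
  using assms by (induction u) (auto simp: foldr_push_push foldr_push_reduced)

lemma push_letter_letters: "fst ` set (push_letter a w) \<subseteq> insert (fst a) (fst ` set w)"
  by (cases w) auto

lemma foldr_push_letters: "fst ` set (foldr push_letter u w) \<subseteq> fst ` set u \<union> fst ` set w"
proof (induction u)
  case (Cons a u)
  then show ?case using push_letter_letters[of a "foldr push_letter u w"] by (simp, blast)
qed simp

abbreviation invert_word :: "('x \<times> bool) list \<Rightarrow> ('x \<times> bool) list" where
  "invert_word u \<equiv> rev (map (\<lambda>(x, b). (x, \<not> b)) u)"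

lemma foldr_push_invert:
  "reduced_word w \<Longrightarrow> foldr push_letter (invert_word u) (foldr push_letter u w) = w"
proof (induction u)
  case (Cons a u)
  obtain x b where "a = (x, b)" by (cases a)
  then show ?case using Cons push_letter_cancel[of "foldr push_letter u w" x b]
    by (simp add: foldr_push_reduced)
qed simp

lemma carrier_free_group: "w \<in> carrier (free_group X) \<longleftrightarrow> reduced_word w \<and> fst ` set w \<subseteq> X"
  and mult_free_group: "u \<otimes>\<^bsub>free_group X\<^esub> v = foldr push_letter u v"
  and one_free_group: "\<one>\<^bsub>free_group X\<^esub> = []"
  by (simp_all add: free_group_def)

lemma foldr_push_Nil: "reduced_word u \<Longrightarrow> foldr push_letter u [] = u"
proof (induction u)
  case (Cons a u)
  then have "foldr push_letter u [] = u" by (auto dest: reduced_word_tail)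
  then show ?case using push_letter_of_reduced[OF Cons.prems] by simp
qed simp

lemma group_free_group: "group (free_group X)"
proof (rule groupI)
  fix u v w
  assume u: "u \<in> carrier (free_group X)" and v: "v \<in> carrier (free_group X)"
  then have "fst ` set (foldr push_letter u v) \<subseteq> X"
    unfolding carrier_free_group by (meson Un_least foldr_push_letters order_trans)
  then show "u \<otimes>\<^bsub>free_group X\<^esub> v \<in> carrier (free_group X)"
    using v by (simp add: carrier_free_group mult_free_group foldr_push_reduced)
  assume w: "w \<in> carrier (free_group X)"
  show "u \<otimes>\<^bsub>free_group X\<^esub> v \<otimes>\<^bsub>free_group X\<^esub> w = u \<otimes>\<^bsub>free_group X\<^esub> (v \<otimes>\<^bsub>free_group X\<^esub> w)"
    using u v w by (simp add: carrier_free_group mult_free_group foldr_push_foldr)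
next
  fix u assume u: "u \<in> carrier (free_group X)"
  let ?v = "foldr push_letter (invert_word u) []"
  have "fst ` set (invert_word u) \<subseteq> X"
    using u by (force simp: carrier_free_group)
  then have "?v \<in> carrier (free_group X)"
    using foldr_push_letters[of "invert_word u" "[]"] foldr_push_reduced[of "[]" "invert_word u"]
    by (auto simp: carrier_free_group)
  moreover have "?v \<otimes>\<^bsub>free_group X\<^esub> u = \<one>\<^bsub>free_group X\<^esub>"
    using u foldr_push_foldr[of "[]" u "invert_word u"] foldr_push_invert[of "[]" u]
    by (simp add: carrier_free_group mult_free_group one_free_group foldr_push_Nil)
  ultimately show "\<exists>v\<in>carrier (free_group X). v \<otimes>\<^bsub>free_group X\<^esub> u = \<one>\<^bsub>free_group X\<^esub>"
    by blast
qed (auto simp: carrier_free_group mult_free_group one_free_group)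

interpretation free: group "free_group X" for X :: "'x set"
  by (rule group_free_group)

lemma free_Cons:
  assumes "a # w \<in> carrier (free_group X)"
  shows "[a] \<in> carrier (free_group X)" "w \<in> carrier (free_group X)" "fst a \<in> X"
    "a # w = [a] \<otimes>\<^bsub>free_group X\<^esub> w"
  using assms push_letter_of_reduced[of a w]
  by (auto simp: carrier_free_group mult_free_group dest: reduced_word_tail)

lemma inv_letter:
  assumes "x \<in> X"
  shows "inv\<^bsub>free_group X\<^esub> [(x, b)] = [(x, \<not> b)]"
  using assms by (intro free.inv_equality) (auto simp: carrier_free_group mult_free_group one_free_group)

lemma letter_in_free: "[(x, b)] \<in> carrier (free_group X) \<longleftrightarrow> x \<in> X"
  by (simp add: carrier_free_group)

lemma free_group_hom_eqI:
  assumes G: "group G" and f: "f \<in> hom (free_group X) G" and g: "g \<in> hom (free_group X) G"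
    and eq: "\<And>x. x \<in> X \<Longrightarrow> f [(x, True)] = g [(x, True)]"
    and w: "w \<in> carrier (free_group X)"
  shows "f w = g w"
proof -
  interpret f: group_hom "free_group X" G f
    using f G by (simp add: group_hom_def group_hom_axioms_def group_free_group)
  interpret g: group_hom "free_group X" G g
    using g G by (simp add: group_hom_def group_hom_axioms_def group_free_group)
  have letter: "f [(x, b)] = g [(x, b)]" if "x \<in> X" for x b
    using f.hom_inv[of "[(x, True)]"] g.hom_inv[of "[(x, True)]"] eq[OF that] that
    by (cases b) (auto simp: inv_letter letter_in_free)
  show ?thesis
    using w
  proof (induction w)
    case Nil
    then show ?case using f.hom_one g.hom_one by (simp add: one_free_group)
  next
    case (Cons a w)
    obtain x b where "a = (x, b)" by (cases a)
    then show ?case using free_Cons[OF Cons.prems] Cons.IH letter[of x b] by auto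
  qed
qed

definition free_lift :: "('g, 'm) monoid_scheme \<Rightarrow> ('x \<Rightarrow> 'g) \<Rightarrow> ('x \<times> bool) list \<Rightarrow> 'g" where
  "free_lift G g w =
     foldr (\<lambda>(x, b) y. (if b then g x else inv\<^bsub>G\<^esub> g x) \<otimes>\<^bsub>G\<^esub> y) w \<one>\<^bsub>G\<^esub>"

lemma free_lift:
  assumes G: "group G" and g: "\<And>x. x \<in> X \<Longrightarrow> g x \<in> carrier G"
  shows "free_lift G g \<in> hom (free_group X) G"
    and "x \<in> X \<Longrightarrow> free_lift G g [(x, True)] = g x"
proof -
  interpret group G by (rule G)
  have closed: "free_lift G g w \<in> carrier G" if "fst ` set w \<subseteq> X" for w
    using that by (induction w) (auto simp: free_lift_def g)
  have push: "free_lift G g (push_letter (x, b) w) = (if b then g x else inv\<^bsub>G\<^esub> g x) \<otimes>\<^bsub>G\<^esub> free_lift G g w"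
    if "x \<in> X" "fst ` set w \<subseteq> X" for x b w
  proof (cases w)
    case Nil
    then show ?thesis by (simp add: free_lift_def)
  next
    case (Cons c v)
    obtain y d where c: "c = (y, d)" by (cases c)
    have "free_lift G g v \<in> carrier G" using closed that Cons by auto
    then have "free_lift G g v = g x \<otimes>\<^bsub>G\<^esub> (inv\<^bsub>G\<^esub> g x \<otimes>\<^bsub>G\<^esub> free_lift G g v)"
      "free_lift G g v = inv\<^bsub>G\<^esub> g x \<otimes>\<^bsub>G\<^esub> (g x \<otimes>\<^bsub>G\<^esub> free_lift G g v)"
      using g[OF that(1)] by (simp_all flip: m_assoc)
    then show ?thesis
      unfolding Cons c by (cases b; cases d; cases "x = y") (simp_all add: free_lift_def)
  qed
  have "free_lift G g (foldr push_letter u v) = free_lift G g u \<otimes>\<^bsub>G\<^esub> free_lift G g v"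
    if "fst ` set u \<subseteq> X" "fst ` set v \<subseteq> X" for u v
    using that(1)
  proof (induction u)
    case Nil
    then show ?case using closed that by (simp add: free_lift_def)
  next
    case (Cons a u)
    obtain x b where a: "a = (x, b)" by (cases a)
    have X: "x \<in> X" "fst ` set u \<subseteq> X" using Cons.prems a by auto
    have "fst ` set (foldr push_letter u v) \<subseteq> X"
      using foldr_push_letters[of u v] X that by blast
    then show ?case
      using Cons.IH[OF X(2)] closed[OF X(2)] closed[OF that(2)] X a push
      by (auto simp: free_lift_def g m_assoc)
  qed
  then show "free_lift G g \<in> hom (free_group X) G"
    using closed by (auto simp: hom_def carrier_free_group mult_free_group)
  show "x \<in> X \<Longrightarrow> free_lift G g [(x, True)] = g x"
    by (simp add: free_lift_def g)
qed

text \<open>The projectivity of free groups: \<open>s\<close> is determined by choosing preimages under \<open>g\<close> of the images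
  of the generators.\<close>

lemma free_group_lift:
  assumes G: "group G" and f: "f \<in> hom (free_group X) G" and L: "group L" and g: "g \<in> epi L G"
  shows "\<exists>s\<in>hom (free_group X) L. \<forall>w\<in>carrier (free_group X). g (s w) = f w"
proof -
  have "\<exists>y\<in>carrier L. g y = f [(x, True)]" if "x \<in> X" for x
  proof -
    have "f [(x, True)] \<in> g ` carrier L"
      using hom_in_carrier[OF f, of "[(x, True)]"] that g by (simp add: letter_in_free epi_def)
    then show ?thesis by (rule imageE) auto
  qed
  then obtain y where y: "\<And>x. x \<in> X \<Longrightarrow> y x \<in> carrier L" "\<And>x. x \<in> X \<Longrightarrow> g (y x) = f [(x, True)]"
    by metis
  let ?s = "free_lift L y"
  have s: "?s \<in> hom (free_group X) L" using free_lift(1)[OF L y(1)] .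
  have "(g \<circ> ?s) \<in> hom (free_group X) G"
    using hom_compose[OF s, of g G] g by (simp add: epi_def)
  moreover have "(g \<circ> ?s) [(x, True)] = f [(x, True)]" if "x \<in> X" for x
    using free_lift(2)[OF L y(1) that] y(2)[OF that] by simp
  ultimately have "(g \<circ> ?s) w = f w" if "w \<in> carrier (free_group X)" for w
    using free_group_hom_eqI[OF G _ f _ that] by blast
  then show ?thesis using s by auto
qed

section \<open>Flows along words in Schreier graphs\<close>

text \<open>Words are read from right to left, so prepending the letter \<open>a\<close> to \<open>w\<close> moves from the coset \<open>D w\<close> to
  \<open>D a w\<close>. The edge with label \<open>x\<close> at the coset \<open>c\<close> is the pair \<open>(c, x)\<close>; the letter \<open>(x, False)\<close>
  runs backwards through the edge that starts at the coset it leads to.\<close>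

definition step_flow ::
    "'x set \<Rightarrow> ('x \<times> bool) list set \<Rightarrow> 'x \<times> bool \<Rightarrow> ('x \<times> bool) list
      \<Rightarrow> ('x \<times> bool) list set \<times> 'x \<Rightarrow> int" where
  "step_flow X D a w e =
     (if snd a then of_bool (e = (D #>\<^bsub>free_group X\<^esub> w, fst a))
      else - of_bool (e = (D #>\<^bsub>free_group X\<^esub> push_letter a w, fst a)))"

text \<open>In terms of Fox calculus, \<open>flow X D w (c, x)\<close> is the coefficient at \<open>c\<close> of the derivative of \<open>w\<close> with
  respect to \<open>x\<close>, reduced modulo \<open>D\<close>, up to the passage from left to right derivatives.\<close>

primrec flow ::
    "'x set \<Rightarrow> ('x \<times> bool) list set \<Rightarrow> ('x \<times> bool) list
      \<Rightarrow> ('x \<times> bool) list set \<times> 'x \<Rightarrow> int" where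
  "flow X D [] = (\<lambda>e. 0)"
| "flow X D (a # w) = (\<lambda>e. flow X D w e + step_flow X D a w e)"

lemma flow_push:
  assumes "reduced_word w"
  shows "flow X D (push_letter a w) e = flow X D w e + step_flow X D a w e"
proof (cases w)
  case Nil
  then show ?thesis by simp
next
  case (Cons b v)
  show ?thesis
  proof (cases "fst a = fst b \<and> snd a \<noteq> snd b")
    case True
    obtain x c where a: "a = (x, c)" by (cases a)
    with True have b: "b = (x, \<not> c)" by (cases b) auto
    have "push_letter b v = w"
      using push_letter_of_reduced[of b v] assms Cons by auto
    then have "step_flow X D a w e + step_flow X D b v e = 0"
      using Cons by (auto simp: a b step_flow_def)
    then show ?thesis using True Cons by simp
  next
    case False
    then show ?thesis using Cons by auto
  qed
qed

text \<open>The path of \<open>u v\<close> is the path of \<open>v\<close> followed by the path of \<open>u\<close> with its starting point moved from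
  \<open>D\<close> to \<open>D v\<close>.\<close>

lemma flow_mult:
  assumes D: "D \<subseteq> carrier (free_group X)" and u: "u \<in> carrier (free_group X)"
    and v: "v \<in> carrier (free_group X)" and c: "c \<subseteq> carrier (free_group X)"
  shows "flow X D (u \<otimes>\<^bsub>free_group X\<^esub> v) (c, x) =
    flow X D v (c, x) + flow X D u (c #>\<^bsub>free_group X\<^esub> inv\<^bsub>free_group X\<^esub> v, x)"
  using u
proof (induction u)
  case Nil
  then show ?case by (simp add: mult_free_group)
next
  case (Cons a u)
  let ?F = "free_group X"
  note a = free_Cons[OF Cons.prems]
  have red: "reduced_word (u \<otimes>\<^bsub>?F\<^esub> v)"
    using free.m_closed[OF a(2) v] by (simp add: carrier_free_group)
  have push: "push_letter a (u \<otimes>\<^bsub>?F\<^esub> v) = [a] \<otimes>\<^bsub>?F\<^esub> u \<otimes>\<^bsub>?F\<^esub> v"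
      "push_letter a u = [a] \<otimes>\<^bsub>?F\<^esub> u"
    using a v by (simp_all add: free.m_assoc) (simp_all add: mult_free_group)
  have coset: "D #>\<^bsub>?F\<^esub> (w \<otimes>\<^bsub>?F\<^esub> v) = c \<longleftrightarrow> D #>\<^bsub>?F\<^esub> w = c #>\<^bsub>?F\<^esub> inv\<^bsub>?F\<^esub> v"
    if "w \<in> carrier ?F" for w
  proof
    assume "D #>\<^bsub>?F\<^esub> (w \<otimes>\<^bsub>?F\<^esub> v) = c"
    then have "c #>\<^bsub>?F\<^esub> inv\<^bsub>?F\<^esub> v = D #>\<^bsub>?F\<^esub> (w \<otimes>\<^bsub>?F\<^esub> v \<otimes>\<^bsub>?F\<^esub> inv\<^bsub>?F\<^esub> v)"
      using that v D by (auto simp: free.coset_mult_assoc)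
    then show "D #>\<^bsub>?F\<^esub> w = c #>\<^bsub>?F\<^esub> inv\<^bsub>?F\<^esub> v"
      using that v by (simp add: free.m_assoc)
  next
    assume "D #>\<^bsub>?F\<^esub> w = c #>\<^bsub>?F\<^esub> inv\<^bsub>?F\<^esub> v"
    then have "D #>\<^bsub>?F\<^esub> w #>\<^bsub>?F\<^esub> v = c #>\<^bsub>?F\<^esub> (inv\<^bsub>?F\<^esub> v \<otimes>\<^bsub>?F\<^esub> v)"
      using v c by (simp only: free.coset_mult_assoc free.inv_closed)
    then show "D #>\<^bsub>?F\<^esub> (w \<otimes>\<^bsub>?F\<^esub> v) = c"
      using that v c D by (simp add: free.coset_mult_assoc)
  qed
  have "step_flow X D a (u \<otimes>\<^bsub>?F\<^esub> v) (c, x)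
      = step_flow X D a u (c #>\<^bsub>?F\<^esub> inv\<^bsub>?F\<^esub> v, x)"
    unfolding step_flow_def push prod.inject eq_commute[of c] eq_commute[of "c #>\<^bsub>?F\<^esub> inv\<^bsub>?F\<^esub> v"]
      coset[OF a(2)] coset[OF free.m_closed[OF a(1,2)]] ..
  moreover have "(a # u) \<otimes>\<^bsub>?F\<^esub> v = push_letter a (u \<otimes>\<^bsub>?F\<^esub> v)"
    by (simp add: mult_free_group)
  ultimately show ?case
    using Cons.IH[OF a(2)] flow_push[OF red, of X D a "(c, x)"] by (simp add: mult_free_group)
qed

lemma (in normal) nat_pow_mem: "h \<in> H \<Longrightarrow> h [^] (k::nat) \<in> H"
  by (induction k) auto

lemma (in normal) coset_eq_self_iff: "g \<in> carrier G \<Longrightarrow> H #> g = H \<longleftrightarrow> g \<in> H"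
  using coset_join1 coset_join2 subgroup_axioms by blast

lemma (in normal) coset_mult_mem:
  assumes "c \<in> rcosets H" "h \<in> H"
  shows "c #> h = c"
proof -
  obtain g where g: "g \<in> carrier G" "c = H #> g"
    using assms(1) by (auto simp: RCOSETS_def)
  have "H #> (g \<otimes> h) = H #> (g \<otimes> h \<otimes> inv g \<otimes> g)"
    using g assms(2) by (simp add: m_assoc)
  also have "\<dots> = H #> g"
    using g assms(2) inv_op_closed2 by (metis coset_mult_assoc is_group inv_closed m_closed mem_carrier rcos_const subset)
  finally show ?thesis
    using g assms(2) by (simp add: coset_mult_assoc subset)
qed

text \<open>The case \<open>m = 0\<close>, in which the flow itself must vanish, serves for discrete groups; powers of a
  prime serve for pro-\<open>p\<close>-groups.\<close>

definition flow_kernel ::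
    "'x set \<Rightarrow> ('x \<times> bool) list set \<Rightarrow> nat \<Rightarrow> ('x \<times> bool) list set" where
  "flow_kernel X D m =
     {u \<in> D. \<forall>c\<in>rcosets\<^bsub>free_group X\<^esub> D. \<forall>x\<in>X. int m dvd flow X D u (c, x)}"

locale schreier_flow = normal D "free_group X" for X :: "'x set" and D
begin

abbreviation (input) "F \<equiv> free_group X"

lemma flow_mult_left:
  assumes "c \<in> rcosets\<^bsub>F\<^esub> D" "u \<in> carrier F" "v \<in> D"
  shows "flow X D (u \<otimes>\<^bsub>F\<^esub> v) (c, x) = flow X D u (c, x) + flow X D v (c, x)"
  using assms flow_mult[of D X u v c x] coset_mult_mem[of c "inv\<^bsub>F\<^esub> v"] subset
    rcosets_carrier[of c]
  by (simp add: group_free_group)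

lemma flow_inv:
  assumes "c \<in> rcosets\<^bsub>F\<^esub> D" "v \<in> carrier F"
  shows "flow X D (inv\<^bsub>F\<^esub> v) (c, x) = - flow X D v (c #>\<^bsub>F\<^esub> v, x)"
  using flow_mult[of D X v "inv\<^bsub>F\<^esub> v" c x] assms subset rcosets_carrier[of c]
  by (simp add: group_free_group one_free_group)

lemma rcosets_shift:
  assumes "c \<in> rcosets\<^bsub>F\<^esub> D" "v \<in> carrier F"
  shows "c #>\<^bsub>F\<^esub> v \<in> rcosets\<^bsub>F\<^esub> D"
  using assms subset by (auto simp: RCOSETS_def coset_mult_assoc)

lemma flow_inv_mem:
  assumes "c \<in> rcosets\<^bsub>F\<^esub> D" "v \<in> D"
  shows "flow X D (inv\<^bsub>F\<^esub> v) (c, x) = - flow X D v (c, x)"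
  using flow_inv[of c v x] coset_mult_mem[of c v] assms mem_carrier by simp

lemma flow_conj:
  assumes c: "c \<in> rcosets\<^bsub>F\<^esub> D" and v: "v \<in> carrier F" and u: "u \<in> D"
  shows "flow X D (v \<otimes>\<^bsub>F\<^esub> u \<otimes>\<^bsub>F\<^esub> inv\<^bsub>F\<^esub> v) (c, x) = flow X D u (c #>\<^bsub>F\<^esub> v, x)"
proof -
  have cv: "c #>\<^bsub>F\<^esub> v \<in> rcosets\<^bsub>F\<^esub> D" by (rule rcosets_shift[OF c v])
  show ?thesis
    using flow_mult[of D X "v \<otimes>\<^bsub>F\<^esub> u" "inv\<^bsub>F\<^esub> v" c x] flow_mult_left[OF cv v u, of x] flow_inv[OF c v, of x]
      v u subset rcosets_carrier[OF group_free_group c] mem_carrier by simp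
qed

lemma flow_pow:
  assumes "c \<in> rcosets\<^bsub>F\<^esub> D" "v \<in> D"
  shows "flow X D (v [^]\<^bsub>F\<^esub> (k::nat)) (c, x) = int k * flow X D v (c, x)"
proof (induction k)
  case 0
  then show ?case by (simp add: one_free_group)
next
  case (Suc k)
  then show ?case using flow_mult_left[of c "v [^]\<^bsub>F\<^esub> k" v x] assms mem_carrier
    by (simp add: algebra_simps)
qed

lemma flow_kernel_normal: "flow_kernel X D m \<lhd> F"
proof (rule free.normal_invI)
  show "subgroup (flow_kernel X D m) F"
    by (rule free.subgroupI)
      (auto simp: flow_kernel_def flow_mult_left flow_inv_mem mem_carrier one_free_group[symmetric]
         intro!: exI[of _ "\<one>\<^bsub>F\<^esub>"], simp add: one_free_group)
  fix u v assume "u \<in> carrier F" "v \<in> flow_kernel X D m"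
  then show "u \<otimes>\<^bsub>F\<^esub> v \<otimes>\<^bsub>F\<^esub> inv\<^bsub>F\<^esub> u \<in> flow_kernel X D m"
    using inv_op_closed2 rcosets_shift by (auto simp: flow_kernel_def flow_conj)
qed

lemma commutator_in_flow_kernel:
  assumes "u \<in> D" "v \<in> D"
  shows "u \<otimes>\<^bsub>F\<^esub> v \<otimes>\<^bsub>F\<^esub> inv\<^bsub>F\<^esub> u \<otimes>\<^bsub>F\<^esub> inv\<^bsub>F\<^esub> v \<in> flow_kernel X D m"
  using assms by (auto simp: flow_kernel_def flow_mult_left flow_inv_mem mem_carrier)

lemma flow_kernel_root:
  assumes "w \<in> D" "k > 0" "w [^]\<^bsub>F\<^esub> (k::nat) \<in> flow_kernel X D (k * m)"
  shows "w \<in> flow_kernel X D m"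
  using assms by (auto simp: flow_kernel_def flow_pow)

lemma flow_kernel_pow:
  assumes "w \<in> D"
  shows "w [^]\<^bsub>F\<^esub> m \<in> flow_kernel X D m"
  using assms nat_pow_mem by (auto simp: flow_kernel_def flow_pow)

text \<open>Hence the cosets of the flow kernel are told apart by finitely many data as soon as \<open>D\<close> has finite
  index and \<open>X\<close> is finite.\<close>

lemma flow_kernel_separates:
  assumes u: "u \<in> carrier F" and v: "v \<in> carrier F" and Duv: "D #>\<^bsub>F\<^esub> u = D #>\<^bsub>F\<^esub> v"
    and flow: "\<And>c x. c \<in> rcosets\<^bsub>F\<^esub> D \<Longrightarrow> x \<in> X \<Longrightarrow>
      flow X D u (c, x) mod int m = flow X D v (c, x) mod int m"
  shows "u \<otimes>\<^bsub>F\<^esub> inv\<^bsub>F\<^esub> v \<in> flow_kernel X D m"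
proof -
  let ?d = "u \<otimes>\<^bsub>F\<^esub> inv\<^bsub>F\<^esub> v"
  have "?d \<in> D"
    using rcos_module[OF group_free_group v u] rcos_self[OF u subgroup_axioms] Duv by auto
  moreover have "int m dvd flow X D ?d (c, x)" if c: "c \<in> rcosets\<^bsub>F\<^esub> D" and x: "x \<in> X" for c x
  proof -
    have "flow X D ?d (c, x) = flow X D u (c #>\<^bsub>F\<^esub> v, x) - flow X D v (c #>\<^bsub>F\<^esub> v, x)"
      using flow_mult[of D X u "inv\<^bsub>F\<^esub> v" c x] flow_inv[OF c v, of x] u v subset
        rcosets_carrier[OF group_free_group c] by simp
    then show ?thesis
      using flow[OF rcosets_shift[OF c v] x] by (simp add: mod_eq_dvd_iff)
  qed
  ultimately show ?thesis by (simp add: flow_kernel_def)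
qed

end

section \<open>Crossed homomorphisms of free groups\<close>

lemma centralizer_vimage_normal:
  assumes P: "group P" and F: "group F" and A: "A \<lhd> P" and q: "q \<in> hom F P"
  shows "{w \<in> carrier F. \<forall>a\<in>A. q w \<otimes>\<^bsub>P\<^esub> a = a \<otimes>\<^bsub>P\<^esub> q w} \<lhd> F"
    (is "?D \<lhd> F")
proof -
  interpret A: normal A P by (rule A)
  interpret q: group_hom F P q
    using q P F by (simp add: group_hom_def group_hom_axioms_def)
  have comm: "q w \<in> carrier P" "q w \<otimes>\<^bsub>P\<^esub> a \<otimes>\<^bsub>P\<^esub> inv\<^bsub>P\<^esub> q w = a" if "w \<in> ?D" "a \<in> A" for w a
    using that A.mem_carrier by (auto simp: A.m_assoc)
  have I: "w \<in> ?D" if "w \<in> carrier F" "\<And>a. a \<in> A \<Longrightarrow> q w \<otimes>\<^bsub>P\<^esub> a \<otimes>\<^bsub>P\<^esub> inv\<^bsub>P\<^esub> q w = a" for w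
    using that A.mem_carrier by (auto simp: A.inv_solve_right')
  show ?thesis
  proof (rule q.G.normal_invI)
    show "subgroup ?D F"
    proof (rule q.G.subgroupI)
      show "?D \<noteq> {}" using A.mem_carrier by (auto intro!: exI[of _ "\<one>\<^bsub>F\<^esub>"])
      fix v assume v: "v \<in> ?D"
      show "inv\<^bsub>F\<^esub> v \<in> ?D"
      proof (rule I)
        fix a assume a: "a \<in> A"
        then have "a \<otimes>\<^bsub>P\<^esub> q v = q v \<otimes>\<^bsub>P\<^esub> a" using v by simp
        then show "q (inv\<^bsub>F\<^esub> v) \<otimes>\<^bsub>P\<^esub> a \<otimes>\<^bsub>P\<^esub> inv\<^bsub>P\<^esub> q (inv\<^bsub>F\<^esub> v) = a"
          using conjunct1[OF v[unfolded mem_Collect_eq]] A.mem_carrier[OF a] by (simp add: A.m_assoc)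
            (simp flip: A.m_assoc)
      qed (use v in auto)
      fix u assume u: "u \<in> ?D"
      show "u \<otimes>\<^bsub>F\<^esub> v \<in> ?D"
      proof (rule I)
        fix a assume a: "a \<in> A"
        have "q u \<otimes>\<^bsub>P\<^esub> (q v \<otimes>\<^bsub>P\<^esub> a \<otimes>\<^bsub>P\<^esub> inv\<^bsub>P\<^esub> q v) \<otimes>\<^bsub>P\<^esub> inv\<^bsub>P\<^esub> q u = a"
          using comm u v a by simp
        then show "q (u \<otimes>\<^bsub>F\<^esub> v) \<otimes>\<^bsub>P\<^esub> a \<otimes>\<^bsub>P\<^esub> inv\<^bsub>P\<^esub> q (u \<otimes>\<^bsub>F\<^esub> v) = a"
          using u v A.mem_carrier[OF a] by (simp add: A.m_assoc A.inv_mult_group)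
      qed (use u v in auto)
    qed auto
    fix g v assume g: "g \<in> carrier F" and v: "v \<in> ?D"
    show "g \<otimes>\<^bsub>F\<^esub> v \<otimes>\<^bsub>F\<^esub> inv\<^bsub>F\<^esub> g \<in> ?D"
    proof (rule I)
      fix a assume a: "a \<in> A"
      let ?a = "inv\<^bsub>P\<^esub> q g \<otimes>\<^bsub>P\<^esub> a \<otimes>\<^bsub>P\<^esub> q g"
      have "q v \<otimes>\<^bsub>P\<^esub> ?a \<otimes>\<^bsub>P\<^esub> inv\<^bsub>P\<^esub> q v = ?a"
        using A.inv_op_closed1[of "q g" a] g v a comm by simp
      then have "q g \<otimes>\<^bsub>P\<^esub> (q v \<otimes>\<^bsub>P\<^esub> ?a \<otimes>\<^bsub>P\<^esub> inv\<^bsub>P\<^esub> q v) \<otimes>\<^bsub>P\<^esub> inv\<^bsub>P\<^esub> q g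
          = q g \<otimes>\<^bsub>P\<^esub> ?a \<otimes>\<^bsub>P\<^esub> inv\<^bsub>P\<^esub> q g" by simp
      also have "\<dots> = a"
        using g A.mem_carrier[OF a] by (simp add: A.m_assoc flip: A.m_assoc[of "q g" "inv\<^bsub>P\<^esub> q g"])
      finally show "q (g \<otimes>\<^bsub>F\<^esub> v \<otimes>\<^bsub>F\<^esub> inv\<^bsub>F\<^esub> g) \<otimes>\<^bsub>P\<^esub> a \<otimes>\<^bsub>P\<^esub> inv\<^bsub>P\<^esub> q (g \<otimes>\<^bsub>F\<^esub> v \<otimes>\<^bsub>F\<^esub> inv\<^bsub>F\<^esub> g) = a"
        using g v A.mem_carrier[OF a] by (simp add: A.m_assoc A.inv_mult_group)
    qed (use g v in auto)
  qed
qed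

lemma (in comm_group) finprod_pow_insert:
  assumes S: "finite S" and b: "\<And>e. e \<in> insert d S \<Longrightarrow> b e \<in> carrier G"
    and f: "\<And>e. e \<notin> S \<Longrightarrow> f e = 0"
  shows "finprod G (\<lambda>e. b e [^] (f e + (if e = d then k else 0 :: int))) (insert d S) =
    finprod G (\<lambda>e. b e [^] f e) S \<otimes> b d [^] k"
proof -
  have "finprod G (\<lambda>e. b e [^] (f e + (if e = d then k else 0))) (insert d S)
      = finprod G (\<lambda>e. b e [^] f e \<otimes> (if d = e then b e [^] k else \<one>)) (insert d S)"
    by (rule finprod_cong') (use b in \<open>auto simp: int_pow_mult\<close>)
  also have "\<dots> = finprod G (\<lambda>e. b e [^] f e) (insert d S) \<otimes>
      finprod G (\<lambda>e. if d = e then b e [^] k else \<one>) (insert d S)"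
    using S b by (subst finprod_multf) auto
  also have "finprod G (\<lambda>e. if d = e then b e [^] k else \<one>) (insert d S) = b d [^] k"
    using S b by (intro finprod_singleton) auto
  also have "finprod G (\<lambda>e. b e [^] f e) (insert d S) = finprod G (\<lambda>e. b e [^] f e) S"
    using S b f by (intro finprod_mono_neutral_cong_right) auto
  finally show ?thesis .
qed

text \<open>The map \<open>\<delta>(w) = q(w)\<inverse> r(w)\<close> satisfies \<open>\<delta>(v w) = q(w)\<inverse> \<delta>(v) q(w) \<delta>(w)\<close>. Thus prepending a letter
  \<open>x\<close> to \<open>w\<close> multiplies \<open>\<delta>(w)\<close> by the conjugate of \<open>\<delta>(x)\<close> under \<open>q(w)\<close>, which depends only on the
  coset \<open>D w\<close> since \<open>q(D)\<close> centralizes \<open>A\<close>. Collecting equal factors gives the product formula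
  \<open>\<delta>(w) = \<Prod>\<^sub>e b(e)\<^bsup>flow(w, e)\<^esup>\<close> over the edges \<open>e\<close> of the Schreier graph, and every factor is
  trivial when the flow is divisible by an exponent of \<open>A\<close>.\<close>

lemma eq_on_flow_kernel:
  assumes P: "group P" and A: "A \<lhd> P"
    and comm: "\<And>a b. a \<in> A \<Longrightarrow> b \<in> A \<Longrightarrow> a \<otimes>\<^bsub>P\<^esub> b = b \<otimes>\<^bsub>P\<^esub> a"
    and q: "q \<in> hom (free_group X) P" and r: "r \<in> hom (free_group X) P"
    and qr: "\<And>w. w \<in> carrier (free_group X) \<Longrightarrow> inv\<^bsub>P\<^esub> q w \<otimes>\<^bsub>P\<^esub> r w \<in> A"
    and D: "D = {w \<in> carrier (free_group X). \<forall>a\<in>A. q w \<otimes>\<^bsub>P\<^esub> a = a \<otimes>\<^bsub>P\<^esub> q w}"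
    and exp: "\<And>a. a \<in> A \<Longrightarrow> a [^]\<^bsub>P\<^esub> m = \<one>\<^bsub>P\<^esub>"
    and w: "w \<in> flow_kernel X D m"
  shows "q w = r w"
proof -
  let ?F = "free_group X" and ?B = "P\<lparr>carrier := A\<rparr>"
  interpret A: normal A P by (rule A)
  interpret q: group_hom ?F P q
    using q P by (simp add: group_hom_def group_hom_axioms_def group_free_group)
  interpret r: group_hom ?F P r
    using r P by (simp add: group_hom_def group_hom_axioms_def group_free_group)
  interpret schreier_flow X D
    unfolding schreier_flow_def D by (rule centralizer_vimage_normal[OF P group_free_group A q])
  interpret B: comm_group ?B
    by (rule group.group_comm_groupI[OF A.subgroup_is_group[OF P]]) (simp add: comm)
  have finprod_closed: "finprod ?B f S \<in> A" if "\<And>e. e \<in> S \<Longrightarrow> f e \<in> A" for f :: "_ \<Rightarrow> _" and S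
    using B.finprod_closed[of f S] that by auto
  define \<delta> where "\<delta> w = inv\<^bsub>P\<^esub> q w \<otimes>\<^bsub>P\<^esub> r w" for w
  have \<delta>_mem: "\<delta> w \<in> A" if "w \<in> carrier ?F" for w
    using qr[OF that] by (simp add: \<delta>_def)
  \<comment> \<open>Any word \<open>u\<close> in the starting coset of the edge gives the same conjugate, by the choice of \<open>D\<close>.\<close>
  define b where "b e = (let u = SOME u. u \<in> fst e in
      inv\<^bsub>P\<^esub> q u \<otimes>\<^bsub>P\<^esub> \<delta> [(snd e, True)] \<otimes>\<^bsub>P\<^esub> q u)" for e
  have b: "b (D #>\<^bsub>?F\<^esub> w, x) = inv\<^bsub>P\<^esub> q w \<otimes>\<^bsub>P\<^esub> \<delta> [(x, True)] \<otimes>\<^bsub>P\<^esub> q w"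
    if w: "w \<in> carrier ?F" and x: "x \<in> X" for w x
  proof -
    define u where "u = (SOME u. u \<in> D #>\<^bsub>?F\<^esub> w)"
    have "u \<in> D #>\<^bsub>?F\<^esub> w"
      unfolding u_def using free.rcos_self[OF w subgroup_axioms] by (rule someI)
    then obtain d where d: "d \<in> D" "u = d \<otimes>\<^bsub>?F\<^esub> w" by (auto simp: r_coset_def)
    have dF: "d \<in> carrier ?F" and dA: "\<And>a. a \<in> A \<Longrightarrow> q d \<otimes>\<^bsub>P\<^esub> a = a \<otimes>\<^bsub>P\<^esub> q d"
      using d(1) unfolding D by blast+
    have a: "\<delta> [(x, True)] \<in> A" using \<delta>_mem x by (simp add: letter_in_free)
    from dA[OF this] have "inv\<^bsub>P\<^esub> q d \<otimes>\<^bsub>P\<^esub> \<delta> [(x, True)] \<otimes>\<^bsub>P\<^esub> q d = \<delta> [(x, True)]"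
      using dF A.mem_carrier[OF a] by (metis A.inv_closed A.inv_solve_left A.m_assoc A.m_closed q.hom_closed)
    then have "inv\<^bsub>P\<^esub> q w \<otimes>\<^bsub>P\<^esub> (inv\<^bsub>P\<^esub> q d \<otimes>\<^bsub>P\<^esub> \<delta> [(x, True)] \<otimes>\<^bsub>P\<^esub> q d) \<otimes>\<^bsub>P\<^esub> q w
        = inv\<^bsub>P\<^esub> q w \<otimes>\<^bsub>P\<^esub> \<delta> [(x, True)] \<otimes>\<^bsub>P\<^esub> q w" by simp
    then show ?thesis
      using d dF w A.mem_carrier[OF a] by (simp add: b_def u_def[symmetric] Let_def A.m_assoc A.inv_mult_group)
  qed
  have b_mem: "b e \<in> A" if e: "e \<in> (rcosets\<^bsub>?F\<^esub> D) \<times> X" for e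
  proof -
    obtain c x where "e = (c, x)" "c \<in> rcosets\<^bsub>?F\<^esub> D" "x \<in> X"
      using e by (cases e) auto
    then obtain v where "e = (D #>\<^bsub>?F\<^esub> v, x)" "v \<in> carrier ?F" "x \<in> X"
      by (auto simp: RCOSETS_def)
    then show ?thesis using \<delta>_mem[of "[(x, True)]"] A.inv_op_closed1[of "q v"] by (simp add: b letter_in_free)
  qed
  have step: "\<delta> ([(x, True)] \<otimes>\<^bsub>?F\<^esub> v) = \<delta> v \<otimes>\<^bsub>P\<^esub> b (D #>\<^bsub>?F\<^esub> v, x)"
    if v: "v \<in> carrier ?F" and x: "x \<in> X" for v x
  proof -
    have l: "[(x, True)] \<in> carrier ?F" using x by (simp add: letter_in_free)
    have e: "(D #>\<^bsub>?F\<^esub> v, x) \<in> (rcosets\<^bsub>?F\<^esub> D) \<times> X"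
      using v x by (auto simp: RCOSETS_def)
    have "b (D #>\<^bsub>?F\<^esub> v, x) \<otimes>\<^bsub>P\<^esub> \<delta> v
        = inv\<^bsub>P\<^esub> q v \<otimes>\<^bsub>P\<^esub> \<delta> [(x, True)] \<otimes>\<^bsub>P\<^esub> (q v \<otimes>\<^bsub>P\<^esub> inv\<^bsub>P\<^esub> q v) \<otimes>\<^bsub>P\<^esub> r v"
      using v l by (simp only: b[OF v x] \<delta>_def A.m_assoc q.hom_closed r.hom_closed A.inv_closed A.m_closed)
    also have "\<dots> = \<delta> ([(x, True)] \<otimes>\<^bsub>?F\<^esub> v)"
      using v l by (simp add: \<delta>_def A.m_assoc A.inv_mult_group)
    finally show ?thesis using comm[OF b_mem[OF e] \<delta>_mem[OF v]] by simp
  qed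
  have pow: "a [^]\<^bsub>?B\<^esub> (1::int) = a" "a [^]\<^bsub>?B\<^esub> (-1::int) = inv\<^bsub>P\<^esub> a" if "a \<in> A" for a
    using that B.int_pow_1[of a] B.int_pow_neg[of a 1]
    by (simp_all add: A.m_inv_consistent[OF A.subgroup_axioms])
  have "\<exists>S. finite S \<and> S \<subseteq> (rcosets\<^bsub>?F\<^esub> D) \<times> X \<and> (\<forall>e. e \<notin> S \<longrightarrow> flow X D v e = 0) \<and>
      \<delta> v = finprod ?B (\<lambda>e. b e [^]\<^bsub>?B\<^esub> flow X D v e) S" if "v \<in> carrier ?F" for v
    using that
  proof (induction v)
    case Nil
    then show ?case
      using q.hom_one r.hom_one by (intro exI[of _ "{}"]) (simp add: \<delta>_def one_free_group)
  next
    case (Cons a v)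
    note v = free_Cons[OF Cons.prems]
    obtain S where S: "finite S" "S \<subseteq> (rcosets\<^bsub>?F\<^esub> D) \<times> X" "\<And>e. e \<notin> S \<Longrightarrow> flow X D v e = 0"
      and eq: "\<delta> v = finprod ?B (\<lambda>e. b e [^]\<^bsub>?B\<^esub> flow X D v e) S"
      using Cons.IH[OF v(2)] by blast
    obtain x s where a: "a = (x, s)" by (cases a)
    have x: "x \<in> X" using v(3) a by simp
    define d where "d = (D #>\<^bsub>?F\<^esub> (if s then v else a # v), x)"
    define k :: int where "k = (if s then 1 else -1)"
    have push: "push_letter a v = a # v"
      using Cons.prems push_letter_of_reduced[of a v] by (auto simp: carrier_free_group)
    have flow: "flow X D (a # v) e = flow X D v e + (if e = d then k else 0)" for e
      using push by (cases s) (auto simp: step_flow_def d_def k_def a)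
    have d: "d \<in> (rcosets\<^bsub>?F\<^esub> D) \<times> X"
      using v(2) Cons.prems x by (auto simp: RCOSETS_def d_def)
    have "\<delta> (a # v) = \<delta> v \<otimes>\<^bsub>P\<^esub> b d [^]\<^bsub>?B\<^esub> k"
    proof (cases s)
      case True
      then show ?thesis using step[OF v(2) x] v(4) pow(1)[OF b_mem[OF d]] by (simp add: d_def k_def a)
    next
      case False
      have "v = [(x, True)] \<otimes>\<^bsub>?F\<^esub> (a # v)"
        using push_letter_cancel[of v x False] v(2) push False
        by (simp add: mult_free_group a carrier_free_group)
      then have "\<delta> v = \<delta> (a # v) \<otimes>\<^bsub>P\<^esub> b d"
        using step[OF Cons.prems x] False by (simp add: d_def)
      then show ?thesis
        using \<delta>_mem[OF Cons.prems] b_mem[OF d] A.mem_carrier pow(2)[OF b_mem[OF d]] False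
        by (simp add: k_def A.m_assoc)
    qed
    also have "\<dots> = finprod ?B (\<lambda>e. b e [^]\<^bsub>?B\<^esub> flow X D (a # v) e) (insert d S)"
    proof -
      have "b e \<in> carrier ?B" if "e \<in> insert d S" for e
        using that S(2) d b_mem by auto
      from B.finprod_pow_insert[OF S(1) this S(3)] show ?thesis
        unfolding flow eq by simp
    qed
    finally show ?case
      using S d flow by (intro exI[of _ "insert d S"]) auto
  qed
  moreover have w_mem: "w \<in> carrier ?F"
    using w mem_carrier by (auto simp: flow_kernel_def)
  ultimately obtain S where S: "S \<subseteq> (rcosets\<^bsub>?F\<^esub> D) \<times> X"
      and eq: "\<delta> w = finprod ?B (\<lambda>e. b e [^]\<^bsub>?B\<^esub> flow X D w e) S"
    by blast
  have "b e [^]\<^bsub>?B\<^esub> flow X D w e = \<one>\<^bsub>?B\<^esub>" if "e \<in> S" for e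
  proof -
    have "e \<in> (rcosets\<^bsub>?F\<^esub> D) \<times> X" using that S by auto
    then have be: "b e \<in> A" and "int m dvd flow X D w e"
      using b_mem w by (auto simp: flow_kernel_def)
    then obtain k where k: "flow X D w e = int m * k" by (auto elim: dvdE)
    have "b e [^]\<^bsub>?B\<^esub> (int m) = \<one>\<^bsub>?B\<^esub>"
      using exp[OF be] A.nat_pow_consistent[of "b e" m A] by (simp add: int_pow_int)
    then show ?thesis
      using be B.int_pow_one[of k] by (simp add: k B.int_pow_pow[symmetric])
  qed
  then have "\<delta> w = \<one>\<^bsub>P\<^esub>"
    unfolding eq using B.finprod_one_eqI[of S] by simp
  then show ?thesis
    using w_mem by (simp add: \<delta>_def A.inv_solve_left')
qed

lemma (in group_hom) hom_commute:
  assumes "x \<in> carrier G" "y \<in> carrier G" "h (x \<otimes>\<^bsub>G\<^esub> y \<otimes>\<^bsub>G\<^esub> inv\<^bsub>G\<^esub> x \<otimes>\<^bsub>G\<^esub> inv\<^bsub>G\<^esub> y) = \<one>\<^bsub>H\<^esub>"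
  shows "h x \<otimes>\<^bsub>H\<^esub> h y = h y \<otimes>\<^bsub>H\<^esub> h x"
proof -
  have "h x \<otimes>\<^bsub>H\<^esub> h y \<otimes>\<^bsub>H\<^esub> inv\<^bsub>H\<^esub> (h y \<otimes>\<^bsub>H\<^esub> h x) = \<one>\<^bsub>H\<^esub>"
    using assms by (simp add: H.inv_mult_group H.m_assoc)
  then show ?thesis
    using assms by (metis H.inv_closed H.inv_equality H.inv_inv H.m_closed hom_closed)
qed

text \<open>The form in which the product formula is used for both kinds of presentations: \<open>L\<close> is the free
  group or the free pro-\<open>p\<close>-group, \<open>\<phi>\<close> is a quotient map of \<open>L\<close> that makes the image of \<open>R\<close> central
  in that of \<open>R M\<close>, and \<open>e\<close> is an endomorphism of \<open>L\<close> that induces the identity on \<open>L/R\<close>.\<close>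

lemma endomorphism_eq_on_flow_kernel:
  assumes L: "group L" and P: "group P" and \<phi>: "\<phi> \<in> hom L P" "\<phi> ` carrier L = carrier P"
    and \<eta>: "\<eta> \<in> hom (free_group X) L" and R: "R \<lhd> L" and M: "M \<subseteq> carrier L" "\<one>\<^bsub>L\<^esub> \<in> M"
    and comm: "\<forall>r\<in>R. \<forall>b\<in>R <#>\<^bsub>L\<^esub> M.
      \<phi> (r \<otimes>\<^bsub>L\<^esub> b \<otimes>\<^bsub>L\<^esub> inv\<^bsub>L\<^esub> r \<otimes>\<^bsub>L\<^esub> inv\<^bsub>L\<^esub> b) = \<one>\<^bsub>P\<^esub>"
    and D: "D = {w \<in> carrier (free_group X). \<forall>a\<in>\<phi> ` R. \<phi> (\<eta> w) \<otimes>\<^bsub>P\<^esub> a = a \<otimes>\<^bsub>P\<^esub> \<phi> (\<eta> w)}"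
  shows "D \<lhd> free_group X"
    and "\<And>w b. w \<in> carrier (free_group X) \<Longrightarrow> b \<in> R <#>\<^bsub>L\<^esub> M \<Longrightarrow> \<phi> (\<eta> w) = \<phi> b \<Longrightarrow> w \<in> D"
    and "\<And>e m w. e \<in> hom L L \<Longrightarrow> (\<And>x. x \<in> carrier L \<Longrightarrow> inv\<^bsub>L\<^esub> x \<otimes>\<^bsub>L\<^esub> e x \<in> R) \<Longrightarrow>
      (\<And>r. r \<in> R \<Longrightarrow> \<phi> r [^]\<^bsub>P\<^esub> (m::nat) = \<one>\<^bsub>P\<^esub>) \<Longrightarrow>
      w \<in> flow_kernel X D m \<Longrightarrow> \<phi> (\<eta> w) = \<phi> (e (\<eta> w))"
proof -
  interpret R: normal R L by (rule R)
  interpret \<phi>: group_hom L P \<phi> using \<phi> P L by (simp add: group_hom_def group_hom_axioms_def)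
  have A: "\<phi> ` R \<lhd> P" by (rule R.surj_hom_normal_subgroup[OF \<phi>.group_hom_axioms \<phi>(2)])
  have q: "(\<lambda>w. \<phi> (\<eta> w)) \<in> hom (free_group X) P"
    using hom_compose[OF \<eta> \<phi>(1)] by (simp add: comp_def)
  have RM: "R <#>\<^bsub>L\<^esub> M \<subseteq> carrier L" by (rule R.setmult_subset_G[OF R.subset M(1)])
  have R_sub: "R \<subseteq> R <#>\<^bsub>L\<^esub> M"
  proof
    fix r assume r: "r \<in> R"
    then have "r = r \<otimes>\<^bsub>L\<^esub> \<one>\<^bsub>L\<^esub>" using R.mem_carrier by simp
    then show "r \<in> R <#>\<^bsub>L\<^esub> M" using r M(2) unfolding set_mult_def by blast
  qed
  have commute: "\<phi> r \<otimes>\<^bsub>P\<^esub> \<phi> b = \<phi> b \<otimes>\<^bsub>P\<^esub> \<phi> r" if "r \<in> R" "b \<in> R <#>\<^bsub>L\<^esub> M" for r b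
    using \<phi>.hom_commute[OF R.mem_carrier[OF that(1)] subsetD[OF RM that(2)] comm[rule_format, OF that]] .
  show "D \<lhd> free_group X"
    unfolding D by (rule centralizer_vimage_normal[OF P group_free_group A q])
  show "w \<in> D" if "w \<in> carrier (free_group X)" "b \<in> R <#>\<^bsub>L\<^esub> M" "\<phi> (\<eta> w) = \<phi> b" for w b
    using that unfolding D by (auto intro: commute[symmetric])
  fix e and m :: nat and w
  assume e: "e \<in> hom L L" "\<And>x. x \<in> carrier L \<Longrightarrow> inv\<^bsub>L\<^esub> x \<otimes>\<^bsub>L\<^esub> e x \<in> R"
    and exp: "\<And>r. r \<in> R \<Longrightarrow> \<phi> r [^]\<^bsub>P\<^esub> m = \<one>\<^bsub>P\<^esub>" and w: "w \<in> flow_kernel X D m"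
  have r: "(\<lambda>w. \<phi> (e (\<eta> w))) \<in> hom (free_group X) P"
    using hom_compose[OF hom_compose[OF \<eta> e(1)] \<phi>(1)] by (simp add: comp_def)
  show "\<phi> (\<eta> w) = \<phi> (e (\<eta> w))"
  proof (rule eq_on_flow_kernel[OF P A _ q r _ D _ w])
    fix a b assume "a \<in> \<phi> ` R" "b \<in> \<phi> ` R"
    then show "a \<otimes>\<^bsub>P\<^esub> b = b \<otimes>\<^bsub>P\<^esub> a" using commute R_sub by blast
  next
    fix w assume "w \<in> carrier (free_group X)"
    then have \<eta>w: "\<eta> w \<in> carrier L" using \<eta> by (auto simp: hom_def)
    then have "e (\<eta> w) \<in> carrier L" using e(1) by (auto simp: hom_def)
    then have "inv\<^bsub>P\<^esub> \<phi> (\<eta> w) \<otimes>\<^bsub>P\<^esub> \<phi> (e (\<eta> w)) = \<phi> (inv\<^bsub>L\<^esub> \<eta> w \<otimes>\<^bsub>L\<^esub> e (\<eta> w))"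
      using \<eta>w by simp
    then show "inv\<^bsub>P\<^esub> \<phi> (\<eta> w) \<otimes>\<^bsub>P\<^esub> \<phi> (e (\<eta> w)) \<in> \<phi> ` R" using e(2)[OF \<eta>w] by simp
  qed (use exp in auto)
qed

section \<open>Normal subgroups of prime power index\<close>

text \<open>A converse of Lagrange's theorem for \<open>p\<close>-groups: for another prime \<open>q\<close> dividing the order,
  Sylow's theorem gives a subgroup of order \<open>q\<close>, whose elements are killed by \<open>q\<close> and a power of \<open>p\<close>.\<close>

lemma (in group) order_prime_powerI:
  assumes "prime p" and fin: "finite (carrier G)"
    and pow: "\<And>x. x \<in> carrier G \<Longrightarrow> \<exists>b::nat. x [^] (p ^ b) = \<one>"
  shows "\<exists>k::nat. Coset.order G = p ^ k"
proof -
  have ord: "Coset.order G \<noteq> 0" using order_gt_0_iff_finite fin by simp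
  have "\<not> is_unit p" using prime_gt_1_nat[OF \<open>prime p\<close>] by simp
  then obtain m where m: "Coset.order G = p ^ multiplicity p (Coset.order G) * m" "\<not> p dvd m"
    using multiplicity_decompose'[OF ord] by blast
  have "m = 1"
  proof (rule ccontr)
    assume "m \<noteq> 1"
    then obtain q where q: "prime q" "q dvd m" using prime_factor_nat by blast
    then obtain m' where "Coset.order G = q ^ 1 * m'" using m(1) by (metis dvdE mult.left_commute power_one_right)
    then obtain H where H: "subgroup H G" "card H = q"
      using sylow_thm[OF \<open>prime q\<close> group_axioms _ fin] by fastforce
    interpret H: group "G\<lparr>carrier := H\<rparr>"
      using subgroup.subgroup_is_group[OF H(1)] group_axioms by blast
    have "card H > 1" using H(2) q(1) prime_gt_1_nat by simp
    then have "\<not> H \<subseteq> {\<one>}" using card_mono[of "{\<one>}" H] by auto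
    then obtain h where h: "h \<in> H" "h \<noteq> \<one>" by blast
    have hG: "h \<in> carrier G" using subgroup.mem_carrier[OF H(1) h(1)] .
    have "h [^]\<^bsub>G\<lparr>carrier := H\<rparr>\<^esub> q = \<one>"
      using H.pow_order_eq_1[of h] h H(2) by (simp add: Coset.order_def)
    then have "h [^] q = \<one>" using nat_pow_consistent by metis
    then have "ord h dvd q" using pow_eq_id[OF hG] by blast
    moreover obtain b :: nat where "h [^] (p ^ b) = \<one>" using pow[OF hG] by blast
    then have "ord h dvd p ^ b" using pow_eq_id[OF hG] by blast
    moreover have "coprime q (p ^ b)"
      using q m(2) \<open>prime p\<close> by (metis coprime_power_right_iff primes_coprime)
    ultimately have "ord h = 1" by (metis coprime_common_divisor nat_dvd_1_iff_1)
    then show False using h hG ord_eq_1 by blast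
  qed
  then show ?thesis using m(1) by auto
qed

lemma (in normal) FactGroup_pow_eq_one:
  assumes "g \<in> carrier G"
  shows "(H #> g) [^]\<^bsub>G Mod H\<^esub> (k::nat) = \<one>\<^bsub>G Mod H\<^esub> \<longleftrightarrow> g [^] k \<in> H"
  using FactGroup_pow[OF assms, of k] coset_eq_self_iff[of "g [^] k"] assms by simp

text \<open>In contrast to the index itself, these two conditions are easily checked for intersections,
  kernels and flow kernels.\<close>

lemma (in normal) p_power_index_iff:
  assumes "prime p"
  shows "p_power_index p G H \<longleftrightarrow>
    finite (rcosets H) \<and> (\<forall>g\<in>carrier G. \<exists>b::nat. g [^] (p ^ b) \<in> H)"
proof -
  interpret Q: group "G Mod H" by (rule factorgroup_is_group)
  have ord: "Coset.order (G Mod H) = card (rcosets H)" "carrier (G Mod H) = rcosets H"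
    by (simp_all add: Coset.order_def FactGroup_def)
  have coset: "H #> g \<in> carrier (G Mod H)" if "g \<in> carrier G" for g
    using that by (auto simp: carrier_FactGroup)
  show ?thesis
  proof
    assume "p_power_index p G H"
    then obtain k :: nat where k: "card (rcosets H) = p ^ k" by (auto simp: p_power_index_def)
    then have "finite (rcosets H)" using assms by (metis card.infinite not_prime_0 power_not_zero)
    moreover have "g [^] (p ^ k) \<in> H" if "g \<in> carrier G" for g
      using Q.pow_order_eq_1[OF coset[OF that]] FactGroup_pow_eq_one[OF that] ord k by simp
    ultimately show "finite (rcosets H) \<and> (\<forall>g\<in>carrier G. \<exists>b::nat. g [^] (p ^ b) \<in> H)" by blast
  next
    assume *: "finite (rcosets H) \<and> (\<forall>g\<in>carrier G. \<exists>b::nat. g [^] (p ^ b) \<in> H)"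
    have "\<exists>b::nat. x [^]\<^bsub>G Mod H\<^esub> (p ^ b) = \<one>\<^bsub>G Mod H\<^esub>" if "x \<in> carrier (G Mod H)" for x
      using that * FactGroup_pow_eq_one by (force simp: carrier_FactGroup)
    then show "p_power_index p G H"
      using Q.order_prime_powerI[OF assms] * ord by (simp add: p_power_index_def)
  qed
qed

lemma (in group) finite_rcosetsI:
  assumes H: "subgroup H G" and fin: "finite (f ` carrier G)"
    and sep: "\<And>u v. u \<in> carrier G \<Longrightarrow> v \<in> carrier G \<Longrightarrow> f u = f v \<Longrightarrow> u \<otimes> inv v \<in> H"
  shows "finite (rcosets H)"
proof -
  define g where "g y = (SOME u. u \<in> carrier G \<and> f u = y)" for y
  have "H #> u = H #> g (f u)" if u: "u \<in> carrier G" for u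
  proof -
    have g: "g (f u) \<in> carrier G \<and> f (g (f u)) = f u"
      unfolding g_def by (rule someI[of _ u]) (use u in simp)
    then have "g (f u) \<otimes> inv u \<in> H" using sep u by simp
    then have "g (f u) \<in> H #> u"
      using subgroup.rcos_module[OF H group_axioms u] g by blast
    then show ?thesis using repr_independence[OF _ u H] by blast
  qed
  then have "rcosets H \<subseteq> (\<lambda>y. H #> g y) ` f ` carrier G" by (auto simp: RCOSETS_def)
  then show ?thesis using fin finite_surj by blast
qed

lemma p_power_normal_iff:
  assumes "prime p"
  shows "N \<in> p_power_normal p G \<longleftrightarrow>
    N \<lhd> G \<and> finite (rcosets\<^bsub>G\<^esub> N) \<and> (\<forall>g\<in>carrier G. \<exists>b::nat. g [^]\<^bsub>G\<^esub> (p ^ b) \<in> N)"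
  using normal.p_power_index_iff[OF _ assms] by (auto simp: p_power_normal_def)

lemma p_power_normal_superset:
  assumes "prime p" and N: "N \<in> p_power_normal p G" and "N \<subseteq> M" and M: "M \<lhd> G"
  shows "M \<in> p_power_normal p G"
proof -
  interpret N: normal N G using N by (simp add: p_power_normal_def)
  interpret M: normal M G by (rule M)
  have "finite (rcosets\<^bsub>G\<^esub> M)"
  proof (rule N.finite_rcosetsI[OF M.subgroup_axioms, of "\<lambda>u. N #>\<^bsub>G\<^esub> u"])
    show "finite ((\<lambda>u. N #>\<^bsub>G\<^esub> u) ` carrier G)"
      using N by (simp add: p_power_normal_iff[OF assms(1)] RCOSETS_def UNION_singleton_eq_range)
    fix u v assume "u \<in> carrier G" "v \<in> carrier G" "N #>\<^bsub>G\<^esub> u = N #>\<^bsub>G\<^esub> v"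
    then show "u \<otimes>\<^bsub>G\<^esub> inv\<^bsub>G\<^esub> v \<in> M"
      using N.rcos_module[OF N.is_group, of v u] N.rcos_self[OF _ N.subgroup_axioms, of u] assms(3) by auto
  qed
  then show ?thesis
    using assms by (auto simp: p_power_normal_iff) blast
qed

lemma p_power_normal_Int:
  assumes "prime p" and N: "N \<in> p_power_normal p G" and M: "M \<in> p_power_normal p G"
  shows "N \<inter> M \<in> p_power_normal p G"
proof -
  interpret N: normal N G using N by (simp add: p_power_normal_def)
  interpret M: normal M G using M by (simp add: p_power_normal_def)
  have NM: "N \<inter> M \<lhd> G"
    using N.normal_subgroup_intersect[OF N.normal_axioms M.normal_axioms] .
  have "finite (rcosets\<^bsub>G\<^esub> (N \<inter> M))"
  proof (rule N.finite_rcosetsI[OF normal_imp_subgroup[OF NM], of "\<lambda>u. (N #>\<^bsub>G\<^esub> u, M #>\<^bsub>G\<^esub> u)"])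
    have "finite ((rcosets\<^bsub>G\<^esub> N) \<times> (rcosets\<^bsub>G\<^esub> M))"
      using N M by (simp add: p_power_normal_iff[OF assms(1)])
    then show "finite ((\<lambda>u. (N #>\<^bsub>G\<^esub> u, M #>\<^bsub>G\<^esub> u)) ` carrier G)"
      by (rule rev_finite_subset) (auto simp: RCOSETS_def)
    fix u v assume "u \<in> carrier G" "v \<in> carrier G" "(N #>\<^bsub>G\<^esub> u, M #>\<^bsub>G\<^esub> u) = (N #>\<^bsub>G\<^esub> v, M #>\<^bsub>G\<^esub> v)"
    then show "u \<otimes>\<^bsub>G\<^esub> inv\<^bsub>G\<^esub> v \<in> N \<inter> M"
      using N.rcos_module[OF N.is_group, of v u] N.rcos_self[OF _ N.subgroup_axioms, of u]
        M.rcos_module[OF N.is_group, of v u] N.rcos_self[OF _ M.subgroup_axioms, of u] by auto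
  qed
  moreover have "\<exists>b::nat. g [^]\<^bsub>G\<^esub> (p ^ b) \<in> N \<inter> M" if g: "g \<in> carrier G" for g
  proof -
    obtain a :: nat where a: "g [^]\<^bsub>G\<^esub> (p ^ a) \<in> N"
      using N g unfolding p_power_normal_iff[OF assms(1)] by blast
    obtain b :: nat where b: "g [^]\<^bsub>G\<^esub> (p ^ b) \<in> M"
      using M g unfolding p_power_normal_iff[OF assms(1)] by blast
    have "(g [^]\<^bsub>G\<^esub> (p ^ a)) [^]\<^bsub>G\<^esub> (p ^ b) \<in> N" "(g [^]\<^bsub>G\<^esub> (p ^ b)) [^]\<^bsub>G\<^esub> (p ^ a) \<in> M"
      using a b N.nat_pow_mem M.nat_pow_mem by auto
    then show ?thesis
      using g by (intro exI[of _ "a + b"]) (simp add: N.nat_pow_pow power_add mult.commute)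
  qed
  ultimately show ?thesis using NM by (simp add: p_power_normal_iff[OF assms(1)])
qed

lemma p_power_normal_kernel:
  assumes "prime p" and q: "q \<in> hom G (F Mod N)" and G: "group G" and N: "N \<in> p_power_normal p F"
  shows "kernel G (F Mod N) q \<in> p_power_normal p G"
proof -
  interpret N: normal N F using N by (simp add: p_power_normal_def)
  interpret q: group_hom G "F Mod N" q
    using q G N.factorgroup_is_group by (simp add: group_hom_def group_hom_axioms_def)
  have fin: "finite (carrier (F Mod N))"
    using N by (simp add: p_power_normal_iff[OF assms(1)] FactGroup_def)
  have "finite (rcosets\<^bsub>G\<^esub> (kernel G (F Mod N) q))"
  proof (rule q.G.finite_rcosetsI[OF q.subgroup_kernel, of q])
    show "finite (q ` carrier G)" using fin by (rule rev_finite_subset) auto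
    fix u v assume "u \<in> carrier G" "v \<in> carrier G" "q u = q v"
    then show "u \<otimes>\<^bsub>G\<^esub> inv\<^bsub>G\<^esub> v \<in> kernel G (F Mod N) q"
      by (simp add: kernel_def del: mult_FactGroup one_FactGroup)
  qed
  moreover have "\<exists>b::nat. g [^]\<^bsub>G\<^esub> (p ^ b) \<in> kernel G (F Mod N) q" if g: "g \<in> carrier G" for g
  proof -
    obtain w where w: "w \<in> carrier F" "q g = N #>\<^bsub>F\<^esub> w"
      using q.hom_closed[OF g] by (auto simp: carrier_FactGroup)
    then obtain b :: nat where "w [^]\<^bsub>F\<^esub> (p ^ b) \<in> N"
      using N by (auto simp: p_power_normal_iff[OF assms(1)])
    then have "q g [^]\<^bsub>F Mod N\<^esub> (p ^ b) = \<one>\<^bsub>F Mod N\<^esub>"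
      using N.FactGroup_pow_eq_one w by simp
    then have "g [^]\<^bsub>G\<^esub> (p ^ b) \<in> kernel G (F Mod N) q"
      using g by (simp add: kernel_def q.hom_nat_pow del: mult_FactGroup one_FactGroup)
    then show ?thesis ..
  qed
  ultimately show ?thesis
    using q.normal_kernel by (simp add: p_power_normal_iff[OF assms(1)])
qed

text \<open>The index is finite by \<open>flow_kernel_separates\<close>. It is a power of \<open>p\<close> because some \<open>p\<close>-power of
  each word lies in \<open>D\<close>, and there taking the \<open>p\<^sup>j\<close>-th power multiplies flows by \<open>p\<^sup>j\<close>.\<close>

lemma p_power_normal_flow_kernel:
  assumes "prime p" and X: "finite X" and D: "D \<in> p_power_normal p (free_group X)"
  shows "flow_kernel X D (p ^ j) \<in> p_power_normal p (free_group X)"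
proof -
  let ?F = "free_group X" and ?K = "flow_kernel X D (p ^ j)"
  interpret schreier_flow X D
    using D by (simp add: schreier_flow_def p_power_normal_def)
  let ?E = "(rcosets\<^bsub>?F\<^esub> D) \<times> X"
  have "p ^ j > 0" using assms(1) prime_gt_0_nat by simp
  have fin: "finite (rcosets\<^bsub>?F\<^esub> D)"
    using D by (simp add: p_power_normal_iff[OF assms(1)])
  have "finite (rcosets\<^bsub>?F\<^esub> ?K)"
  proof (rule free.finite_rcosetsI[OF normal_imp_subgroup[OF flow_kernel_normal],
        of "\<lambda>u. (D #>\<^bsub>?F\<^esub> u, \<lambda>e\<in>?E. flow X D u e mod int (p ^ j))"])
    have "finite ((rcosets\<^bsub>?F\<^esub> D) \<times> (?E \<rightarrow>\<^sub>E {0..<int (p ^ j)}))"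
      using fin X by (intro finite_cartesian_product finite_PiE) auto
    then show "finite ((\<lambda>u. (D #>\<^bsub>?F\<^esub> u, \<lambda>e\<in>?E. flow X D u e mod int (p ^ j))) ` carrier ?F)"
    proof (rule rev_finite_subset, intro image_subsetI SigmaI)
      fix u assume u: "u \<in> carrier ?F"
      show "D #>\<^bsub>?F\<^esub> u \<in> rcosets\<^bsub>?F\<^esub> D" by (rule free.rcosetsI[OF subset u])
      show "(\<lambda>e\<in>?E. flow X D u e mod int (p ^ j)) \<in> ?E \<rightarrow>\<^sub>E {0..<int (p ^ j)}"
        using \<open>p ^ j > 0\<close> by (simp add: restrict_PiE_iff del: of_nat_power)
    qed
    fix u v assume u: "u \<in> carrier ?F" and v: "v \<in> carrier ?F"
      and eq: "(D #>\<^bsub>?F\<^esub> u, \<lambda>e\<in>?E. flow X D u e mod int (p ^ j)) =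
        (D #>\<^bsub>?F\<^esub> v, \<lambda>e\<in>?E. flow X D v e mod int (p ^ j))"
    show "u \<otimes>\<^bsub>?F\<^esub> inv\<^bsub>?F\<^esub> v \<in> ?K"
    proof (rule flow_kernel_separates[OF u v])
      fix c x assume "c \<in> rcosets\<^bsub>?F\<^esub> D" "x \<in> X"
      then show "flow X D u (c, x) mod int (p ^ j) = flow X D v (c, x) mod int (p ^ j)"
        using fun_cong[OF conjunct2[OF eq[unfolded prod.inject]], of "(c, x)"] by simp
    qed (use eq in simp)
  qed
  moreover have "\<exists>b::nat. g [^]\<^bsub>?F\<^esub> (p ^ b) \<in> ?K" if g: "g \<in> carrier ?F" for g
  proof -
    obtain a :: nat where a: "g [^]\<^bsub>?F\<^esub> (p ^ a) \<in> D"
      using D g by (auto simp: p_power_normal_iff[OF assms(1)])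
    have "(g [^]\<^bsub>?F\<^esub> (p ^ a)) [^]\<^bsub>?F\<^esub> (p ^ j) \<in> ?K"
      by (rule flow_kernel_pow[OF a])
    then show ?thesis
      using g by (intro exI[of _ "a + j"]) (simp add: free.nat_pow_pow power_add)
  qed
  ultimately show ?thesis
    using flow_kernel_normal by (simp add: p_power_normal_iff[OF assms(1)])
qed

section \<open>Group rings modulo an integer and the Zassenhaus filtration\<close>

lemmas cong_iff_mod = unique_euclidean_semiring_class.cong_def

lemma residue_ring_simps [simp]:
  "carrier (residue_ring m) = {0..m - 1}" "\<zero>\<^bsub>residue_ring m\<^esub> = 0" "\<one>\<^bsub>residue_ring m\<^esub> = 1"
  "x \<otimes>\<^bsub>residue_ring m\<^esub> y = (x * y) mod m" "x \<oplus>\<^bsub>residue_ring m\<^esub> y = (x + y) mod m"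
  by (simp_all add: residue_ring_def)

lemma finsum_residue_ring:
  assumes m: "m > 1" and "finite A" and "\<And>a. a \<in> A \<Longrightarrow> f a \<in> {0..m - 1}"
  shows "finsum (residue_ring m) f A = (\<Sum>a\<in>A. f a) mod m"
proof -
  interpret abelian_group "residue_ring m"
    using m by (intro residues.abelian_group) (simp add: residues_def)
  show ?thesis
    using assms(2,3)
  proof (induction A rule: finite_induct)
    case (insert a A)
    then show ?case by (subst finsum_insert) (auto simp: mod_simps)
  qed simp
qed

text \<open>Summing a push-forward against \<open>h\<close> is summing against the pull-back of \<open>h\<close>. This is why
  a group homomorphism induces a map of group rings that preserves products and augmentations.\<close>

lemma sum_swap_fibre:
  fixes f :: "'a \<Rightarrow> int"
  assumes "finite A" "finite U" "\<phi> ` A \<subseteq> U"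
  shows "(\<Sum>u\<in>U. (\<Sum>a\<in>A. f a * of_bool (\<phi> a = u)) * h u) = (\<Sum>a\<in>A. f a * h (\<phi> a))"
proof -
  have "(\<Sum>u\<in>U. (\<Sum>a\<in>A. f a * of_bool (\<phi> a = u)) * h u)
      = (\<Sum>a\<in>A. \<Sum>u\<in>U. f a * of_bool (\<phi> a = u) * h u)"
    unfolding sum_distrib_right by (rule sum.swap)
  also have "\<dots> = (\<Sum>a\<in>A. f a * h (\<phi> a))"
  proof (rule sum.cong[OF refl])
    fix a assume "a \<in> A"
    then have "\<phi> a \<in> U" using assms by auto
    have "(\<Sum>u\<in>U. f a * of_bool (\<phi> a = u) * h u) = (\<Sum>u\<in>U. if \<phi> a = u then f a * h u else 0)"
      by (rule sum.cong) auto
    then show "(\<Sum>u\<in>U. f a * of_bool (\<phi> a = u) * h u) = f a * h (\<phi> a)"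
      using \<open>\<phi> a \<in> U\<close> assms(2) by simp
  qed
  finally show ?thesis .
qed

locale modular_group_ring = G: group G for G :: "('a, 'm) monoid_scheme" and m :: int +
  assumes m: "m > 1"
begin

abbreviation (input) "KG \<equiv> group_ring (residue_ring m) G"

definition supp :: "('a \<Rightarrow> int) \<Rightarrow> 'a set" where
  "supp f = {x \<in> carrier G. f x \<noteq> 0}"

lemma carrier_KG:
  "f \<in> carrier KG \<longleftrightarrow>
    f \<in> extensional (carrier G) \<and> (\<forall>x\<in>carrier G. 0 \<le> f x \<and> f x < m) \<and> finite (supp f)"
  by (auto simp: group_ring_def supp_def PiE_def Pi_def)

lemma KG_bounds:
  assumes "f \<in> carrier KG" "x \<in> carrier G"
  shows "0 \<le> f x" "f x < m" "f x mod m = f x"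
  using assms by (simp_all add: carrier_KG)

lemma add_KG: "x \<in> carrier G \<Longrightarrow> (f \<oplus>\<^bsub>KG\<^esub> g) x = (f x + g x) mod m"
  by (simp add: group_ring_def)

lemma supp_add: "supp (f \<oplus>\<^bsub>KG\<^esub> g) \<subseteq> supp f \<union> supp g"
  by (auto simp: supp_def add_KG)

lemma abelian_group_KG: "abelian_group KG"
proof (rule abelian_groupI)
  fix f g h assume f: "f \<in> carrier KG" and g: "g \<in> carrier KG"
  show "f \<oplus>\<^bsub>KG\<^esub> g \<in> carrier KG"
    using f g m finite_subset[OF supp_add[of f g]]
    by (auto simp: carrier_KG add_KG) (simp add: group_ring_def)
  show "f \<oplus>\<^bsub>KG\<^esub> g = g \<oplus>\<^bsub>KG\<^esub> f"
    by (simp add: group_ring_def add.commute)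
  show "f \<oplus>\<^bsub>KG\<^esub> g \<oplus>\<^bsub>KG\<^esub> h = f \<oplus>\<^bsub>KG\<^esub> (g \<oplus>\<^bsub>KG\<^esub> h)"
    by (auto simp: group_ring_def mod_simps add.assoc intro!: restrict_ext)
next
  show "\<zero>\<^bsub>KG\<^esub> \<in> carrier KG"
    using m by (auto simp: carrier_KG supp_def) (auto simp: group_ring_def cong: conj_cong)
next
  fix f assume f: "f \<in> carrier KG"
  show "\<zero>\<^bsub>KG\<^esub> \<oplus>\<^bsub>KG\<^esub> f = f"
    using f KG_bounds[OF f] by (auto simp: carrier_KG group_ring_def fun_eq_iff extensional_def)
  define g where "g = (\<lambda>x\<in>carrier G. (- f x) mod m)"
  have "supp g \<subseteq> supp f" by (auto simp: supp_def g_def)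
  then have "g \<in> carrier KG"
    using f m by (auto simp: carrier_KG g_def intro: finite_subset)
  moreover have "g \<oplus>\<^bsub>KG\<^esub> f = \<zero>\<^bsub>KG\<^esub>"
    by (auto simp: group_ring_def g_def mod_simps intro!: restrict_ext)
  ultimately show "\<exists>g\<in>carrier KG. g \<oplus>\<^bsub>KG\<^esub> f = \<zero>\<^bsub>KG\<^esub>" by blast
qed

lemma augmentation_eq:
  assumes f: "f \<in> carrier KG" and A: "finite A" "supp f \<subseteq> A" "A \<subseteq> carrier G"
  shows "augmentation (residue_ring m) G f = (\<Sum>a\<in>A. f a) mod m"
proof -
  have "augmentation (residue_ring m) G f = (\<Sum>a\<in>supp f. f a) mod m"
    unfolding augmentation_def using f m
    by (subst finsum_residue_ring) (auto simp: carrier_KG supp_def)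
  also have "(\<Sum>a\<in>supp f. f a) = (\<Sum>a\<in>A. f a)"
    by (rule sum.mono_neutral_left) (use A in \<open>auto simp: supp_def\<close>)
  finally show ?thesis .
qed

lemma group_ring_map_eq:
  assumes f: "f \<in> carrier KG" and A: "finite A" "supp f \<subseteq> A" "A \<subseteq> carrier G" and z: "z \<in> carrier H"
  shows "group_ring_map (residue_ring m) G H \<phi> f z = (\<Sum>a\<in>A. f a * of_bool (\<phi> a = z)) mod m"
proof -
  let ?S = "{x \<in> carrier G. f x \<noteq> 0 \<and> \<phi> x = z}"
  have S: "finite ?S" "?S \<subseteq> A" using A by (auto simp: supp_def intro: finite_subset)
  have "group_ring_map (residue_ring m) G H \<phi> f z = (\<Sum>a\<in>?S. f a) mod m"
    unfolding group_ring_map_def using f m z S(1)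
    by (simp, subst finsum_residue_ring) (auto simp: carrier_KG)
  also have "(\<Sum>a\<in>?S. f a) = (\<Sum>a\<in>?S. f a * of_bool (\<phi> a = z))"
    by (rule sum.cong) auto
  also have "\<dots> = (\<Sum>a\<in>A. f a * of_bool (\<phi> a = z))"
    by (rule sum.mono_neutral_left) (use A S in \<open>auto simp: supp_def\<close>)
  finally show ?thesis .
qed

text \<open>A symmetric form of the convolution product, over any finite sets that contain the supports.\<close>

lemma mult_eq:
  assumes f: "f \<in> carrier KG" and A: "finite A" "supp f \<subseteq> A" "A \<subseteq> carrier G"
    and g: "g \<in> carrier KG" and B: "finite B" "supp g \<subseteq> B" "B \<subseteq> carrier G" and x: "x \<in> carrier G"
  shows "(f \<otimes>\<^bsub>KG\<^esub> g) x = (\<Sum>a\<in>A. f a * (\<Sum>b\<in>B. g b * of_bool (a \<otimes>\<^bsub>G\<^esub> b = x))) mod m"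
proof -
  have inner: "(\<Sum>b\<in>B. g b * of_bool (a \<otimes>\<^bsub>G\<^esub> b = x)) = g (inv\<^bsub>G\<^esub> a \<otimes>\<^bsub>G\<^esub> x)" if a: "a \<in> carrier G" for a
  proof -
    let ?b = "inv\<^bsub>G\<^esub> a \<otimes>\<^bsub>G\<^esub> x"
    have "a \<otimes>\<^bsub>G\<^esub> b = x \<longleftrightarrow> ?b = b" if "b \<in> B" for b
      using that a B x G.inv_solve_left[of b a x] by (metis subsetD)
    then have "(\<Sum>b\<in>B. g b * of_bool (a \<otimes>\<^bsub>G\<^esub> b = x)) = (\<Sum>b\<in>B. if ?b = b then g b else 0)"
      by (intro sum.cong) auto
    also have "\<dots> = g ?b"
      using B G.m_closed[OF G.inv_closed[OF a] x] by (auto simp: supp_def)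
    finally show ?thesis .
  qed
  have "(f \<otimes>\<^bsub>KG\<^esub> g) x = (\<Sum>a\<in>supp f. (f a * g (inv\<^bsub>G\<^esub> a \<otimes>\<^bsub>G\<^esub> x)) mod m) mod m"
  proof -
    have "finite (supp f)" using f by (simp add: carrier_KG)
    then show ?thesis
      using x m unfolding group_ring_def supp_def
      by (simp, subst finsum_residue_ring) auto
  qed
  also have "\<dots> = (\<Sum>a\<in>supp f. f a * g (inv\<^bsub>G\<^esub> a \<otimes>\<^bsub>G\<^esub> x)) mod m"
    by (rule mod_sum_eq)
  also have "(\<Sum>a\<in>supp f. f a * g (inv\<^bsub>G\<^esub> a \<otimes>\<^bsub>G\<^esub> x)) = (\<Sum>a\<in>A. f a * g (inv\<^bsub>G\<^esub> a \<otimes>\<^bsub>G\<^esub> x))"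
    by (rule sum.mono_neutral_left) (use A in \<open>auto simp: supp_def\<close>)
  also have "\<dots> = (\<Sum>a\<in>A. f a * (\<Sum>b\<in>B. g b * of_bool (a \<otimes>\<^bsub>G\<^esub> b = x)))"
    by (rule sum.cong) (use A inner in auto)
  finally show ?thesis .
qed

lemma supp_mult:
  assumes "f \<in> carrier KG" "g \<in> carrier KG"
  shows "supp (f \<otimes>\<^bsub>KG\<^esub> g) \<subseteq> (\<lambda>(a, b). a \<otimes>\<^bsub>G\<^esub> b) ` (supp f \<times> supp g)"
proof
  fix x assume x: "x \<in> supp (f \<otimes>\<^bsub>KG\<^esub> g)"
  have "\<exists>a\<in>supp f. \<exists>b\<in>supp g. a \<otimes>\<^bsub>G\<^esub> b = x"
  proof (rule ccontr)
    assume "\<not> ?thesis"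
    then have "(\<Sum>a\<in>supp f. f a * (\<Sum>b\<in>supp g. g b * of_bool (a \<otimes>\<^bsub>G\<^esub> b = x))) = 0"
      by (intro sum.neutral) auto
    then show False
      using x mult_eq[OF assms(1) _ _ _ assms(2), of "supp f" "supp g" x] assms
      by (auto simp: carrier_KG supp_def)
  qed
  then show "x \<in> (\<lambda>(a, b). a \<otimes>\<^bsub>G\<^esub> b) ` (supp f \<times> supp g)" by force
qed

lemma mult_closed:
  assumes "f \<in> carrier KG" "g \<in> carrier KG"
  shows "f \<otimes>\<^bsub>KG\<^esub> g \<in> carrier KG"
proof -
  have "finite (supp (f \<otimes>\<^bsub>KG\<^esub> g))"
    using supp_mult[OF assms] assms by (auto simp: carrier_KG intro: finite_subset)
  moreover have "0 \<le> (f \<otimes>\<^bsub>KG\<^esub> g) x \<and> (f \<otimes>\<^bsub>KG\<^esub> g) x < m" if "x \<in> carrier G" for x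
    using mult_eq[OF assms(1) _ _ _ assms(2), of "supp f" "supp g" x] that assms m
    by (auto simp: carrier_KG supp_def)
  moreover have "f \<otimes>\<^bsub>KG\<^esub> g \<in> extensional (carrier G)" by (simp add: group_ring_def)
  ultimately show ?thesis by (simp add: carrier_KG)
qed

lemma of_closed: "g \<in> carrier G \<Longrightarrow> group_ring_of (residue_ring m) G g \<in> carrier KG"
  using m by (auto simp: carrier_KG supp_def group_ring_of_def cong: conj_cong)

lemma one_eq_of: "\<one>\<^bsub>KG\<^esub> = group_ring_of (residue_ring m) G \<one>\<^bsub>G\<^esub>"
  by (simp add: group_ring_def group_ring_of_def)

end

locale modular_group_ring_hom = G: modular_group_ring G m + H: modular_group_ring H m
  for G :: "('a, 'm) monoid_scheme" and H :: "('b, 'k) monoid_scheme" and m +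
  fixes \<phi> :: "'a \<Rightarrow> 'b"
  assumes hom: "\<phi> \<in> hom G H"
begin

abbreviation (input) "KG \<equiv> group_ring (residue_ring m) G"
abbreviation (input) "KH \<equiv> group_ring (residue_ring m) H"
abbreviation (input) "\<Phi> \<equiv> group_ring_map (residue_ring m) G H \<phi>"

lemma supp_map: "f \<in> carrier KG \<Longrightarrow> H.supp (\<Phi> f) \<subseteq> \<phi> ` G.supp f"
proof
  fix z assume f: "f \<in> carrier KG" and z: "z \<in> H.supp (\<Phi> f)"
  have "\<exists>a\<in>G.supp f. \<phi> a = z"
  proof (rule ccontr)
    assume "\<not> ?thesis"
    then have "(\<Sum>a\<in>G.supp f. f a * of_bool (\<phi> a = z)) = 0"
      by (intro sum.neutral) auto
    then show False
      using z G.group_ring_map_eq[OF f, of "G.supp f" z H \<phi>] f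
      by (auto simp: G.carrier_KG H.supp_def G.supp_def)
  qed
  then show "z \<in> \<phi> ` G.supp f" by auto
qed

lemma map_closed:
  assumes f: "f \<in> carrier KG"
  shows "\<Phi> f \<in> carrier KH"
proof -
  have "finite (H.supp (\<Phi> f))"
    using supp_map[OF f] f by (auto simp: G.carrier_KG intro: finite_surj)
  moreover have "0 \<le> \<Phi> f z \<and> \<Phi> f z < m" if "z \<in> carrier H" for z
    using G.group_ring_map_eq[OF f, of "G.supp f" z H \<phi>] that f G.m
    by (auto simp: G.carrier_KG G.supp_def)
  moreover have "\<Phi> f \<in> extensional (carrier H)" by (simp add: group_ring_map_def)
  ultimately show ?thesis by (simp add: H.carrier_KG)
qed

lemma map_pairing:
  assumes f: "f \<in> carrier KG" and A: "finite A" "G.supp f \<subseteq> A" "A \<subseteq> carrier G"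
    and U: "finite U" "\<phi> ` A \<subseteq> U" "U \<subseteq> carrier H"
  shows "[(\<Sum>u\<in>U. \<Phi> f u * h u) = (\<Sum>a\<in>A. f a * h (\<phi> a))] (mod m)"
proof -
  have "[(\<Sum>u\<in>U. \<Phi> f u * h u) = (\<Sum>u\<in>U. (\<Sum>a\<in>A. f a * of_bool (\<phi> a = u)) * h u)] (mod m)"
    by (intro cong_sum cong_mult) (use U G.group_ring_map_eq[OF f A, of _ H \<phi>] in \<open>auto simp: cong_iff_mod\<close>)
  then show ?thesis using sum_swap_fibre[OF A(1) U(1,2), of f h] by simp
qed

lemma map_augmentation:
  assumes f: "f \<in> carrier KG"
  shows "augmentation (residue_ring m) H (\<Phi> f) = augmentation (residue_ring m) G f"
proof -
  have A: "finite (G.supp f)" "G.supp f \<subseteq> carrier G" using f by (auto simp: G.carrier_KG G.supp_def)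
  have U: "\<phi> ` G.supp f \<subseteq> carrier H" using A hom by (auto simp: hom_def)
  show ?thesis
    using map_pairing[OF f A(1) order_refl A(2) finite_imageI[OF A(1)] order_refl U, of "\<lambda>_. 1", unfolded cong_iff_mod]
      H.augmentation_eq[OF map_closed[OF f] finite_imageI[OF A(1)] supp_map[OF f] U]
      G.augmentation_eq[OF f A(1) order_refl A(2)]
    by simp
qed

lemma map_add:
  assumes f: "f \<in> carrier KG" and g: "g \<in> carrier KG"
  shows "\<Phi> (f \<oplus>\<^bsub>KG\<^esub> g) = \<Phi> f \<oplus>\<^bsub>KH\<^esub> \<Phi> g"
proof
  fix z
  let ?A = "G.supp f \<union> G.supp g"
  interpret KG: abelian_group KG by (rule G.abelian_group_KG)
  have A: "finite ?A" "G.supp f \<subseteq> ?A" "G.supp g \<subseteq> ?A" "?A \<subseteq> carrier G"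
    using f g by (auto simp: G.carrier_KG G.supp_def)
  show "\<Phi> (f \<oplus>\<^bsub>KG\<^esub> g) z = (\<Phi> f \<oplus>\<^bsub>KH\<^esub> \<Phi> g) z"
  proof (cases "z \<in> carrier H")
    case True
    have "[(\<Sum>a\<in>?A. (f \<oplus>\<^bsub>KG\<^esub> g) a * of_bool (\<phi> a = z)) =
        (\<Sum>a\<in>?A. f a * of_bool (\<phi> a = z) + g a * of_bool (\<phi> a = z))] (mod m)"
      unfolding distrib_right[symmetric]
      by (intro cong_sum cong_mult) (use A in \<open>auto simp: cong_iff_mod G.add_KG\<close>)
    then show ?thesis
      using G.group_ring_map_eq[OF KG.a_closed[OF f g] A(1) G.supp_add A(4) True, of \<phi>]
        G.group_ring_map_eq[OF f A(1,2,4) True, of \<phi>] G.group_ring_map_eq[OF g A(1,3,4) True, of \<phi>]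
      by (simp add: H.add_KG[OF True] cong_iff_mod sum.distrib mod_simps)
  qed (simp add: group_ring_map_def group_ring_def)
qed

lemma map_mult:
  assumes f: "f \<in> carrier KG" and g: "g \<in> carrier KG"
  shows "\<Phi> (f \<otimes>\<^bsub>KG\<^esub> g) = \<Phi> f \<otimes>\<^bsub>KH\<^esub> \<Phi> g"
proof
  fix z
  let ?A = "G.supp f" and ?B = "G.supp g"
  let ?AB = "(\<lambda>(a, b). a \<otimes>\<^bsub>G\<^esub> b) ` (?A \<times> ?B)"
  have A: "finite ?A" "?A \<subseteq> carrier G" and B: "finite ?B" "?B \<subseteq> carrier G"
    using f g by (auto simp: G.carrier_KG G.supp_def)
  have AB: "finite ?AB" "?AB \<subseteq> carrier G" using A B by auto
  have U: "\<phi> ` ?A \<subseteq> carrier H" "\<phi> ` ?B \<subseteq> carrier H" using A B hom by (auto simp: hom_def)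
  show "\<Phi> (f \<otimes>\<^bsub>KG\<^esub> g) z = (\<Phi> f \<otimes>\<^bsub>KH\<^esub> \<Phi> g) z"
  proof (cases "z \<in> carrier H")
    case True
    let ?S = "\<Sum>a\<in>?A. f a * (\<Sum>b\<in>?B. g b * of_bool (\<phi> a \<otimes>\<^bsub>H\<^esub> \<phi> b = z))"
    have "[(\<Sum>x\<in>?AB. (f \<otimes>\<^bsub>KG\<^esub> g) x * of_bool (\<phi> x = z)) =
        (\<Sum>x\<in>?AB. (\<Sum>a\<in>?A. f a * (\<Sum>b\<in>?B. g b * of_bool (a \<otimes>\<^bsub>G\<^esub> b = x))) * of_bool (\<phi> x = z))] (mod m)"
      by (intro cong_sum cong_mult)
        (use AB G.mult_eq[OF f A(1) order_refl A(2) g B(1) order_refl B(2)] in \<open>auto simp: cong_iff_mod\<close>)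
    also have "(\<Sum>x\<in>?AB. (\<Sum>a\<in>?A. f a * (\<Sum>b\<in>?B. g b * of_bool (a \<otimes>\<^bsub>G\<^esub> b = x))) * of_bool (\<phi> x = z))
        = (\<Sum>a\<in>?A. f a * (\<Sum>x\<in>?AB. (\<Sum>b\<in>?B. g b * of_bool (a \<otimes>\<^bsub>G\<^esub> b = x)) * of_bool (\<phi> x = z)))"
      by (simp add: sum_distrib_right sum_distrib_left mult.assoc) (rule sum.swap)
    also have "\<dots> = (\<Sum>a\<in>?A. f a * (\<Sum>b\<in>?B. g b * of_bool (\<phi> (a \<otimes>\<^bsub>G\<^esub> b) = z)))"
    proof (rule sum.cong[OF refl])
      fix a assume "a \<in> ?A"
      then have "(\<lambda>b. a \<otimes>\<^bsub>G\<^esub> b) ` ?B \<subseteq> ?AB" by auto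
      from sum_swap_fibre[OF B(1) AB(1) this, of g "\<lambda>x. of_bool (\<phi> x = z)"]
      show "f a * (\<Sum>x\<in>?AB. (\<Sum>b\<in>?B. g b * of_bool (a \<otimes>\<^bsub>G\<^esub> b = x)) * of_bool (\<phi> x = z))
          = f a * (\<Sum>b\<in>?B. g b * of_bool (\<phi> (a \<otimes>\<^bsub>G\<^esub> b) = z))" by simp
    qed
    also have "\<dots> = ?S"
    proof (intro sum.cong refl arg_cong2[where f = "(*)"])
      fix a b assume "a \<in> ?A" "b \<in> ?B"
      then have "a \<in> carrier G" "b \<in> carrier G" using A B by blast+
      then show "of_bool (\<phi> (a \<otimes>\<^bsub>G\<^esub> b) = z) = (of_bool (\<phi> a \<otimes>\<^bsub>H\<^esub> \<phi> b = z) :: int)"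
        using hom_mult[OF hom, of a b] by simp
    qed
    finally have lhs: "\<Phi> (f \<otimes>\<^bsub>KG\<^esub> g) z = ?S mod m"
      using G.group_ring_map_eq[OF G.mult_closed[OF f g] AB(1) G.supp_mult[OF f g] AB(2) True, of \<phi>]
      by (simp add: cong_iff_mod)
    have "[(\<Sum>u\<in>\<phi> ` ?A. \<Phi> f u * (\<Sum>v\<in>\<phi> ` ?B. \<Phi> g v * of_bool (u \<otimes>\<^bsub>H\<^esub> v = z))) =
        (\<Sum>a\<in>?A. f a * (\<Sum>v\<in>\<phi> ` ?B. \<Phi> g v * of_bool (\<phi> a \<otimes>\<^bsub>H\<^esub> v = z)))] (mod m)"
      by (rule map_pairing[OF f A(1) order_refl A(2) finite_imageI[OF A(1)] order_refl U(1)])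
    also have "[(\<Sum>a\<in>?A. f a * (\<Sum>v\<in>\<phi> ` ?B. \<Phi> g v * of_bool (\<phi> a \<otimes>\<^bsub>H\<^esub> v = z))) = ?S] (mod m)"
      by (intro cong_sum cong_mult cong_refl
          map_pairing[OF g B(1) order_refl B(2) finite_imageI[OF B(1)] order_refl U(2)])
    finally have "(\<Phi> f \<otimes>\<^bsub>KH\<^esub> \<Phi> g) z = ?S mod m"
      using H.mult_eq[OF map_closed[OF f] finite_imageI[OF A(1)] supp_map[OF f] U(1)
          map_closed[OF g] finite_imageI[OF B(1)] supp_map[OF g] U(2) True]
      by (simp add: cong_iff_mod)
    with lhs show ?thesis by simp
  qed (simp add: group_ring_map_def group_ring_def)
qed

lemma map_of:
  assumes "g \<in> carrier G"
  shows "\<Phi> (group_ring_of (residue_ring m) G g) = group_ring_of (residue_ring m) H (\<phi> g)"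
proof
  fix z
  have A: "finite {g}" "G.supp (group_ring_of (residue_ring m) G g) \<subseteq> {g}" "{g} \<subseteq> carrier G"
    using assms by (auto simp: G.supp_def group_ring_of_def)
  show "\<Phi> (group_ring_of (residue_ring m) G g) z = group_ring_of (residue_ring m) H (\<phi> g) z"
  proof (cases "z \<in> carrier H")
    case True
    then show ?thesis
      using G.group_ring_map_eq[OF G.of_closed[OF assms] A True, of \<phi>] assms G.m
      by (auto simp: group_ring_of_def)
  qed (simp add: group_ring_map_def group_ring_of_def)
qed

end

lemma group_ring_map_compose:
  assumes "modular_group_ring_hom G H m \<phi>" "modular_group_ring_hom H L m \<psi>"
    and f: "f \<in> carrier (group_ring (residue_ring m) G)"
  shows "group_ring_map (residue_ring m) H L \<psi> (group_ring_map (residue_ring m) G H \<phi> f) =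
    group_ring_map (residue_ring m) G L (\<psi> \<circ> \<phi>) f"
proof
  fix z
  interpret phi: modular_group_ring_hom G H m \<phi> by fact
  interpret psi: modular_group_ring_hom H L m \<psi> by fact
  let ?A = "phi.G.supp f"
  have A: "finite ?A" "?A \<subseteq> carrier G" using f by (auto simp: phi.G.carrier_KG phi.G.supp_def)
  have U: "\<phi> ` ?A \<subseteq> carrier H" using A phi.hom by (auto simp: hom_def)
  show "group_ring_map (residue_ring m) H L \<psi> (group_ring_map (residue_ring m) G H \<phi> f) z =
    group_ring_map (residue_ring m) G L (\<psi> \<circ> \<phi>) f z"
  proof (cases "z \<in> carrier L")
    case True
    then show ?thesis
      using phi.H.group_ring_map_eq[OF phi.map_closed[OF f] finite_imageI[OF A(1)] phi.supp_map[OF f] U True, of \<psi>]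
        phi.map_pairing[OF f A(1) order_refl A(2) finite_imageI[OF A(1)] order_refl U, of "\<lambda>u. of_bool (\<psi> u = z)"]
        phi.G.group_ring_map_eq[OF f A(1) order_refl A(2) True, of "\<psi> \<circ> \<phi>"]
      by (simp add: cong_iff_mod)
  qed (simp add: group_ring_map_def)
qed

lemma group_ring_map_cong:
  assumes "\<And>x. x \<in> carrier G \<Longrightarrow> \<phi> x = \<psi> x"
  shows "group_ring_map K G H \<phi> = group_ring_map K G H \<psi>"
proof -
  have "{x \<in> carrier G. f x \<noteq> \<zero>\<^bsub>K\<^esub> \<and> \<phi> x = y} = {x \<in> carrier G. f x \<noteq> \<zero>\<^bsub>K\<^esub> \<and> \<psi> x = y}" for f y
    using assms by auto
  then show ?thesis by (auto simp: group_ring_map_def fun_eq_iff)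
qed

lemma ideal_power_image:
  assumes closed: "\<And>x y. x \<in> carrier A \<Longrightarrow> y \<in> carrier A \<Longrightarrow> x \<otimes>\<^bsub>A\<^esub> y \<in> carrier A"
      "\<And>x y. x \<in> carrier A \<Longrightarrow> y \<in> carrier A \<Longrightarrow> x \<oplus>\<^bsub>A\<^esub> y \<in> carrier A"
    and I: "I \<subseteq> carrier A" "h ` I \<subseteq> J"
    and h: "\<And>x. x \<in> carrier A \<Longrightarrow> h x \<in> carrier B"
      "\<And>x y. x \<in> carrier A \<Longrightarrow> y \<in> carrier A \<Longrightarrow> h (x \<otimes>\<^bsub>A\<^esub> y) = h x \<otimes>\<^bsub>B\<^esub> h y"
      "\<And>x y. x \<in> carrier A \<Longrightarrow> y \<in> carrier A \<Longrightarrow> h (x \<oplus>\<^bsub>A\<^esub> y) = h x \<oplus>\<^bsub>B\<^esub> h y"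
  shows "x \<in> ideal_power A I n \<Longrightarrow> x \<in> carrier A \<and> h x \<in> ideal_power B J n"
proof (induction n arbitrary: x)
  case 0
  then show ?case using h(1) by simp
next
  case (Suc n)
  from Suc.prems have "x \<in> ideal_prod A I (ideal_power A I n)" by simp
  then show ?case
  proof (induction x rule: ideal_prod.induct)
    case (prod i j)
    have ij: "i \<in> carrier A" "j \<in> carrier A" "h i \<in> J" "h j \<in> ideal_power B J n"
      using prod I Suc.IH by auto
    then have "h i \<otimes>\<^bsub>B\<^esub> h j \<in> ideal_power B J (Suc n)"
      by (simp add: ideal_prod.prod)
    then show ?case using ij closed h by simp
  next
    case (sum s t)
    then have "h s \<oplus>\<^bsub>B\<^esub> h t \<in> ideal_power B J (Suc n)"
      by (auto intro: ideal_prod.sum)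
    then show ?case using sum closed h by simp
  qed
qed

lemma additive_map_minus:
  assumes A: "abelian_group A" and B: "abelian_group B"
    and h: "\<And>x. x \<in> carrier A \<Longrightarrow> h x \<in> carrier B"
      "\<And>x y. x \<in> carrier A \<Longrightarrow> y \<in> carrier A \<Longrightarrow> h (x \<oplus>\<^bsub>A\<^esub> y) = h x \<oplus>\<^bsub>B\<^esub> h y"
    and x: "x \<in> carrier A" and y: "y \<in> carrier A"
  shows "h (x \<ominus>\<^bsub>A\<^esub> y) = h x \<ominus>\<^bsub>B\<^esub> h y"
proof -
  interpret A: abelian_group A by (rule A)
  interpret B: abelian_group B by (rule B)
  interpret h: group_hom "add_monoid A" "add_monoid B" h
    using A.a_group B.a_group h by (simp add: group_hom_def group_hom_axioms_def hom_def)
  have "h (\<ominus>\<^bsub>A\<^esub> y) = \<ominus>\<^bsub>B\<^esub> h y"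
    using h.hom_inv[of y] y by (simp add: a_inv_def)
  then show ?thesis using x y h by (simp add: a_minus_def)
qed

text \<open>The induced map of group rings takes \<open>f - 1\<close> to \<open>\<phi>(f) - 1\<close>, preserves augmentations and therefore
  maps powers of the augmentation ideal into powers of the augmentation ideal.\<close>

theorem zassenhaus_hom:
  assumes p: "prime p" and G: "group G" and H: "group H" and \<phi>: "\<phi> \<in> hom G H"
    and f: "f \<in> zassenhaus p G n"
  shows "\<phi> f \<in> zassenhaus p H n"
proof -
  interpret modular_group_ring_hom G H "int p" \<phi>
    using prime_gt_1_nat[OF p] G H \<phi>
    by (simp add: modular_group_ring_hom_def modular_group_ring_def modular_group_ring_axioms_def
        modular_group_ring_hom_axioms_def)
  interpret KG: abelian_group KG by (rule G.abelian_group_KG)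
  let ?I = "augmentation_ideal (prime_field p) G" and ?J = "augmentation_ideal (prime_field p) H"
  have f_mem: "f \<in> carrier G" using f by (simp add: zassenhaus_def)
  have \<phi>f: "\<phi> f \<in> carrier H" using f_mem \<phi> by (auto simp: hom_def)
  have "\<Phi> (group_ring_of (prime_field p) G f \<ominus>\<^bsub>KG\<^esub> \<one>\<^bsub>KG\<^esub>) =
      group_ring_of (prime_field p) H (\<phi> f) \<ominus>\<^bsub>KH\<^esub> \<one>\<^bsub>KH\<^esub>"
    unfolding G.one_eq_of H.one_eq_of
    using additive_map_minus[of KG KH \<Phi> "group_ring_of (prime_field p) G f"
        "group_ring_of (prime_field p) G \<one>\<^bsub>G\<^esub>"]
      f_mem hom_one[OF \<phi> G H]
    by (simp add: G.abelian_group_KG H.abelian_group_KG map_closed map_add G.of_closed map_of)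
  moreover have "\<Phi> ` ?I \<subseteq> ?J"
    by (auto simp: augmentation_ideal_def map_closed map_augmentation)
  then have "\<Phi> x \<in> ideal_power KH ?J n" if "x \<in> ideal_power KG ?I n" for x
    using ideal_power_image[of KG ?I \<Phi> ?J KH x n] that
    by (simp add: augmentation_ideal_def map_closed map_mult map_add G.mult_closed)
  ultimately show ?thesis
    using f \<phi>f unfolding zassenhaus_def mem_Collect_eq by metis
qed

lemma zero_in_ideal_power:
  assumes "\<zero>\<^bsub>A\<^esub> \<in> carrier A" "\<zero>\<^bsub>A\<^esub> \<in> I" "\<zero>\<^bsub>A\<^esub> \<otimes>\<^bsub>A\<^esub> \<zero>\<^bsub>A\<^esub> = \<zero>\<^bsub>A\<^esub>"
  shows "\<zero>\<^bsub>A\<^esub> \<in> ideal_power A I n"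
proof (induction n)
  case (Suc n)
  then show ?case using ideal_prod.prod[OF assms(2) Suc, of A] assms(3) by simp
qed (use assms in simp)

context modular_group_ring
begin

lemma supp_zero: "supp \<zero>\<^bsub>KG\<^esub> = {}"
  by (auto simp: supp_def group_ring_def)

lemma zero_mult: "\<zero>\<^bsub>KG\<^esub> \<otimes>\<^bsub>KG\<^esub> \<zero>\<^bsub>KG\<^esub> = \<zero>\<^bsub>KG\<^esub>"
proof
  fix x
  interpret A: abelian_group KG by (rule abelian_group_KG)
  show "(\<zero>\<^bsub>KG\<^esub> \<otimes>\<^bsub>KG\<^esub> \<zero>\<^bsub>KG\<^esub>) x = \<zero>\<^bsub>KG\<^esub> x"
  proof (cases "x \<in> carrier G")
    case True
    then have "(\<zero>\<^bsub>KG\<^esub> \<otimes>\<^bsub>KG\<^esub> \<zero>\<^bsub>KG\<^esub>) x = 0"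
      using mult_eq[OF A.zero_closed _ _ _ A.zero_closed, of "{}" "{}"] supp_zero by simp
    then show ?thesis using True by (simp add: group_ring_def)
  qed (simp add: group_ring_def)
qed

lemma zero_augmentation: "augmentation (residue_ring m) G \<zero>\<^bsub>KG\<^esub> = 0"
  using augmentation_eq[OF abelian_groupE(2)[OF abelian_group_KG], of "{}"] supp_zero by simp

end

lemma zassenhaus_one:
  assumes p: "prime p" and F: "group F"
  shows "\<one>\<^bsub>F\<^esub> \<in> zassenhaus p F n"
proof -
  interpret modular_group_ring F "int p"
    using prime_gt_1_nat[OF p] F by (simp add: modular_group_ring_def modular_group_ring_axioms_def)
  interpret A: abelian_group KG by (rule abelian_group_KG)
  have "\<zero>\<^bsub>KG\<^esub> \<in> ideal_power KG (augmentation_ideal (prime_field p) F) n"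
    by (rule zero_in_ideal_power)
      (simp_all add: augmentation_ideal_def zero_mult zero_augmentation)
  moreover have "\<one>\<^bsub>KG\<^esub> \<in> carrier KG" unfolding one_eq_of by (simp add: of_closed)
  then have "\<one>\<^bsub>KG\<^esub> \<ominus>\<^bsub>KG\<^esub> \<one>\<^bsub>KG\<^esub> = \<zero>\<^bsub>KG\<^esub>" by (simp add: a_minus_def A.r_neg)
  ultimately show ?thesis by (simp add: zassenhaus_def one_eq_of[symmetric])
qed

lemma (in group) conjugation_hom: "g \<in> carrier G \<Longrightarrow> (\<lambda>x. g \<otimes> x \<otimes> inv g) \<in> hom G G"
  by (rule homI) (simp_all add: m_assoc flip: m_assoc[of "inv g" g])

lemma zassenhaus_conj:
  assumes p: "prime p" and F: "group F" and f: "f \<in> zassenhaus p F n" and g: "g \<in> carrier F"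
  shows "g \<otimes>\<^bsub>F\<^esub> f \<otimes>\<^bsub>F\<^esub> inv\<^bsub>F\<^esub> g \<in> zassenhaus p F n"
  using zassenhaus_hom[OF p F F group.conjugation_hom[OF F g] f] .

section \<open>Inverse limits, completed group rings and the pro-\<open>p\<close> Zassenhaus filtration\<close>

lemma limit_carrierD:
  assumes "x \<in> limit_carrier I A \<theta>"
  shows "N \<in> I \<Longrightarrow> x N \<in> A N" "N \<notin> I \<Longrightarrow> x N = undefined"
    "N \<in> I \<Longrightarrow> M \<in> I \<Longrightarrow> N \<subseteq> M \<Longrightarrow> \<theta> N M (x N) = x M"
  using assms by (auto simp: limit_carrier_def PiE_def extensional_def)

lemma limit_carrierI:
  assumes "\<And>N. N \<in> I \<Longrightarrow> f N \<in> A N"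
    "\<And>N M. N \<in> I \<Longrightarrow> M \<in> I \<Longrightarrow> N \<subseteq> M \<Longrightarrow> \<theta> N M (f N) = f M"
  shows "(\<lambda>N\<in>I. f N) \<in> limit_carrier I A \<theta>"
  using assms by (auto simp: limit_carrier_def)

lemma limit_ext:
  assumes "x \<in> limit_carrier I A \<theta>" "y \<in> limit_carrier I A \<theta>" "\<And>N. N \<in> I \<Longrightarrow> x N = y N"
  shows "x = y"
  using assms limit_carrierD(2) by (metis ext)

lemma topspace_limit [simp]: "topspace (limit_topology I A \<theta>) = limit_carrier I A \<theta>"
  by (auto simp: limit_topology_def limit_carrier_def)

lemma openin_limit_coordinate:
  assumes "N \<in> I"
  shows "openin (limit_topology I A \<theta>) {x \<in> limit_carrier I A \<theta>. x N \<in> V}"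
proof -
  have "continuous_map (limit_topology I A \<theta>) (discrete_topology (A N)) (\<lambda>x. x N)"
    unfolding limit_topology_def
    by (rule continuous_map_from_subtopology[OF continuous_map_product_projection[OF assms]])
  from openin_continuous_map_preimage[OF this, of "V \<inter> A N"]
  have "openin (limit_topology I A \<theta>) {x \<in> limit_carrier I A \<theta>. x N \<in> V \<inter> A N}"
    by simp
  also have "{x \<in> limit_carrier I A \<theta>. x N \<in> V \<inter> A N} = {x \<in> limit_carrier I A \<theta>. x N \<in> V}"
    using assms limit_carrierD(1) by auto
  finally show ?thesis .
qed

text \<open>Each component of \<open>h x\<close> depends on a single component of \<open>x\<close>, which lives in a discrete space.\<close>

lemma continuous_map_limit:
  assumes h: "\<And>x. x \<in> limit_carrier I A \<theta> \<Longrightarrow> h x \<in> limit_carrier J B \<eta>"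
    and fac: "\<And>M. M \<in> J \<Longrightarrow> \<exists>N\<in>I. \<forall>x\<in>limit_carrier I A \<theta>. \<forall>y\<in>limit_carrier I A \<theta>.
      x N = y N \<longrightarrow> h x M = h y M"
  shows "continuous_map (limit_topology I A \<theta>) (limit_topology J B \<eta>) h"
proof -
  let ?L = "limit_carrier I A \<theta>"
  have "continuous_map (limit_topology I A \<theta>) (discrete_topology (B M)) (\<lambda>x. h x M)" if M: "M \<in> J" for M
  proof -
    obtain N where N: "N \<in> I" "\<And>x y. x \<in> ?L \<Longrightarrow> y \<in> ?L \<Longrightarrow> x N = y N \<Longrightarrow> h x M = h y M"
      using fac[OF M] by blast
    have "openin (limit_topology I A \<theta>) {x \<in> ?L. h x M \<in> U}" for U
    proof -
      have "{x \<in> ?L. h x M \<in> U} = {x \<in> ?L. x N \<in> {y N |y. y \<in> ?L \<and> h y M \<in> U}}"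
      proof (intro equalityI subsetI)
        fix x assume "x \<in> {x \<in> ?L. x N \<in> {y N |y. y \<in> ?L \<and> h y M \<in> U}}"
        then obtain y where "x \<in> ?L" "y \<in> ?L" "x N = y N" "h y M \<in> U" by blast
        then show "x \<in> {x \<in> ?L. h x M \<in> U}" using N(2)[of x y] by simp
      qed blast
      then show ?thesis by (simp only: openin_limit_coordinate[OF N(1)])
    qed
    then show ?thesis
      using limit_carrierD(1)[OF h M] by (simp add: continuous_map_def Pi_def)
  qed
  moreover have "h ` topspace (limit_topology I A \<theta>) \<subseteq> extensional J"
    using limit_carrierD(2)[OF h] by (auto simp: extensional_def)
  ultimately have "continuous_map (limit_topology I A \<theta>) (product_topology (\<lambda>M. discrete_topology (B M)) J) h"
    unfolding continuous_map_componentwise by blast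
  then show ?thesis
    unfolding limit_topology_def[of J] using h by (intro continuous_map_into_subtopology) auto
qed

text \<open>Finitely many coordinates of a point of the limit are determined by a single one because the
  system is directed. This reduces closures to conditions in the finite quotients.\<close>

lemma closure_of_limit:
  assumes I: "I \<noteq> {}" and dir: "\<And>N M. N \<in> I \<Longrightarrow> M \<in> I \<Longrightarrow> \<exists>L\<in>I. L \<subseteq> N \<and> L \<subseteq> M"
    and S: "S \<subseteq> limit_carrier I A \<theta>"
  shows "limit_topology I A \<theta> closure_of S =
    {x \<in> limit_carrier I A \<theta>. \<forall>N\<in>I. \<exists>c\<in>S. c N = x N}"
proof (intro equalityI subsetI)
  fix x assume x: "x \<in> limit_topology I A \<theta> closure_of S"
  then have xL: "x \<in> limit_carrier I A \<theta>"
    and x: "\<And>W. x \<in> W \<Longrightarrow> openin (limit_topology I A \<theta>) W \<Longrightarrow> \<exists>y\<in>S. y \<in> W"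
    by (auto simp: in_closure_of)
  have "\<exists>c\<in>S. c N = x N" if "N \<in> I" for N
    using x[OF _ openin_limit_coordinate[OF that, of _ _ "{x N}"]] xL by auto
  then show "x \<in> {x \<in> limit_carrier I A \<theta>. \<forall>N\<in>I. \<exists>c\<in>S. c N = x N}" using xL by simp
next
  fix x assume x: "x \<in> {x \<in> limit_carrier I A \<theta>. \<forall>N\<in>I. \<exists>c\<in>S. c N = x N}"
  have "\<exists>y\<in>S. y \<in> W" if W: "x \<in> W" "openin (limit_topology I A \<theta>) W" for W
  proof -
    obtain W' where W': "openin (product_topology (\<lambda>N. discrete_topology (A N)) I) W'"
      "W = W' \<inter> limit_carrier I A \<theta>"
      using W(2) unfolding limit_topology_def openin_subtopology by blast
    then have "x \<in> W'" using W(1) by simp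
    then obtain U where U: "finite {i \<in> I. U i \<noteq> A i}" "x \<in> Pi\<^sub>E I U" "Pi\<^sub>E I U \<subseteq> W'"
      using W'(1) unfolding openin_product_topology_alt by auto
    have "\<exists>L\<in>I. \<forall>i\<in>J. L \<subseteq> i" if "finite J" "J \<subseteq> I" for J
      using that
    proof (induction J rule: finite_induct)
      case empty
      then show ?case using I by auto
    next
      case (insert i J)
      then obtain L where "L \<in> I" "\<forall>i\<in>J. L \<subseteq> i" by auto
      moreover obtain L' where "L' \<in> I" "L' \<subseteq> L" "L' \<subseteq> i"
        using dir[OF \<open>L \<in> I\<close>, of i] insert.prems by auto
      ultimately show ?case by (intro bexI[of _ L']) auto
    qed
    from this[OF U(1)] obtain L where L: "L \<in> I" "\<And>i. i \<in> I \<Longrightarrow> U i \<noteq> A i \<Longrightarrow> L \<subseteq> i" by auto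
    obtain c where c: "c \<in> S" "c L = x L" using x L(1) by auto
    have cL: "c \<in> limit_carrier I A \<theta>" and xL: "x \<in> limit_carrier I A \<theta>" using c S x by auto
    have "c \<in> Pi\<^sub>E I U"
    proof (rule PiE_I)
      fix i assume i: "i \<in> I"
      show "c i \<in> U i"
      proof (cases "U i = A i")
        case True
        then show ?thesis using limit_carrierD(1)[OF cL i] by simp
      next
        case False
        then have "c i = x i"
          using limit_carrierD(3)[OF cL L(1) i] limit_carrierD(3)[OF xL L(1) i] L(2)[OF i] c(2) by metis
        then show ?thesis using U(2) i by auto
      qed
    qed (rule limit_carrierD(2)[OF cL])
    then show ?thesis using c(1) cL U(3) W'(2) by auto
  qed
  then show "x \<in> limit_topology I A \<theta> closure_of S"
    using x by (auto simp: in_closure_of)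
qed

lemma quotient_map_of_coset:
  assumes "U \<lhd> G" "V \<lhd> G" "U \<subseteq> V" "g \<in> carrier G"
  shows "quotient_map_of G U V (U #>\<^bsub>G\<^esub> g) = V #>\<^bsub>G\<^esub> g"
proof -
  interpret U: normal U G by fact
  interpret V: normal V G by fact
  have "V <#>\<^bsub>G\<^esub> U = V"
    using V.subset V.rcosets_mult_eq assms(3) U.one_closed
    by (force simp: set_mult_def intro!: exI[of _ "\<one>\<^bsub>G\<^esub>"])
  then show ?thesis
    using U.setmult_rcos_assoc[OF V.subset U.subset assms(4)] by (simp add: quotient_map_of_def)
qed

lemma quotient_map_of_hom:
  assumes "U \<lhd> G" "V \<lhd> G" "U \<subseteq> V"
  shows "quotient_map_of G U V \<in> hom (G Mod U) (G Mod V)"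
proof -
  interpret U: normal U G by fact
  interpret V: normal V G by fact
  show ?thesis
    by (rule homI)
      (auto simp: carrier_FactGroup quotient_map_of_coset[OF assms] U.rcos_sum V.rcos_sum)
qed

text \<open>The map from \<open>G/s\<inverse>(V)\<close> to \<open>H/V\<close> induced by \<open>s\<close>, on cosets as sets.\<close>

definition induced_map ::
    "('a, 'm) monoid_scheme \<Rightarrow> ('a \<Rightarrow> 'b) \<Rightarrow> 'b set \<Rightarrow> ('b, 'k) monoid_scheme \<Rightarrow> 'a set \<Rightarrow> 'b set" where
  "induced_map G s V H C = V <#>\<^bsub>H\<^esub> s ` C"

abbreviation vimage_in :: "('a, 'm) monoid_scheme \<Rightarrow> ('a \<Rightarrow> 'b) \<Rightarrow> 'b set \<Rightarrow> 'a set" where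
  "vimage_in G s V \<equiv> {x \<in> carrier G. s x \<in> V}"

lemma vimage_in_normal:
  assumes "group G" "s \<in> hom G H" "V \<lhd> H"
  shows "vimage_in G s V \<lhd> G"
proof -
  interpret V: normal V H by fact
  interpret s: group_hom G H s
    using assms V.is_group by (simp add: group_hom_def group_hom_axioms_def)
  show ?thesis
  proof (rule s.G.normal_invI)
    show "subgroup (vimage_in G s V) G"
      by (rule s.G.subgroupI) (auto intro: exI[of _ "\<one>\<^bsub>G\<^esub>"])
  qed (auto simp: V.inv_op_closed2)
qed

lemma induced_map_coset:
  assumes "group G" "s \<in> hom G H" "V \<lhd> H" "g \<in> carrier G"
  shows "induced_map G s V H (vimage_in G s V #>\<^bsub>G\<^esub> g) = V #>\<^bsub>H\<^esub> s g"
proof -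
  interpret V: normal V H by fact
  interpret s: group_hom G H s
    using assms V.is_group by (simp add: group_hom_def group_hom_axioms_def)
  show ?thesis
  proof (intro equalityI subsetI)
    fix y assume "y \<in> induced_map G s V H (vimage_in G s V #>\<^bsub>G\<^esub> g)"
    then obtain v u where "v \<in> V" "u \<in> carrier G" "s u \<in> V" "y = v \<otimes>\<^bsub>H\<^esub> s (u \<otimes>\<^bsub>G\<^esub> g)"
      by (auto simp: induced_map_def set_mult_def r_coset_def)
    then show "y \<in> V #>\<^bsub>H\<^esub> s g"
      using assms(4) V.mem_carrier by (auto simp: r_coset_def V.m_assoc[symmetric])
  next
    fix y assume "y \<in> V #>\<^bsub>H\<^esub> s g"
    then obtain v where "v \<in> V" "y = v \<otimes>\<^bsub>H\<^esub> s g" by (auto simp: r_coset_def)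
    moreover have "g \<in> vimage_in G s V #>\<^bsub>G\<^esub> g"
      using assms(4) by (auto simp: r_coset_def intro!: bexI[of _ "\<one>\<^bsub>G\<^esub>"] exI[of _ "\<one>\<^bsub>G\<^esub>"])
    ultimately show "y \<in> induced_map G s V H (vimage_in G s V #>\<^bsub>G\<^esub> g)"
      by (auto simp: induced_map_def set_mult_def)
  qed
qed

lemma induced_map_hom:
  assumes "group G" "s \<in> hom G H" "V \<lhd> H"
  shows "induced_map G s V H \<in> hom (G Mod vimage_in G s V) (H Mod V)"
proof -
  interpret V: normal V H by fact
  interpret U: normal "vimage_in G s V" G by (rule vimage_in_normal[OF assms])
  interpret s: group_hom G H s
    using assms V.is_group by (simp add: group_hom_def group_hom_axioms_def)
  show ?thesis
  proof (rule homI)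
    fix C assume "C \<in> carrier (G Mod vimage_in G s V)"
    then obtain g where g: "g \<in> carrier G" "C = vimage_in G s V #>\<^bsub>G\<^esub> g"
      unfolding carrier_FactGroup by blast
    show "induced_map G s V H C \<in> carrier (H Mod V)"
      unfolding g(2) induced_map_coset[OF assms g(1)] carrier_FactGroup
      using s.hom_closed[OF g(1)] by (rule imageI)
    fix D assume "D \<in> carrier (G Mod vimage_in G s V)"
    then obtain k where k: "k \<in> carrier G" "D = vimage_in G s V #>\<^bsub>G\<^esub> k"
      unfolding carrier_FactGroup by blast
    show "induced_map G s V H (C \<otimes>\<^bsub>G Mod vimage_in G s V\<^esub> D) =
        induced_map G s V H C \<otimes>\<^bsub>H Mod V\<^esub> induced_map G s V H D"
      unfolding g(2) k(2) mult_FactGroup U.rcos_sum[OF g(1) k(1)] induced_map_coset[OF assms g(1)]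
        induced_map_coset[OF assms k(1)] induced_map_coset[OF assms U.m_closed[OF g(1) k(1)]]
        V.rcos_sum[OF s.hom_closed[OF g(1)] s.hom_closed[OF k(1)]] s.hom_mult[OF g(1) k(1)] ..
  qed
qed

locale completed_ring = G: group G for G :: "('a, 'm) monoid_scheme" and T :: "'a topology" and m :: int +
  assumes m: "m > 1" and topspace: "topspace T = carrier G"
begin

abbreviation (input) "K \<equiv> residue_ring m"
abbreviation (input) "\<I> \<equiv> open_normal G T"
abbreviation (input) "AU \<equiv> \<lambda>U. group_ring K (G Mod U)"
abbreviation (input) "\<A> \<equiv> completed_group_ring K G T"

lemma component_ring: "U \<in> \<I> \<Longrightarrow> modular_group_ring (G Mod U) m"
  using normal.factorgroup_is_group[of U G] m
  by (simp add: open_normal_def modular_group_ring_def modular_group_ring_axioms_def)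

lemma transition_hom:
  assumes "U \<in> \<I>" "V \<in> \<I>" "U \<subseteq> V"
  shows "modular_group_ring_hom (G Mod U) (G Mod V) m (quotient_map_of G U V)"
  using component_ring assms quotient_map_of_hom[of U G V]
  by (simp add: modular_group_ring_hom_def modular_group_ring_hom_axioms_def open_normal_def)

lemma carrier_completed: "carrier \<A> = limit_carrier \<I> (\<lambda>U. carrier (AU U)) (completed_transition K G)"
  and mult_completed: "x \<otimes>\<^bsub>\<A>\<^esub> y = (\<lambda>U\<in>\<I>. x U \<otimes>\<^bsub>AU U\<^esub> y U)"
  and add_completed: "x \<oplus>\<^bsub>\<A>\<^esub> y = (\<lambda>U\<in>\<I>. x U \<oplus>\<^bsub>AU U\<^esub> y U)"
  and zero_completed: "\<zero>\<^bsub>\<A>\<^esub> = (\<lambda>U\<in>\<I>. \<zero>\<^bsub>AU U\<^esub>)"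
  and one_completed: "\<one>\<^bsub>\<A>\<^esub> = (\<lambda>U\<in>\<I>. \<one>\<^bsub>AU U\<^esub>)"
  by (simp_all add: completed_group_ring_def Let_def)

lemma component:
  assumes "x \<in> carrier \<A>" "U \<in> \<I>"
  shows "x U \<in> carrier (AU U)"
  using limit_carrierD(1)[OF assms(1)[unfolded carrier_completed] assms(2)] .

lemma completed_mult_closed:
  assumes "x \<in> carrier \<A>" "y \<in> carrier \<A>"
  shows "x \<otimes>\<^bsub>\<A>\<^esub> y \<in> carrier \<A>"
  unfolding carrier_completed mult_completed
proof (rule limit_carrierI)
  fix U assume U: "U \<in> \<I>"
  show "x U \<otimes>\<^bsub>AU U\<^esub> y U \<in> carrier (AU U)"
    using modular_group_ring.mult_closed[OF component_ring[OF U]] component U assms by blast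
  fix V assume V: "V \<in> \<I>" "U \<subseteq> V"
  show "completed_transition K G U V (x U \<otimes>\<^bsub>AU U\<^esub> y U) = x V \<otimes>\<^bsub>AU V\<^esub> y V"
    using modular_group_ring_hom.map_mult[OF transition_hom[OF U V] component[OF assms(1) U] component[OF assms(2) U]]
      limit_carrierD(3)[OF assms(1)[unfolded carrier_completed] U V]
      limit_carrierD(3)[OF assms(2)[unfolded carrier_completed] U V]
    by (simp add: completed_transition_def)
qed

lemma abelian_group_completed: "abelian_group \<A>"
proof (rule abelian_groupI)
  have ab: "abelian_group (AU U)" if "U \<in> \<I>" for U
    using modular_group_ring.abelian_group_KG[OF component_ring[OF that]] .
  note [simp] = carrier_completed add_completed zero_completed
  fix x y z assume x: "x \<in> carrier \<A>" and y: "y \<in> carrier \<A>"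
  have trans: "completed_transition K G U V (x U \<oplus>\<^bsub>AU U\<^esub> y U) = x V \<oplus>\<^bsub>AU V\<^esub> y V"
    if U: "U \<in> \<I>" and V: "V \<in> \<I>" "U \<subseteq> V" for U V
    using modular_group_ring_hom.map_add[OF transition_hom[OF U V] component[OF x U] component[OF y U]]
      limit_carrierD(3)[OF x[unfolded carrier_completed] U V]
      limit_carrierD(3)[OF y[unfolded carrier_completed] U V]
    by (simp add: completed_transition_def)
  show "x \<oplus>\<^bsub>\<A>\<^esub> y \<in> carrier \<A>"
    unfolding carrier_completed add_completed
    by (rule limit_carrierI)
      (auto intro: abelian_groupE(1)[OF ab] component[OF x] component[OF y] trans)
  show "x \<oplus>\<^bsub>\<A>\<^esub> y = y \<oplus>\<^bsub>\<A>\<^esub> x"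
    using abelian_groupE(4)[OF ab] component[OF x] component[OF y] by (auto intro!: restrict_ext)
  assume z: "z \<in> carrier \<A>"
  show "x \<oplus>\<^bsub>\<A>\<^esub> y \<oplus>\<^bsub>\<A>\<^esub> z = x \<oplus>\<^bsub>\<A>\<^esub> (y \<oplus>\<^bsub>\<A>\<^esub> z)"
    using abelian_groupE(3)[OF ab] component[OF x] component[OF y] component[OF z]
    by (auto intro!: restrict_ext)
next
  have ab: "abelian_group (AU U)" if "U \<in> \<I>" for U
    using modular_group_ring.abelian_group_KG[OF component_ring[OF that]] .
  have minus: "completed_transition K G U V (f \<ominus>\<^bsub>AU U\<^esub> g) =
      completed_transition K G U V f \<ominus>\<^bsub>AU V\<^esub> completed_transition K G U V g"
    if U: "U \<in> \<I>" and V: "V \<in> \<I>" "U \<subseteq> V" and f: "f \<in> carrier (AU U)" "g \<in> carrier (AU U)" for U V f g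
  proof -
    interpret modular_group_ring_hom "G Mod U" "G Mod V" m "quotient_map_of G U V"
      by (rule transition_hom[OF U V])
    show ?thesis
      unfolding completed_transition_def
      by (rule additive_map_minus[OF ab[OF U] ab[OF V(1)]]) (simp_all add: map_closed map_add f)
  qed
  have minus_self: "f \<ominus>\<^bsub>AU U\<^esub> f = \<zero>\<^bsub>AU U\<^esub>" if "U \<in> \<I>" "f \<in> carrier (AU U)" for U f
    using abelian_group.r_neg[OF ab[OF that(1)] that(2)] by (simp add: a_minus_def)
  have zero_closed: "\<zero>\<^bsub>AU U\<^esub> \<in> carrier (AU U)" if "U \<in> \<I>" for U
    using abelian_groupE(2)[OF ab[OF that]] .
  have trans_closed: "completed_transition K G U V f \<in> carrier (AU V)"
    if "U \<in> \<I>" "V \<in> \<I>" "U \<subseteq> V" "f \<in> carrier (AU U)" for U V f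
    using modular_group_ring_hom.map_closed[OF transition_hom] that by (simp add: completed_transition_def)
  have trans_zero: "completed_transition K G U V \<zero>\<^bsub>AU U\<^esub> = \<zero>\<^bsub>AU V\<^esub>"
    if "U \<in> \<I>" "V \<in> \<I>" "U \<subseteq> V" for U V
    using minus[OF that zero_closed zero_closed] that zero_closed trans_closed minus_self by metis
  show "\<zero>\<^bsub>\<A>\<^esub> \<in> carrier \<A>"
    unfolding carrier_completed zero_completed
    by (rule limit_carrierI) (auto intro: zero_closed trans_zero)
  fix x assume x: "x \<in> carrier \<A>"
  have "\<zero>\<^bsub>\<A>\<^esub> \<oplus>\<^bsub>\<A>\<^esub> x = (\<lambda>U\<in>\<I>. x U)"
    unfolding add_completed zero_completed
    using abelian_groupE(5)[OF ab] component[OF x] by (auto intro!: restrict_ext)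
  also have "\<dots> = x"
    using limit_carrierD(2)[OF x[unfolded carrier_completed]] by (auto simp: restrict_def)
  finally show "\<zero>\<^bsub>\<A>\<^esub> \<oplus>\<^bsub>\<A>\<^esub> x = x" .
  let ?y = "\<lambda>U\<in>\<I>. \<zero>\<^bsub>AU U\<^esub> \<ominus>\<^bsub>AU U\<^esub> x U"
  have "?y \<in> carrier \<A>"
    unfolding carrier_completed
  proof (rule limit_carrierI)
    fix U assume U: "U \<in> \<I>"
    interpret ab: abelian_group "AU U" by (rule ab[OF U])
    show "\<zero>\<^bsub>AU U\<^esub> \<ominus>\<^bsub>AU U\<^esub> x U \<in> carrier (AU U)" using component[OF x U] by simp
    fix V assume V: "V \<in> \<I>" "U \<subseteq> V"
    show "completed_transition K G U V (\<zero>\<^bsub>AU U\<^esub> \<ominus>\<^bsub>AU U\<^esub> x U) = \<zero>\<^bsub>AU V\<^esub> \<ominus>\<^bsub>AU V\<^esub> x V"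
      using minus[OF U V zero_closed[OF U] component[OF x U]] trans_zero[OF U V]
        limit_carrierD(3)[OF x[unfolded carrier_completed] U V] by simp
  qed
  moreover have "?y \<oplus>\<^bsub>\<A>\<^esub> x = \<zero>\<^bsub>\<A>\<^esub>"
    unfolding add_completed zero_completed
  proof (rule restrict_ext)
    fix U assume U: "U \<in> \<I>"
    interpret ab: abelian_group "AU U" by (rule ab[OF U])
    show "?y U \<oplus>\<^bsub>AU U\<^esub> x U = \<zero>\<^bsub>AU U\<^esub>"
      using U component[OF x U] by (simp add: a_minus_def ab.l_neg)
  qed
  ultimately show "\<exists>y\<in>carrier \<A>. y \<oplus>\<^bsub>\<A>\<^esub> x = \<zero>\<^bsub>\<A>\<^esub>" by blast
qed

lemma completed_of_closed:
  assumes g: "g \<in> carrier G"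
  shows "completed_group_ring_of K G T g \<in> carrier \<A>"
  unfolding carrier_completed completed_group_ring_of_def
proof (rule limit_carrierI)
  fix U assume U: "U \<in> \<I>"
  have gU: "U #>\<^bsub>G\<^esub> g \<in> carrier (G Mod U)" using g by (auto simp: carrier_FactGroup)
  show "group_ring_of K (G Mod U) (U #>\<^bsub>G\<^esub> g) \<in> carrier (AU U)"
    by (rule modular_group_ring.of_closed[OF component_ring[OF U] gU])
  fix V assume V: "V \<in> \<I>" "U \<subseteq> V"
  then show "completed_transition K G U V (group_ring_of K (G Mod U) (U #>\<^bsub>G\<^esub> g)) =
      group_ring_of K (G Mod V) (V #>\<^bsub>G\<^esub> g)"
    using modular_group_ring_hom.map_of[OF transition_hom[OF U V] gU] U g
    by (simp add: completed_transition_def quotient_map_of_coset open_normal_def)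
qed

lemma one_eq_of: "\<one>\<^bsub>\<A>\<^esub> = completed_group_ring_of K G T \<one>\<^bsub>G\<^esub>"
  unfolding one_completed completed_group_ring_of_def
proof (rule restrict_ext)
  fix U assume U: "U \<in> \<I>"
  then interpret U: normal U G by (simp add: open_normal_def)
  show "\<one>\<^bsub>AU U\<^esub> = group_ring_of K (G Mod U) (U #>\<^bsub>G\<^esub> \<one>\<^bsub>G\<^esub>)"
    using modular_group_ring.one_eq_of[OF component_ring[OF U]] U.subset by simp
qed

lemma carrier_open_normal: "carrier G \<in> \<I>"
  using topspace G.normal_self openin_topspace[of T] by (simp add: open_normal_def)

end

text \<open>The components of the induced map of completed group rings are the maps of group rings induced by
  \<open>G/s\<inverse>(V) \<rightarrow> H/V\<close>. It is continuous, so it maps the closure of a power of the augmentation ideal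
  into the closure of that power.\<close>

theorem pro_p_zassenhaus_hom:
  assumes p: "prime p" and G: "group G" "topspace T = carrier G" and H: "group H" "topspace T' = carrier H"
    and s: "s \<in> hom G H" "continuous_map T T' s"
    and f: "f \<in> pro_p_zassenhaus p G T n"
  shows "s f \<in> pro_p_zassenhaus p H T' n"
proof -
  let ?K = "prime_field p"
  have p1: "int p > 1" using prime_gt_1_nat[OF p] by simp
  interpret G: completed_ring G T "int p"
    using G p1 by (simp add: completed_ring_def completed_ring_axioms_def)
  interpret H: completed_ring H T' "int p"
    using H p1 by (simp add: completed_ring_def completed_ring_axioms_def)
  let ?I = "open_normal G T" and ?J = "open_normal H T'"
  let ?A = "completed_group_ring ?K G T" and ?B = "completed_group_ring ?K H T'"
  let ?v = "vimage_in G s"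
  have s_closed: "s x \<in> carrier H" if "x \<in> carrier G" for x using that s by (auto simp: hom_def)
  have normal: "V \<lhd> H" if "V \<in> ?J" for V using that by (simp add: open_normal_def)
  have v: "?v V \<in> ?I" if "V \<in> ?J" for V
    using that vimage_in_normal[OF G(1) s(1)] openin_continuous_map_preimage[OF s(2)] G(2)
    by (auto simp: open_normal_def)
  have hom: "modular_group_ring_hom (G Mod ?v V) (H Mod V) (int p) (induced_map G s V H)"
    if V: "V \<in> ?J" for V
    using G.component_ring[OF v[OF V]] H.component_ring[OF V] induced_map_hom[OF G(1) s(1) normal[OF V]]
    by (simp add: modular_group_ring_hom_def modular_group_ring_hom_axioms_def)
  define \<Phi> where "\<Phi> V = group_ring_map ?K (G Mod ?v V) (H Mod V) (induced_map G s V H)" for V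
  define h where "h x = (\<lambda>V\<in>?J. \<Phi> V (x (?v V)))" for x
  have h_closed: "h x \<in> carrier ?B" if x: "x \<in> carrier ?A" for x
    unfolding h_def H.carrier_completed
  proof (rule limit_carrierI)
    fix V assume V: "V \<in> ?J"
    note xV = G.component[OF x v[OF V]]
    show "\<Phi> V (x (?v V)) \<in> carrier (group_ring ?K (H Mod V))"
      unfolding \<Phi>_def by (rule modular_group_ring_hom.map_closed[OF hom[OF V] xV])
    fix W assume W: "W \<in> ?J" "V \<subseteq> W"
    have vW: "?v V \<subseteq> ?v W" using W by auto
    have "completed_transition ?K H V W (\<Phi> V (x (?v V))) =
        group_ring_map ?K (G Mod ?v V) (H Mod W) (quotient_map_of H V W \<circ> induced_map G s V H) (x (?v V))"
      unfolding completed_transition_def \<Phi>_def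
      by (rule group_ring_map_compose[OF hom[OF V] H.transition_hom[OF V W] xV])
    also have "group_ring_map ?K (G Mod ?v V) (H Mod W) (quotient_map_of H V W \<circ> induced_map G s V H) =
        group_ring_map ?K (G Mod ?v V) (H Mod W) (induced_map G s W H \<circ> quotient_map_of G (?v V) (?v W))"
    proof (rule group_ring_map_cong)
      fix C assume "C \<in> carrier (G Mod ?v V)"
      then obtain g where g: "g \<in> carrier G" "C = ?v V #>\<^bsub>G\<^esub> g"
        unfolding carrier_FactGroup by blast
      show "(quotient_map_of H V W \<circ> induced_map G s V H) C =
          (induced_map G s W H \<circ> quotient_map_of G (?v V) (?v W)) C"
        using g induced_map_coset[OF G(1) s(1) normal[OF V] g(1)] induced_map_coset[OF G(1) s(1) normal[OF W(1)] g(1)]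
          quotient_map_of_coset[OF normal[OF V] normal[OF W(1)] W(2) s_closed[OF g(1)]]
          quotient_map_of_coset[OF vimage_in_normal[OF G(1) s(1) normal[OF V]]
            vimage_in_normal[OF G(1) s(1) normal[OF W(1)]] vW g(1)] by simp
    qed
    also have "group_ring_map ?K (G Mod ?v V) (H Mod W)
          (induced_map G s W H \<circ> quotient_map_of G (?v V) (?v W)) (x (?v V)) =
        \<Phi> W (completed_transition ?K G (?v V) (?v W) (x (?v V)))"
      unfolding completed_transition_def \<Phi>_def
      by (rule group_ring_map_compose[OF G.transition_hom[OF v[OF V] v[OF W(1)] vW] hom[OF W(1)] xV, symmetric])
    also have "completed_transition ?K G (?v V) (?v W) (x (?v V)) = x (?v W)"
      by (rule limit_carrierD(3)[OF x[unfolded G.carrier_completed] v[OF V] v[OF W(1)] vW])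
    finally show "completed_transition ?K H V W (\<Phi> V (x (?v V))) = \<Phi> W (x (?v W))" .
  qed
  have h_mult: "h (x \<otimes>\<^bsub>?A\<^esub> y) = h x \<otimes>\<^bsub>?B\<^esub> h y" if "x \<in> carrier ?A" "y \<in> carrier ?A" for x y
    unfolding G.mult_completed H.mult_completed h_def
    by (rule restrict_ext)
      (use v that in \<open>simp add: \<Phi>_def modular_group_ring_hom.map_mult[OF hom] G.component\<close>)
  have h_add: "h (x \<oplus>\<^bsub>?A\<^esub> y) = h x \<oplus>\<^bsub>?B\<^esub> h y" if "x \<in> carrier ?A" "y \<in> carrier ?A" for x y
    unfolding G.add_completed H.add_completed h_def
    by (rule restrict_ext)
      (use v that in \<open>simp add: \<Phi>_def modular_group_ring_hom.map_add[OF hom] G.component\<close>)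
  have h_of: "h (completed_group_ring_of ?K G T g) = completed_group_ring_of ?K H T' (s g)"
    if g: "g \<in> carrier G" for g
    unfolding completed_group_ring_of_def h_def
  proof (rule restrict_ext)
    fix V assume V: "V \<in> ?J"
    have "?v V #>\<^bsub>G\<^esub> g \<in> carrier (G Mod ?v V)" using g unfolding carrier_FactGroup by blast
    then show "\<Phi> V ((\<lambda>U\<in>?I. group_ring_of ?K (G Mod U) (U #>\<^bsub>G\<^esub> g)) (?v V)) =
        group_ring_of ?K (H Mod V) (V #>\<^bsub>H\<^esub> s g)"
      using v[OF V] modular_group_ring_hom.map_of[OF hom[OF V]] induced_map_coset[OF G(1) s(1) normal[OF V] g]
      by (simp add: \<Phi>_def)
  qed
  let ?\<Delta> = "completed_augmentation_ideal ?K G T" and ?\<Delta>' = "completed_augmentation_ideal ?K H T'"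
  have h_ideal: "h ` ?\<Delta> \<subseteq> ?\<Delta>'"
  proof (rule image_subsetI)
    fix x assume "x \<in> ?\<Delta>"
    then have x: "x \<in> carrier ?A" "augmentation ?K (G Mod carrier G) (x (carrier G)) = 0"
      by (simp_all add: completed_augmentation_ideal_def completed_augmentation_def)
    have vH: "?v (carrier H) = carrier G" using s_closed by auto
    have "augmentation ?K (H Mod carrier H) (h x (carrier H)) = 0"
      using modular_group_ring_hom.map_augmentation[OF hom[OF H.carrier_open_normal]
          G.component[OF x(1) v[OF H.carrier_open_normal]]] x(2) H.carrier_open_normal vH
      by (simp add: h_def \<Phi>_def)
    then show "h x \<in> ?\<Delta>'"
      using h_closed[OF x(1)] by (simp add: completed_augmentation_ideal_def completed_augmentation_def)
  qed
  have h_power: "h ` ideal_power ?A ?\<Delta> n \<subseteq> ideal_power ?B ?\<Delta>' n"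
  proof (rule image_subsetI)
    fix x assume x: "x \<in> ideal_power ?A ?\<Delta> n"
    show "h x \<in> ideal_power ?B ?\<Delta>' n"
      using ideal_power_image[of ?A ?\<Delta> h ?\<Delta>' ?B x n] x h_ideal h_closed h_mult h_add
        G.completed_mult_closed abelian_groupE(1)[OF G.abelian_group_completed]
      by (auto simp: completed_augmentation_ideal_def)
  qed
  have h_cont: "continuous_map (completed_group_ring_topology ?K G T) (completed_group_ring_topology ?K H T') h"
    unfolding completed_group_ring_topology_def
  proof (rule continuous_map_limit)
    fix V assume "V \<in> ?J"
    then show "\<exists>N\<in>?I. \<forall>x\<in>limit_carrier ?I (\<lambda>U. carrier (group_ring ?K (G Mod U))) (completed_transition ?K G).
        \<forall>y\<in>limit_carrier ?I (\<lambda>U. carrier (group_ring ?K (G Mod U))) (completed_transition ?K G).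
          x N = y N \<longrightarrow> h x V = h y V"
      using v by (intro bexI[of _ "?v V"]) (auto simp: h_def)
  qed (use h_closed in \<open>simp add: G.carrier_completed H.carrier_completed\<close>)
  have f_mem: "f \<in> carrier G" using f by (simp add: pro_p_zassenhaus_def Let_def)
  have "h (completed_group_ring_of ?K G T f \<ominus>\<^bsub>?A\<^esub> \<one>\<^bsub>?A\<^esub>) =
      completed_group_ring_of ?K H T' (s f) \<ominus>\<^bsub>?B\<^esub> \<one>\<^bsub>?B\<^esub>"
    unfolding G.one_eq_of H.one_eq_of
    using additive_map_minus[of ?A ?B h "completed_group_ring_of ?K G T f"
        "completed_group_ring_of ?K G T \<one>\<^bsub>G\<^esub>"] f_mem hom_one[OF s(1) G(1) H(1)]
    by (simp add: G.abelian_group_completed H.abelian_group_completed h_closed h_add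
        G.completed_of_closed h_of)
  moreover have "h (completed_group_ring_of ?K G T f \<ominus>\<^bsub>?A\<^esub> \<one>\<^bsub>?A\<^esub>) \<in>
      completed_group_ring_topology ?K H T' closure_of ideal_power ?B ?\<Delta>' n"
    using f continuous_map_image_closure_subset[OF h_cont, of "ideal_power ?A ?\<Delta> n"]
      closure_of_mono[OF h_power, of "completed_group_ring_topology ?K H T'"]
    unfolding pro_p_zassenhaus_def Let_def by blast
  ultimately show ?thesis
    using s_closed[OF f_mem] by (simp add: pro_p_zassenhaus_def Let_def)
qed

lemma pro_p_zassenhaus_one:
  assumes p: "prime p" and F: "group F" and T: "topspace T = carrier F"
  shows "\<one>\<^bsub>F\<^esub> \<in> pro_p_zassenhaus p F T n"
proof -
  interpret completed_ring F T "int p"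
    using prime_gt_1_nat[OF p] F T by (simp add: completed_ring_def completed_ring_axioms_def)
  interpret A: abelian_group \<A> by (rule abelian_group_completed)
  have zero: "\<zero>\<^bsub>\<A>\<^esub> \<otimes>\<^bsub>\<A>\<^esub> \<zero>\<^bsub>\<A>\<^esub> = \<zero>\<^bsub>\<A>\<^esub>"
    unfolding mult_completed zero_completed
    by (rule restrict_ext) (simp add: modular_group_ring.zero_mult[OF component_ring])
  have "\<zero>\<^bsub>\<A>\<^esub> (carrier F) = \<zero>\<^bsub>AU (carrier F)\<^esub>"
    using carrier_open_normal by (simp add: zero_completed)
  then have "\<zero>\<^bsub>\<A>\<^esub> \<in> completed_augmentation_ideal K F T"
    using modular_group_ring.zero_augmentation[OF component_ring[OF carrier_open_normal]]
    by (simp add: completed_augmentation_ideal_def completed_augmentation_def)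
  then have "\<zero>\<^bsub>\<A>\<^esub> \<in> ideal_power \<A> (completed_augmentation_ideal K F T) n"
    by (intro zero_in_ideal_power) (simp_all add: zero)
  moreover have "\<zero>\<^bsub>\<A>\<^esub> \<in> topspace (completed_group_ring_topology K F T)"
    using A.zero_closed by (simp add: completed_group_ring_topology_def carrier_completed)
  ultimately have "\<zero>\<^bsub>\<A>\<^esub> \<in> completed_group_ring_topology K F T closure_of
      ideal_power \<A> (completed_augmentation_ideal K F T) n"
    by (meson IntI closure_of_subset_Int subsetD)
  moreover have "\<one>\<^bsub>\<A>\<^esub> \<in> carrier \<A>" unfolding one_eq_of by (simp add: completed_of_closed)
  then have "\<one>\<^bsub>\<A>\<^esub> \<ominus>\<^bsub>\<A>\<^esub> \<one>\<^bsub>\<A>\<^esub> = \<zero>\<^bsub>\<A>\<^esub>" by (simp add: a_minus_def A.r_neg)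
  ultimately show ?thesis by (simp add: pro_p_zassenhaus_def Let_def one_eq_of[symmetric])
qed

section \<open>Commutator subgroups of relations and their torsion\<close>

lemma (in group) commutators_in_carrier:
  assumes "H \<subseteq> carrier G" "K \<subseteq> carrier G"
  shows "(\<Union>h\<in>H. \<Union>k\<in>K. {h \<otimes> k \<otimes> inv h \<otimes> inv k}) \<subseteq> carrier G"
  using assms by blast

lemma (in group) commutator_subgroup_normal:
  assumes H: "H \<subseteq> carrier G" "\<And>h g. h \<in> H \<Longrightarrow> g \<in> carrier G \<Longrightarrow> g \<otimes> h \<otimes> inv g \<in> H"
    and K: "K \<subseteq> carrier G" "\<And>k g. k \<in> K \<Longrightarrow> g \<in> carrier G \<Longrightarrow> g \<otimes> k \<otimes> inv g \<in> K"
  shows "commutator_subgroup G H K \<lhd> G"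
  unfolding commutator_subgroup_def
proof (rule normal_generateI[OF commutators_in_carrier[OF H(1) K(1)]])
  fix c g assume "c \<in> (\<Union>h\<in>H. \<Union>k\<in>K. {h \<otimes> k \<otimes> inv h \<otimes> inv k})" and g: "g \<in> carrier G"
  then obtain h k where hk: "h \<in> H" "k \<in> K" and c: "c = h \<otimes> k \<otimes> inv h \<otimes> inv k" by blast
  have hkG: "h \<in> carrier G" "k \<in> carrier G" using hk H K by auto
  let ?h = "g \<otimes> h \<otimes> inv g" and ?k = "g \<otimes> k \<otimes> inv g"
  have cancel: "inv g \<otimes> (g \<otimes> x) = x" if "x \<in> carrier G" for x
    using g that by (simp flip: m_assoc)
  have "g \<otimes> c \<otimes> inv g = ?h \<otimes> ?k \<otimes> inv ?h \<otimes> inv ?k"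
    using g hkG by (simp add: c m_assoc inv_mult_group cancel)
  then show "g \<otimes> c \<otimes> inv g \<in> (\<Union>h\<in>H. \<Union>k\<in>K. {h \<otimes> k \<otimes> inv h \<otimes> inv k})"
    using H(2)[OF hk(1) g] K(2)[OF hk(2) g] by blast
qed

lemma (in group_hom) commutator_subgroup_image:
  assumes S: "S \<subseteq> carrier G" "h ` S \<subseteq> S'" and K: "K \<subseteq> carrier G" "h ` K \<subseteq> K'"
  shows "h ` commutator_subgroup G S K \<subseteq> commutator_subgroup H S' K'"
proof -
  let ?c = "\<Union>s\<in>S. \<Union>k\<in>K. {s \<otimes>\<^bsub>G\<^esub> k \<otimes>\<^bsub>G\<^esub> inv\<^bsub>G\<^esub> s \<otimes>\<^bsub>G\<^esub> inv\<^bsub>G\<^esub> k}"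
  have "h ` ?c \<subseteq> (\<Union>s\<in>S'. \<Union>k\<in>K'. {s \<otimes>\<^bsub>H\<^esub> k \<otimes>\<^bsub>H\<^esub> inv\<^bsub>H\<^esub> s \<otimes>\<^bsub>H\<^esub> inv\<^bsub>H\<^esub> k})"
  proof (rule image_subsetI)
    fix c assume "c \<in> ?c"
    then obtain s k where sk: "s \<in> S" "k \<in> K" "c = s \<otimes>\<^bsub>G\<^esub> k \<otimes>\<^bsub>G\<^esub> inv\<^bsub>G\<^esub> s \<otimes>\<^bsub>G\<^esub> inv\<^bsub>G\<^esub> k" by blast
    have "s \<in> carrier G" "k \<in> carrier G" using sk S K by auto
    then have "h c = h s \<otimes>\<^bsub>H\<^esub> h k \<otimes>\<^bsub>H\<^esub> inv\<^bsub>H\<^esub> h s \<otimes>\<^bsub>H\<^esub> inv\<^bsub>H\<^esub> h k" using sk by simp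
    then show "h c \<in> (\<Union>s\<in>S'. \<Union>k\<in>K'. {s \<otimes>\<^bsub>H\<^esub> k \<otimes>\<^bsub>H\<^esub> inv\<^bsub>H\<^esub> s \<otimes>\<^bsub>H\<^esub> inv\<^bsub>H\<^esub> k})"
      using sk S(2) K(2) by blast
  qed
  from H.mono_generate[OF this] show ?thesis
    unfolding commutator_subgroup_def using generate_img[OF G.commutators_in_carrier[OF S(1) K(1)]] by simp
qed

lemma (in group) commutator_subgroup_subset:
  assumes "subgroup N G" "\<And>h k. h \<in> H \<Longrightarrow> k \<in> K \<Longrightarrow> h \<otimes> k \<otimes> inv h \<otimes> inv k \<in> N"
  shows "commutator_subgroup G H K \<subseteq> N"
  unfolding commutator_subgroup_def by (rule generate_subgroup_incl[OF _ assms(1)]) (use assms(2) in blast)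

lemma commutator_subgroup_incl:
  assumes "h \<in> S" "k \<in> K"
  shows "h \<otimes>\<^bsub>G\<^esub> k \<otimes>\<^bsub>G\<^esub> inv\<^bsub>G\<^esub> h \<otimes>\<^bsub>G\<^esub> inv\<^bsub>G\<^esub> k \<in> commutator_subgroup G S K"
  unfolding commutator_subgroup_def using assms by (intro generate.incl) blast

lemma (in normal) commutator_mem:
  assumes "h \<in> H" "k \<in> carrier G"
  shows "h \<otimes> k \<otimes> inv h \<otimes> inv k \<in> H"
proof -
  have "k \<otimes> inv h \<otimes> inv k \<in> H" using assms inv_op_closed2 by simp
  then have "h \<otimes> (k \<otimes> inv h \<otimes> inv k) \<in> H" using assms by simp
  then show ?thesis using assms mem_carrier by (simp add: m_assoc)
qed

lemma (in normal) set_mult_conj: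
  assumes M: "M \<subseteq> carrier G" "\<And>f g. f \<in> M \<Longrightarrow> g \<in> carrier G \<Longrightarrow> g \<otimes> f \<otimes> inv g \<in> M"
    and x: "x \<in> H <#> M" and g: "g \<in> carrier G"
  shows "g \<otimes> x \<otimes> inv g \<in> H <#> M"
proof -
  obtain h f where hf: "h \<in> H" "f \<in> M" "x = h \<otimes> f" using x by (auto simp: set_mult_def)
  have f: "f \<in> carrier G" using M hf by auto
  have cancel: "inv g \<otimes> (g \<otimes> y) = y" if "y \<in> carrier G" for y
    using g that by (simp flip: m_assoc)
  have "g \<otimes> x \<otimes> inv g = (g \<otimes> h \<otimes> inv g) \<otimes> (g \<otimes> f \<otimes> inv g)"
    using hf f g mem_carrier[OF hf(1)] by (simp add: m_assoc cancel)
  then show ?thesis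
    using inv_op_closed2[OF g hf(1)] M(2)[OF hf(2) g] by (auto simp: set_mult_def)
qed

lemma (in normal) relation_commutator:
  assumes M: "M \<subseteq> carrier G" "\<And>f g. f \<in> M \<Longrightarrow> g \<in> carrier G \<Longrightarrow> g \<otimes> f \<otimes> inv g \<in> M"
  shows "commutator_subgroup G H (H <#> M) \<lhd> G" "commutator_subgroup G H (H <#> M) \<subseteq> H"
proof -
  have HM: "H <#> M \<subseteq> carrier G" by (rule setmult_subset_G[OF subset M(1)])
  show "commutator_subgroup G H (H <#> M) \<lhd> G"
    by (rule commutator_subgroup_normal[OF subset _ HM])
      (simp_all add: inv_op_closed2 set_mult_conj[OF M])
  show "commutator_subgroup G H (H <#> M) \<subseteq> H"
    by (rule commutator_subgroup_subset[OF subgroup_axioms]) (use commutator_mem HM in blast)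
qed

text \<open>Reduces the torsion of the quotient to powers of elements of \<open>R\<close>, which homomorphisms respect.\<close>

lemma p_torsion_trivial_iff:
  assumes F: "group F" and R: "subgroup R F" and C: "C \<lhd> F" "C \<subseteq> R"
  shows "p_torsion p (F\<lparr>carrier := R\<rparr> Mod C) = {\<one>\<^bsub>F\<lparr>carrier := R\<rparr> Mod C\<^esub>} \<longleftrightarrow>
    (\<forall>r\<in>R. \<forall>k::nat. r [^]\<^bsub>F\<^esub> (p ^ k) \<in> C \<longrightarrow> r \<in> C)"
proof -
  let ?R = "F\<lparr>carrier := R\<rparr>"
  interpret F: group F by (rule F)
  interpret C: normal C ?R by (rule F.normal_restrict_supergroup[OF R C])
  have pow: "(C #>\<^bsub>?R\<^esub> r) [^]\<^bsub>?R Mod C\<^esub> (p ^ k) = \<one>\<^bsub>?R Mod C\<^esub> \<longleftrightarrow> r [^]\<^bsub>F\<^esub> (p ^ k) \<in> C"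
    if "r \<in> R" for r and k :: nat
    using C.FactGroup_pow_eq_one[of r "p ^ k"] that F.nat_pow_consistent[of r "p ^ k" R] by simp
  have one: "C #>\<^bsub>?R\<^esub> r = C \<longleftrightarrow> r \<in> C" if "r \<in> R" for r
    using C.coset_eq_self_iff[of r] that by simp
  have carr: "carrier (?R Mod C) = (\<lambda>r. C #>\<^bsub>?R\<^esub> r) ` R"
    by (simp add: carrier_FactGroup)
  have "C \<in> p_torsion p (?R Mod C)"
  proof -
    have R1: "\<one>\<^bsub>F\<^esub> \<in> R" and C1: "\<one>\<^bsub>F\<^esub> \<in> C"
      using subgroup.one_closed[OF R] subgroup.one_closed[OF normal_imp_subgroup[OF C(1)]] by auto
    have eq: "C #>\<^bsub>?R\<^esub> \<one>\<^bsub>F\<^esub> = C" using one[OF R1] C1 by simp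
    have "C [^]\<^bsub>?R Mod C\<^esub> (p ^ 0) = \<one>\<^bsub>?R Mod C\<^esub>"
      using pow[OF R1, of 0] C1 unfolding eq by simp
    moreover have "C \<in> carrier (?R Mod C)"
      unfolding carr using imageI[OF R1, of "\<lambda>r. C #>\<^bsub>?R\<^esub> r"] eq by simp
    ultimately show ?thesis unfolding p_torsion_def by blast
  qed
  then have "p_torsion p (?R Mod C) = {C} \<longleftrightarrow> (\<forall>x\<in>p_torsion p (?R Mod C). x = C)" by blast
  also have "\<dots> \<longleftrightarrow> (\<forall>r\<in>R. \<forall>k::nat. (C #>\<^bsub>?R\<^esub> r) [^]\<^bsub>?R Mod C\<^esub> (p ^ k) = \<one>\<^bsub>?R Mod C\<^esub> \<longrightarrow>
      C #>\<^bsub>?R\<^esub> r = C)"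
    unfolding p_torsion_def carr by blast
  also have "\<dots> \<longleftrightarrow> (\<forall>r\<in>R. \<forall>k::nat. r [^]\<^bsub>F\<^esub> (p ^ k) \<in> C \<longrightarrow> r \<in> C)"
    by (rule ball_cong[OF refl]) (simp only: pow one)
  finally show ?thesis by simp
qed

section \<open>Free pro-\<open>p\<close>-groups\<close>

locale free_pro_p_group =
  fixes p :: nat and X :: "'x set"
  assumes p: "prime p"
begin

abbreviation (input) "F \<equiv> free_group X"
abbreviation (input) "\<I> \<equiv> p_power_normal p F"
abbreviation (input) "P \<equiv> free_pro_p p X"
abbreviation (input) "T \<equiv> free_pro_p_topology p X"

lemma carrier_P: "carrier P = limit_carrier \<I> (\<lambda>N. carrier (F Mod N)) (quotient_map_of F)"
  and mult_P: "x \<otimes>\<^bsub>P\<^esub> y = (\<lambda>N\<in>\<I>. x N \<otimes>\<^bsub>F Mod N\<^esub> y N)"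
  and one_P: "\<one>\<^bsub>P\<^esub> = (\<lambda>N\<in>\<I>. \<one>\<^bsub>F Mod N\<^esub>)"
  by (simp_all add: free_pro_p_def Let_def)

lemma topspace_T: "topspace T = carrier P"
  by (simp add: free_pro_p_topology_def Let_def carrier_P)

lemma normal: "N \<in> \<I> \<Longrightarrow> N \<lhd> F"
  by (simp add: p_power_normal_def)

lemma group_quotient: "N \<in> \<I> \<Longrightarrow> group (F Mod N)"
  using normal normal.factorgroup_is_group by blast

lemma P_component: "x \<in> carrier P \<Longrightarrow> N \<in> \<I> \<Longrightarrow> x N \<in> carrier (F Mod N)"
  unfolding carrier_P by (rule limit_carrierD(1))

lemma P_transition:
  "x \<in> carrier P \<Longrightarrow> N \<in> \<I> \<Longrightarrow> M \<in> \<I> \<Longrightarrow> N \<subseteq> M \<Longrightarrow> quotient_map_of F N M (x N) = x M"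
  unfolding carrier_P by (rule limit_carrierD(3))

lemma P_ext: "x \<in> carrier P \<Longrightarrow> y \<in> carrier P \<Longrightarrow> (\<And>N. N \<in> \<I> \<Longrightarrow> x N = y N) \<Longrightarrow> x = y"
  unfolding carrier_P by (rule limit_ext)

lemma P_coset:
  assumes "x \<in> carrier P" "N \<in> \<I>"
  obtains w where "w \<in> carrier F" "x N = N #>\<^bsub>F\<^esub> w"
  using P_component[OF assms] unfolding carrier_FactGroup by blast

lemma P_coset_mono:
  assumes "x \<in> carrier P" "N \<in> \<I>" "M \<in> \<I>" "N \<subseteq> M" "w \<in> carrier F" "x N = N #>\<^bsub>F\<^esub> w"
  shows "x M = M #>\<^bsub>F\<^esub> w"
  using P_transition[OF assms(1-4)] quotient_map_of_coset[OF normal[OF assms(2)] normal[OF assms(3)] assms(4,5)] assms(6)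
  by simp

lemma group_P: "group P"
proof (rule groupI)
  have hom: "quotient_map_of F N M \<in> hom (F Mod N) (F Mod M)" if "N \<in> \<I>" "M \<in> \<I>" "N \<subseteq> M" for N M
    using quotient_map_of_hom normal that by blast
  fix x y z assume x: "x \<in> carrier P" and y: "y \<in> carrier P"
  show "x \<otimes>\<^bsub>P\<^esub> y \<in> carrier P"
    unfolding mult_P carrier_P
  proof (rule limit_carrierI)
    fix N assume N: "N \<in> \<I>"
    show "x N \<otimes>\<^bsub>F Mod N\<^esub> y N \<in> carrier (F Mod N)"
      by (rule monoid.m_closed[OF group.is_monoid[OF group_quotient[OF N]] P_component[OF x N] P_component[OF y N]])
    fix M assume M: "M \<in> \<I>" "N \<subseteq> M"
    show "quotient_map_of F N M (x N \<otimes>\<^bsub>F Mod N\<^esub> y N) = x M \<otimes>\<^bsub>F Mod M\<^esub> y M"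
      unfolding hom_mult[OF hom[OF N M] P_component[OF x N] P_component[OF y N]]
        P_transition[OF x N M] P_transition[OF y N M] ..
  qed
  assume z: "z \<in> carrier P"
  show "x \<otimes>\<^bsub>P\<^esub> y \<otimes>\<^bsub>P\<^esub> z = x \<otimes>\<^bsub>P\<^esub> (y \<otimes>\<^bsub>P\<^esub> z)"
    unfolding mult_P
  proof (rule restrict_ext)
    fix N assume N: "N \<in> \<I>"
    show "(\<lambda>N\<in>\<I>. x N \<otimes>\<^bsub>F Mod N\<^esub> y N) N \<otimes>\<^bsub>F Mod N\<^esub> z N =
        x N \<otimes>\<^bsub>F Mod N\<^esub> (\<lambda>N\<in>\<I>. y N \<otimes>\<^bsub>F Mod N\<^esub> z N) N"
      using monoid.m_assoc[OF group.is_monoid[OF group_quotient[OF N]] P_component[OF x N] P_component[OF y N] P_component[OF z N]]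
        N by simp
  qed
next
  have hom: "quotient_map_of F N M \<in> hom (F Mod N) (F Mod M)" if "N \<in> \<I>" "M \<in> \<I>" "N \<subseteq> M" for N M
    using quotient_map_of_hom normal that by blast
  show "\<one>\<^bsub>P\<^esub> \<in> carrier P"
    unfolding one_P carrier_P
  proof (rule limit_carrierI)
    fix N assume N: "N \<in> \<I>"
    show "\<one>\<^bsub>F Mod N\<^esub> \<in> carrier (F Mod N)"
      by (rule monoid.one_closed[OF group.is_monoid[OF group_quotient[OF N]]])
    fix M assume M: "M \<in> \<I>" "N \<subseteq> M"
    show "quotient_map_of F N M \<one>\<^bsub>F Mod N\<^esub> = \<one>\<^bsub>F Mod M\<^esub>"
      by (rule hom_one[OF hom[OF N M] group_quotient[OF N] group_quotient[OF M(1)]])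
  qed
  fix x assume x: "x \<in> carrier P"
  have "\<one>\<^bsub>P\<^esub> \<otimes>\<^bsub>P\<^esub> x = (\<lambda>N\<in>\<I>. x N)"
    unfolding mult_P one_P
  proof (rule restrict_ext)
    fix N assume N: "N \<in> \<I>"
    show "(\<lambda>N\<in>\<I>. \<one>\<^bsub>F Mod N\<^esub>) N \<otimes>\<^bsub>F Mod N\<^esub> x N = x N"
      using monoid.l_one[OF group.is_monoid[OF group_quotient[OF N]] P_component[OF x N]] N by simp
  qed
  also have "\<dots> = x"
    using limit_carrierD(2)[OF x[unfolded carrier_P]] by (auto simp: restrict_def fun_eq_iff)
  finally show "\<one>\<^bsub>P\<^esub> \<otimes>\<^bsub>P\<^esub> x = x" .
  let ?y = "\<lambda>N\<in>\<I>. inv\<^bsub>F Mod N\<^esub> x N"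
  have "?y \<in> carrier P"
    unfolding carrier_P
  proof (rule limit_carrierI)
    fix N assume N: "N \<in> \<I>"
    show "inv\<^bsub>F Mod N\<^esub> x N \<in> carrier (F Mod N)"
      by (rule group.inv_closed[OF group_quotient[OF N] P_component[OF x N]])
    fix M assume M: "M \<in> \<I>" "N \<subseteq> M"
    interpret h: group_hom "F Mod N" "F Mod M" "quotient_map_of F N M"
      using group_quotient N M hom by (simp add: group_hom_def group_hom_axioms_def)
    show "quotient_map_of F N M (inv\<^bsub>F Mod N\<^esub> x N) = inv\<^bsub>F Mod M\<^esub> x M"
      unfolding h.hom_inv[OF P_component[OF x N]] P_transition[OF x N M] ..
  qed
  moreover have "?y \<otimes>\<^bsub>P\<^esub> x = \<one>\<^bsub>P\<^esub>"
    unfolding mult_P one_P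
  proof (rule restrict_ext)
    fix N assume N: "N \<in> \<I>"
    show "?y N \<otimes>\<^bsub>F Mod N\<^esub> x N = \<one>\<^bsub>F Mod N\<^esub>"
      using group.l_inv[OF group_quotient[OF N] P_component[OF x N]] N by simp
  qed
  ultimately show "\<exists>y\<in>carrier P. y \<otimes>\<^bsub>P\<^esub> x = \<one>\<^bsub>P\<^esub>" by blast
qed

text \<open>A name for the application of \<open>x\<close> to \<open>N\<close>, so that the homomorphism to \<open>F/N\<close> can be written as a
  constant.\<close>

definition proj :: "('x \<times> bool) list set \<Rightarrow> 'x pro_word \<Rightarrow> ('x \<times> bool) list set" where
  "proj N x = x N"

lemma proj_hom: "N \<in> \<I> \<Longrightarrow> proj N \<in> hom P (F Mod N)"
  by (rule homI) (simp_all add: proj_def P_component mult_P)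

lemma group_hom_proj: "N \<in> \<I> \<Longrightarrow> group_hom P (F Mod N) (proj N)"
  using group_P group_quotient proj_hom by (simp add: group_hom_def group_hom_axioms_def)

definition emb :: "('x \<times> bool) list \<Rightarrow> 'x pro_word" where
  "emb w = (\<lambda>N\<in>\<I>. N #>\<^bsub>F\<^esub> w)"

lemma emb_closed: "w \<in> carrier F \<Longrightarrow> emb w \<in> carrier P"
  unfolding emb_def carrier_P
  by (rule limit_carrierI) (auto simp: carrier_FactGroup quotient_map_of_coset normal)

lemma emb_hom: "emb \<in> hom F P"
proof (rule homI)
  fix v w assume v: "v \<in> carrier F" and w: "w \<in> carrier F"
  show "emb (v \<otimes>\<^bsub>F\<^esub> w) = emb v \<otimes>\<^bsub>P\<^esub> emb w"
    unfolding emb_def mult_P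
    by (rule restrict_ext) (use v w in \<open>simp add: normal.rcos_sum[OF normal]\<close>)
qed (rule emb_closed)

lemma proj_emb: "N \<in> \<I> \<Longrightarrow> proj N (emb w) = N #>\<^bsub>F\<^esub> w"
  by (simp add: proj_def emb_def)

lemma proj_surj:
  assumes N: "N \<in> \<I>"
  shows "proj N ` carrier P = carrier (F Mod N)"
proof (intro equalityI subsetI)
  fix C assume "C \<in> carrier (F Mod N)"
  then obtain w where w: "w \<in> carrier F" "C = N #>\<^bsub>F\<^esub> w" unfolding carrier_FactGroup by blast
  then have "C = proj N (emb w)" using proj_emb[OF N] by simp
  then show "C \<in> proj N ` carrier P" using emb_closed[OF w(1)] by blast
qed (use P_component N in \<open>auto simp: proj_def\<close>)

lemma carrier_mem_I: "carrier F \<in> \<I>"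
  unfolding p_power_normal_iff[OF p]
proof (intro conjI ballI)
  show "carrier F \<lhd> F" by (rule free.normal_self)
  show "finite (rcosets\<^bsub>F\<^esub> carrier F)"
    by (rule free.finite_rcosetsI[OF free.subgroup_self, of "\<lambda>_. ()"]) auto
  fix g assume "g \<in> carrier F"
  then show "\<exists>b::nat. g [^]\<^bsub>F\<^esub> (p ^ b) \<in> carrier F" by simp
qed

lemma closure_T:
  assumes "S \<subseteq> carrier P"
  shows "T closure_of S = {x \<in> carrier P. \<forall>N\<in>\<I>. \<exists>c\<in>S. c N = x N}"
proof -
  have T: "T = limit_topology \<I> (\<lambda>N. carrier (F Mod N)) (quotient_map_of F)"
    by (simp add: free_pro_p_topology_def Let_def)
  show ?thesis
    unfolding T carrier_P
  proof (rule closure_of_limit)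
    show "\<I> \<noteq> {}" using carrier_mem_I by blast
    show "\<exists>L\<in>\<I>. L \<subseteq> N \<and> L \<subseteq> M" if "N \<in> \<I>" "M \<in> \<I>" for N M
      using p_power_normal_Int[OF p that] by blast
  qed (use assms in \<open>simp only: carrier_P\<close>)
qed

lemma closure_normal:
  assumes S: "S \<lhd> P"
  shows "T closure_of S \<lhd> P"
proof -
  interpret S: normal S P by (rule S)
  note cl = closure_T[OF S.subset]
  have comp: "(x \<otimes>\<^bsub>P\<^esub> y) N = x N \<otimes>\<^bsub>F Mod N\<^esub> y N" if "N \<in> \<I>" for x y N
    using that by (simp add: mult_P)
  have inv: "(inv\<^bsub>P\<^esub> x) N = inv\<^bsub>F Mod N\<^esub> x N" if "N \<in> \<I>" "x \<in> carrier P" for x N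
    using group_hom.hom_inv[OF group_hom_proj[OF that(1)] that(2)] by (simp add: proj_def)
  show ?thesis
  proof (rule S.normal_invI)
    show "subgroup (T closure_of S) P"
    proof (rule S.subgroupI)
      show "T closure_of S \<subseteq> carrier P" unfolding cl by blast
      show "T closure_of S \<noteq> {}"
        using closure_of_subset[of S T] topspace_T S.subset subgroup.one_closed[OF S.subgroup_axioms] by blast
      fix x assume x: "x \<in> T closure_of S"
      then have xP: "x \<in> carrier P" unfolding cl by blast
      have "\<exists>c\<in>S. c N = (inv\<^bsub>P\<^esub> x) N" if N: "N \<in> \<I>" for N
      proof -
        obtain c where c: "c \<in> S" "c N = x N" using x N unfolding cl by blast
        have "(inv\<^bsub>P\<^esub> c) N = (inv\<^bsub>P\<^esub> x) N" unfolding inv[OF N xP] inv[OF N S.mem_carrier[OF c(1)]] c(2) ..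
        then show ?thesis using S.m_inv_closed[OF c(1)] by blast
      qed
      then show "inv\<^bsub>P\<^esub> x \<in> T closure_of S" unfolding cl using xP by simp
      fix y assume y: "y \<in> T closure_of S"
      then have yP: "y \<in> carrier P" unfolding cl by blast
      have "\<exists>c\<in>S. c N = (x \<otimes>\<^bsub>P\<^esub> y) N" if N: "N \<in> \<I>" for N
      proof -
        obtain c d where c: "c \<in> S" "c N = x N" "d \<in> S" "d N = y N" using x y N unfolding cl by blast
        have "(c \<otimes>\<^bsub>P\<^esub> d) N = (x \<otimes>\<^bsub>P\<^esub> y) N" unfolding comp[OF N] c(2,4) ..
        then show ?thesis using subgroup.m_closed[OF S.subgroup_axioms c(1,3)] by blast
      qed
      then show "x \<otimes>\<^bsub>P\<^esub> y \<in> T closure_of S" unfolding cl using xP yP by simp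
    qed
    fix g x assume g: "g \<in> carrier P" and x: "x \<in> T closure_of S"
    then have xP: "x \<in> carrier P" unfolding cl by blast
    have "\<exists>c\<in>S. c N = (g \<otimes>\<^bsub>P\<^esub> x \<otimes>\<^bsub>P\<^esub> inv\<^bsub>P\<^esub> g) N" if N: "N \<in> \<I>" for N
    proof -
      obtain c where c: "c \<in> S" "c N = x N" using x N unfolding cl by blast
      have "(g \<otimes>\<^bsub>P\<^esub> c \<otimes>\<^bsub>P\<^esub> inv\<^bsub>P\<^esub> g) N = (g \<otimes>\<^bsub>P\<^esub> x \<otimes>\<^bsub>P\<^esub> inv\<^bsub>P\<^esub> g) N" unfolding comp[OF N] c(2) ..
      then show ?thesis using S.inv_op_closed2[OF g c(1)] by blast
    qed
    then show "g \<otimes>\<^bsub>P\<^esub> x \<otimes>\<^bsub>P\<^esub> inv\<^bsub>P\<^esub> g \<in> T closure_of S" unfolding cl using xP g by simp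
  qed
qed

text \<open>Uniform continuity with respect to the bases of open normal subgroups
  \<open>{x. x N = 1}\<close>.\<close>

definition coordinatewise :: "('x pro_word \<Rightarrow> 'y pro_word) \<Rightarrow> 'y set \<Rightarrow> bool" where
  "coordinatewise s Y \<longleftrightarrow> (\<forall>M\<in>p_power_normal p (free_group Y). \<exists>N\<in>\<I>.
     \<forall>x\<in>carrier P. \<forall>y\<in>carrier P. x N = y N \<longrightarrow> s x M = s y M)"

end

lemma coordinatewise_continuous:
  assumes p: "prime p" and s: "s \<in> hom (free_pro_p p X) (free_pro_p p Y)" "free_pro_p_group.coordinatewise p X s Y"
  shows "continuous_map (free_pro_p_topology p X) (free_pro_p_topology p Y) s"
proof -
  interpret X: free_pro_p_group p X using p by unfold_locales
  interpret Y: free_pro_p_group p Y using p by unfold_locales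
  show ?thesis
    unfolding free_pro_p_topology_def Let_def
  proof (rule continuous_map_limit)
    show "s x \<in> limit_carrier Y.\<I> (\<lambda>N. carrier (Y.F Mod N)) (quotient_map_of Y.F)"
      if "x \<in> limit_carrier X.\<I> (\<lambda>N. carrier (X.F Mod N)) (quotient_map_of X.F)" for x
      using s(1) that unfolding X.carrier_P[symmetric] Y.carrier_P[symmetric] by (rule hom_in_carrier)
    show "\<exists>N\<in>X.\<I>. \<forall>x\<in>limit_carrier X.\<I> (\<lambda>N. carrier (X.F Mod N)) (quotient_map_of X.F).
        \<forall>y\<in>limit_carrier X.\<I> (\<lambda>N. carrier (X.F Mod N)) (quotient_map_of X.F). x N = y N \<longrightarrow> s x M = s y M"
      if "M \<in> Y.\<I>" for M
      using s(2) that unfolding X.coordinatewise_def X.carrier_P by blast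
  qed
qed

context free_pro_p_group
begin

lemma zassenhaus_subset: "pro_p_zassenhaus p P T n \<subseteq> carrier P"
  by (auto simp: pro_p_zassenhaus_def Let_def)

lemma zassenhaus_conj:
  assumes f: "f \<in> pro_p_zassenhaus p P T n" and g: "g \<in> carrier P"
  shows "g \<otimes>\<^bsub>P\<^esub> f \<otimes>\<^bsub>P\<^esub> inv\<^bsub>P\<^esub> g \<in> pro_p_zassenhaus p P T n"
proof -
  have hom: "(\<lambda>x. g \<otimes>\<^bsub>P\<^esub> x \<otimes>\<^bsub>P\<^esub> inv\<^bsub>P\<^esub> g) \<in> hom P P"
    by (rule group.conjugation_hom[OF group_P g])
  have "coordinatewise (\<lambda>x. g \<otimes>\<^bsub>P\<^esub> x \<otimes>\<^bsub>P\<^esub> inv\<^bsub>P\<^esub> g) X"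
    unfolding coordinatewise_def by (intro ballI bexI) (auto simp: mult_P)
  from pro_p_zassenhaus_hom[OF p group_P topspace_T group_P topspace_T hom coordinatewise_continuous[OF p hom this] f]
  show ?thesis .
qed

text \<open>Here is where torsion is used in the pro-\<open>p\<close> case. Let \<open>N'\<close> be the preimage in the discrete free
  group of the image of \<open>C\<close> in \<open>F/N\<close>; modulo \<open>N'\<close>, the image \<open>A\<close> of \<open>R\<close> is abelian, of
  exponent \<open>p\<^sup>j\<close> say. With \<open>D\<close> the centralizer of \<open>A\<close>, the flow kernel modulo \<open>p\<^sup>k p\<^sup>j\<close> defines an
  open subgroup of the free pro-\<open>p\<close>-group that contains \<open>C\<close>. So if a word \<open>w\<close> is close to \<open>r\<close>, then
  the flow of its \<open>p\<^sup>k\<close>-th power is divisible by \<open>p\<^sup>k p\<^sup>j\<close>, its own flow by \<open>p\<^sup>j\<close>, and \<open>e\<close> fixes \<open>w\<close>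
  modulo \<open>N'\<close>.\<close>

lemma endomorphism_fixes_torsion_modulo:
  assumes X: "finite X" and R: "R \<lhd> P" and M: "M \<subseteq> carrier P" "\<one>\<^bsub>P\<^esub> \<in> M"
    and B: "B = commutator_subgroup P R (R <#>\<^bsub>P\<^esub> M)" and C: "C = T closure_of B" "C \<lhd> P"
    and e: "e \<in> hom P P" and eR: "\<And>x. x \<in> carrier P \<Longrightarrow> inv\<^bsub>P\<^esub> x \<otimes>\<^bsub>P\<^esub> e x \<in> R"
    and coord: "coordinatewise e X"
    and r: "r \<in> R" and rk: "r [^]\<^bsub>P\<^esub> (p ^ k :: nat) \<in> C" and N: "N \<in> \<I>"
  shows "\<exists>c\<in>C. c N = (inv\<^bsub>P\<^esub> r \<otimes>\<^bsub>P\<^esub> e r) N"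
proof -
  interpret P: group P by (rule group_P)
  interpret R: normal R P by (rule R)
  interpret C: normal C P by (rule C(2))
  interpret N: normal N F by (rule normal[OF N])
  have rP: "r \<in> carrier P" using R.mem_carrier[OF r] .
  have CN: "proj N ` C \<lhd> F Mod N"
    by (rule C.surj_hom_normal_subgroup[OF group_hom_proj[OF N] proj_surj[OF N]])
  define N' where "N' = vimage_in F (\<lambda>w. N #>\<^bsub>F\<^esub> w) (proj N ` C)"
  have N'_normal: "N' \<lhd> F"
    unfolding N'_def by (rule vimage_in_normal[OF group_free_group N.r_coset_hom_Mod CN])
  interpret N': normal N' F by (rule N'_normal)
  have "N \<in> proj N ` C" using subgroup.one_closed[OF normal_imp_subgroup[OF CN]] by simp
  moreover have "N #>\<^bsub>F\<^esub> w = N" if "w \<in> N" for w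
    using N.coset_eq_self_iff[OF N.mem_carrier[OF that]] that by blast
  ultimately have NN': "N \<subseteq> N'"
    unfolding N'_def by (intro subsetI CollectI conjI) (simp_all only: N.mem_carrier)
  have N': "N' \<in> \<I>" by (rule p_power_normal_superset[OF p N NN' N'_normal])
  interpret pr: group_hom P "F Mod N'" "proj N'" by (rule group_hom_proj[OF N'])
  have proj_N': "proj N' x = \<one>\<^bsub>F Mod N'\<^esub> \<longleftrightarrow> proj N x \<in> proj N ` C" if x: "x \<in> carrier P" for x
  proof -
    obtain w where w: "w \<in> carrier F" "x N = N #>\<^bsub>F\<^esub> w" using P_coset[OF x N] by blast
    have "proj N' x = N' #>\<^bsub>F\<^esub> w" using P_coset_mono[OF x N N' NN' w] by (simp add: proj_def)
    then have "proj N' x = \<one>\<^bsub>F Mod N'\<^esub> \<longleftrightarrow> w \<in> N'" using N'.coset_eq_self_iff[OF w(1)] by simp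
    also have "\<dots> \<longleftrightarrow> proj N x \<in> proj N ` C" unfolding N'_def using w by (simp add: proj_def)
    finally show ?thesis .
  qed
  have RM: "R <#>\<^bsub>P\<^esub> M \<subseteq> carrier P" by (rule P.setmult_subset_G[OF R.subset M(1)])
  have R_RM: "x \<in> R <#>\<^bsub>P\<^esub> M" if "x \<in> R" for x
    using that M(2) R.mem_carrier[OF that] unfolding set_mult_def by force
  have B_sub: "B \<subseteq> carrier P"
    unfolding B by (rule P.commutator_subgroup_subset[OF P.subgroup_self]) (use R.mem_carrier RM in auto)
  have "B \<subseteq> C" unfolding C(1) by (rule closure_of_subset) (use B_sub topspace_T in simp)
  then have comm: "\<forall>x\<in>R. \<forall>b\<in>R <#>\<^bsub>P\<^esub> M.
      proj N' (x \<otimes>\<^bsub>P\<^esub> b \<otimes>\<^bsub>P\<^esub> inv\<^bsub>P\<^esub> x \<otimes>\<^bsub>P\<^esub> inv\<^bsub>P\<^esub> b) = \<one>\<^bsub>F Mod N'\<^esub>"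
    using proj_N' C.mem_carrier commutator_subgroup_incl[of _ R _ "R <#>\<^bsub>P\<^esub> M" P] unfolding B by blast
  define D where "D = {w \<in> carrier F. \<forall>a\<in>proj N' ` R.
      proj N' (emb w) \<otimes>\<^bsub>F Mod N'\<^esub> a = a \<otimes>\<^bsub>F Mod N'\<^esub> proj N' (emb w)}"
  note core = endomorphism_eq_on_flow_kernel[OF group_P group_quotient[OF N'] proj_hom[OF N'] proj_surj[OF N']
      emb_hom R M comm D_def]
  interpret flow: schreier_flow X D unfolding schreier_flow_def by (rule core(1))
  have D_mem: "w \<in> D" if "b \<in> R <#>\<^bsub>P\<^esub> M" "w \<in> carrier F" "b N' = N' #>\<^bsub>F\<^esub> w" for b w
    by (rule core(2)[OF that(2,1)]) (use that(3) proj_emb[OF N'] in \<open>simp add: proj_def\<close>)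
  have "N' \<subseteq> D"
  proof
    fix w assume w: "w \<in> N'"
    have "N' #>\<^bsub>F\<^esub> w = \<one>\<^bsub>P\<^esub> N'"
      using N'.coset_eq_self_iff[OF N'.mem_carrier[OF w]] w N' by (simp add: one_P)
    then show "w \<in> D" using D_mem[OF R_RM[OF R.one_closed] N'.mem_carrier[OF w]] by simp
  qed
  then have D: "D \<in> \<I>" by (rule p_power_normal_superset[OF p N' _ core(1)])
  obtain j :: nat where j: "card (rcosets\<^bsub>F\<^esub> N') = p ^ j"
    using N' by (auto simp: p_power_normal_def p_power_index_def)
  have exp: "proj N' x [^]\<^bsub>F Mod N'\<^esub> (p ^ j) = \<one>\<^bsub>F Mod N'\<^esub>" if "x \<in> R" for x
    using pr.H.pow_order_eq_1[OF pr.hom_closed[OF R.mem_carrier[OF that]]] j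
    by (simp add: Coset.order_def FactGroup_def)
  define K where "K = flow_kernel X D (p ^ k * p ^ j)"
  have K: "K \<in> \<I>"
    unfolding K_def power_add[symmetric] by (rule p_power_normal_flow_kernel[OF p X D])
  interpret K: normal K F by (rule normal[OF K])
  interpret prK: group_hom P "F Mod K" "proj K" by (rule group_hom_proj[OF K])
  interpret embK: group_hom F "F Mod K" "\<lambda>w. K #>\<^bsub>F\<^esub> w"
    using K.r_coset_hom_Mod group_quotient[OF K] group_free_group by (simp add: group_hom_def group_hom_axioms_def)
  have KN': "K \<inter> N' \<in> \<I>" by (rule p_power_normal_Int[OF p K N'])
  have "B \<subseteq> kernel P (F Mod K) (proj K)"
    unfolding B
  proof (rule P.commutator_subgroup_subset[OF prK.subgroup_kernel])
    fix h b assume h: "h \<in> R" and b: "b \<in> R <#>\<^bsub>P\<^esub> M"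
    have hb: "h \<in> carrier P" "b \<in> carrier P" using R.mem_carrier[OF h] RM b by auto
    obtain u where u: "u \<in> carrier F" "h (K \<inter> N') = (K \<inter> N') #>\<^bsub>F\<^esub> u" using P_coset[OF hb(1) KN'] by blast
    obtain v where v: "v \<in> carrier F" "b (K \<inter> N') = (K \<inter> N') #>\<^bsub>F\<^esub> v" using P_coset[OF hb(2) KN'] by blast
    have uD: "u \<in> D" using D_mem[OF R_RM[OF h] u(1)] P_coset_mono[OF hb(1) KN' N' _ u] by blast
    have vD: "v \<in> D" using D_mem[OF b v(1)] P_coset_mono[OF hb(2) KN' N' _ v] by blast
    let ?c = "u \<otimes>\<^bsub>F\<^esub> v \<otimes>\<^bsub>F\<^esub> inv\<^bsub>F\<^esub> u \<otimes>\<^bsub>F\<^esub> inv\<^bsub>F\<^esub> v"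
    have hK: "proj K h = K #>\<^bsub>F\<^esub> u" and bK: "proj K b = K #>\<^bsub>F\<^esub> v"
      unfolding proj_def using P_coset_mono[OF hb(1) KN' K _ u] P_coset_mono[OF hb(2) KN' K _ v] by auto
    have "proj K (h \<otimes>\<^bsub>P\<^esub> b \<otimes>\<^bsub>P\<^esub> inv\<^bsub>P\<^esub> h \<otimes>\<^bsub>P\<^esub> inv\<^bsub>P\<^esub> b) = K #>\<^bsub>F\<^esub> ?c"
      by (simp only: prK.hom_mult prK.hom_inv P.m_closed P.inv_closed hb hK bK
          embK.hom_mult embK.hom_inv free.m_closed free.inv_closed u(1) v(1))
    also have "\<dots> = \<one>\<^bsub>F Mod K\<^esub>"
      using K.coset_eq_self_iff[of ?c] flow.commutator_in_flow_kernel[OF uD vD] u v by (simp add: K_def)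
    finally show "h \<otimes>\<^bsub>P\<^esub> b \<otimes>\<^bsub>P\<^esub> inv\<^bsub>P\<^esub> h \<otimes>\<^bsub>P\<^esub> inv\<^bsub>P\<^esub> b \<in> kernel P (F Mod K) (proj K)"
      using hb by (simp add: kernel_def del: one_FactGroup)
  qed
  then have CK: "proj K c = \<one>\<^bsub>F Mod K\<^esub>" if "c \<in> C" for c
    using that K unfolding C(1) closure_T[OF B_sub] kernel_def proj_def by fastforce
  from bspec[OF coord[unfolded coordinatewise_def] N'] obtain L0 where L0: "L0 \<in> \<I>"
    and eL0: "\<forall>x\<in>carrier P. \<forall>y\<in>carrier P. x L0 = y L0 \<longrightarrow> e x N' = e y N'" ..
  \<comment> \<open>A word that agrees with \<open>r\<close> modulo \<open>K\<close>, modulo \<open>N'\<close> and, after applying \<open>e\<close>, modulo \<open>N'\<close>.\<close>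
  let ?L = "K \<inter> N' \<inter> L0"
  have L: "?L \<in> \<I>" by (rule p_power_normal_Int[OF p KN' L0(1)])
  obtain w where w: "w \<in> carrier F" "r ?L = ?L #>\<^bsub>F\<^esub> w" using P_coset[OF rP L] by blast
  have rK: "r K = K #>\<^bsub>F\<^esub> w" and rN': "r N' = N' #>\<^bsub>F\<^esub> w" and rL0: "r L0 = L0 #>\<^bsub>F\<^esub> w"
    using P_coset_mono[OF rP L K _ w] P_coset_mono[OF rP L N' _ w] P_coset_mono[OF rP L L0 _ w] by blast+
  have "(K #>\<^bsub>F\<^esub> w) [^]\<^bsub>F Mod K\<^esub> (p ^ k) = \<one>\<^bsub>F Mod K\<^esub>"
    using CK[OF rk] prK.hom_nat_pow[OF rP, of "p ^ k"] rK by (simp add: proj_def)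
  then have "w [^]\<^bsub>F\<^esub> (p ^ k) \<in> flow_kernel X D (p ^ k * p ^ j)"
    using K.FactGroup_pow_eq_one[OF w(1)] unfolding K_def by blast
  then have "w \<in> flow_kernel X D (p ^ j)"
    using flow.flow_kernel_root[OF D_mem[OF R_RM[OF r] w(1) rN'], of "p ^ k"] prime_gt_0_nat[OF p] by simp
  then have "proj N' (emb w) = proj N' (e (emb w))"
    using core(3)[OF e eR exp] by blast
  moreover have "proj N' (e (emb w)) = proj N' (e r)"
    unfolding proj_def using eL0[rule_format, OF emb_closed[OF w(1)] rP] rL0 proj_emb[OF L0, of w] by (simp add: proj_def)
  moreover have "proj N' (emb w) = proj N' r"
    using rN' proj_emb[OF N', of w] by (simp add: proj_def)
  ultimately have eq: "proj N' r = proj N' (e r)" by simp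
  have er: "e r \<in> carrier P" using hom_in_carrier[OF e rP] .
  have "proj N' (inv\<^bsub>P\<^esub> r \<otimes>\<^bsub>P\<^esub> e r) = \<one>\<^bsub>F Mod N'\<^esub>"
    by (simp only: pr.hom_mult pr.hom_inv P.inv_closed rP er eq pr.H.l_inv pr.hom_closed)
  then have "proj N (inv\<^bsub>P\<^esub> r \<otimes>\<^bsub>P\<^esub> e r) \<in> proj N ` C"
    using proj_N'[of "inv\<^bsub>P\<^esub> r \<otimes>\<^bsub>P\<^esub> e r"] rP er by blast
  then show ?thesis unfolding proj_def by (metis imageE)
qed

end

text \<open>The discrete lift \<open>\<sigma>\<close> with values in the free pro-\<open>p\<close>-group on \<open>Y\<close> has, in each component \<open>M\<close>, a
  kernel of \<open>p\<close>-power index. So its component at \<open>M\<close> extends to the limit, through the component at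
  this kernel. The compatibility with \<open>f\<close> and \<open>g\<close> holds on the dense subgroup of words and passes to
  the limit because \<open>T\<close> is Hausdorff.\<close>

theorem free_pro_p_lift:
  assumes p: "prime p" and H: "group H" and T: "Hausdorff_space T"
    and f: "f \<in> hom (free_pro_p p X) H" "continuous_map (free_pro_p_topology p X) T f"
    and g: "g \<in> epi (free_pro_p p Y) H" "continuous_map (free_pro_p_topology p Y) T g"
  shows "\<exists>s\<in>hom (free_pro_p p X) (free_pro_p p Y). free_pro_p_group.coordinatewise p X s Y \<and>
    (\<forall>x\<in>carrier (free_pro_p p X). g (s x) = f x)"
proof -
  interpret X: free_pro_p_group p X using p by unfold_locales
  interpret Y: free_pro_p_group p Y using p by unfold_locales
  have gh: "g \<in> hom Y.P H" using g(1) by (simp add: epi_def)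
  have "(f \<circ> X.emb) \<in> hom X.F H" by (rule hom_compose[OF X.emb_hom f(1)])
  from free_group_lift[OF H this Y.group_P g(1)]
  obtain \<sigma> where \<sigma>: "\<sigma> \<in> hom X.F Y.P" "\<And>w. w \<in> carrier X.F \<Longrightarrow> g (\<sigma> w) = f (X.emb w)"
    by auto
  have q: "(Y.proj M \<circ> \<sigma>) \<in> hom X.F (Y.F Mod M)" if "M \<in> Y.\<I>" for M
    by (rule hom_compose[OF \<sigma>(1) Y.proj_hom[OF that]])
  define ker where "ker M = kernel X.F (Y.F Mod M) (Y.proj M \<circ> \<sigma>)" for M
  have ker: "ker M \<in> X.\<I>" if "M \<in> Y.\<I>" for M
    unfolding ker_def by (rule p_power_normal_kernel[OF p q[OF that] group_free_group that])
  have \<sigma>_closed: "\<sigma> w \<in> carrier Y.P" if "w \<in> carrier X.F" for w using hom_in_carrier[OF \<sigma>(1) that] .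
  have \<sigma>_eq: "\<sigma> v M = \<sigma> w M" if M: "M \<in> Y.\<I>" and v: "v \<in> carrier X.F" and w: "w \<in> carrier X.F"
    and vw: "v \<in> ker M #>\<^bsub>X.F\<^esub> w" for v w M
  proof -
    interpret q: group_hom X.F "Y.F Mod M" "Y.proj M \<circ> \<sigma>"
      using q[OF M] group_free_group Y.group_quotient[OF M] by (simp add: group_hom_def group_hom_axioms_def)
    obtain u where u: "u \<in> ker M" "v = u \<otimes>\<^bsub>X.F\<^esub> w" using vw by (auto simp: r_coset_def)
    then have uF: "u \<in> carrier X.F" and u1: "(Y.proj M \<circ> \<sigma>) u = \<one>\<^bsub>Y.F Mod M\<^esub>"
      unfolding ker_def kernel_def by blast+
    have "(Y.proj M \<circ> \<sigma>) v = \<one>\<^bsub>Y.F Mod M\<^esub> \<otimes>\<^bsub>Y.F Mod M\<^esub> (Y.proj M \<circ> \<sigma>) w"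
      unfolding u(2) q.hom_mult[OF uF w] u1 ..
    also have "\<dots> = (Y.proj M \<circ> \<sigma>) w" by (rule q.H.l_one[OF q.hom_closed[OF w]])
    finally show ?thesis by (simp add: Y.proj_def)
  qed
  \<comment> \<open>The component of \<open>x\<close> at \<open>ker M\<close> is a coset, on which \<open>\<sigma>\<close> has constant component at \<open>M\<close>.\<close>
  define s where "s x = (\<lambda>M\<in>Y.\<I>. \<sigma> (SOME w. w \<in> x (ker M)) M)" for x
  have s_eq: "s x M = \<sigma> w M"
    if M: "M \<in> Y.\<I>" and w: "w \<in> carrier X.F" and x: "x (ker M) = ker M #>\<^bsub>X.F\<^esub> w" for x M w
  proof -
    define v where "v = (SOME v. v \<in> ker M #>\<^bsub>X.F\<^esub> w)"
    have sub: "subgroup (ker M) X.F" by (rule normal_imp_subgroup[OF X.normal[OF ker[OF M]]])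
    have v: "v \<in> ker M #>\<^bsub>X.F\<^esub> w"
      unfolding v_def using free.rcos_self[OF w sub] by (rule someI)
    have "v \<in> carrier X.F" using v free.r_coset_subset_G[OF subgroup.subset[OF sub] w] by blast
    then have "\<sigma> v M = \<sigma> w M" using \<sigma>_eq[OF M _ w v] by blast
    then show ?thesis using M by (simp add: s_def x v_def)
  qed
  have s_closed: "s x \<in> carrier Y.P" if x: "x \<in> carrier X.P" for x
    unfolding s_def Y.carrier_P
  proof (rule limit_carrierI)
    fix M assume M: "M \<in> Y.\<I>"
    obtain w where w: "w \<in> carrier X.F" "x (ker M) = ker M #>\<^bsub>X.F\<^esub> w"
      using X.P_coset[OF x ker[OF M]] by blast
    have sM: "\<sigma> (SOME w. w \<in> x (ker M)) M = \<sigma> w M"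
      using s_eq[of M w x] M w by (simp add: s_def)
    then show "\<sigma> (SOME w. w \<in> x (ker M)) M \<in> carrier (Y.F Mod M)"
      using Y.P_component[OF \<sigma>_closed[OF w(1)] M] by simp
    fix L assume L: "L \<in> Y.\<I>" "M \<subseteq> L"
    \<comment> \<open>Both components of \<open>s x\<close> can be computed from one word that represents \<open>x\<close> modulo \<open>?N\<close>.\<close>
    let ?N = "ker M \<inter> ker L"
    have N: "?N \<in> X.\<I>" by (rule p_power_normal_Int[OF p ker[OF M] ker[OF L(1)]])
    obtain v where v: "v \<in> carrier X.F" "x ?N = ?N #>\<^bsub>X.F\<^esub> v"
      using X.P_coset[OF x N] by blast
    have "x (ker M) = ker M #>\<^bsub>X.F\<^esub> v" "x (ker L) = ker L #>\<^bsub>X.F\<^esub> v"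
      using X.P_coset_mono[OF x N _ _ v] ker M L by auto
    then have "\<sigma> (SOME w. w \<in> x (ker M)) M = \<sigma> v M" "\<sigma> (SOME w. w \<in> x (ker L)) L = \<sigma> v L"
      using s_eq[OF M v(1)] s_eq[OF L(1) v(1)] M L by (simp_all add: s_def)
    then show "quotient_map_of Y.F M L (\<sigma> (SOME w. w \<in> x (ker M)) M) = \<sigma> (SOME w. w \<in> x (ker L)) L"
      using Y.P_transition[OF \<sigma>_closed[OF v(1)] M L] by simp
  qed
  have s_emb: "s (X.emb w) = \<sigma> w" if w: "w \<in> carrier X.F" for w
  proof (rule Y.P_ext[OF s_closed[OF X.emb_closed[OF w]] \<sigma>_closed[OF w]])
    fix M assume M: "M \<in> Y.\<I>"
    show "s (X.emb w) M = \<sigma> w M"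
      using s_eq[OF M w] X.proj_emb[OF ker[OF M], of w] by (simp add: X.proj_def)
  qed
  have s_hom: "s \<in> hom X.P Y.P"
  proof (rule homI)
    fix x y assume x: "x \<in> carrier X.P" and y: "y \<in> carrier X.P"
    have xy: "x \<otimes>\<^bsub>X.P\<^esub> y \<in> carrier X.P"
      by (rule monoid.m_closed[OF group.is_monoid[OF X.group_P] x y])
    show "s (x \<otimes>\<^bsub>X.P\<^esub> y) = s x \<otimes>\<^bsub>Y.P\<^esub> s y"
    proof (rule Y.P_ext[OF s_closed[OF xy]])
      show "s x \<otimes>\<^bsub>Y.P\<^esub> s y \<in> carrier Y.P"
        by (rule monoid.m_closed[OF group.is_monoid[OF Y.group_P] s_closed[OF x] s_closed[OF y]])
      fix M assume M: "M \<in> Y.\<I>"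
      obtain v where v: "v \<in> carrier X.F" "x (ker M) = ker M #>\<^bsub>X.F\<^esub> v"
        using X.P_coset[OF x ker[OF M]] by blast
      obtain w where w: "w \<in> carrier X.F" "y (ker M) = ker M #>\<^bsub>X.F\<^esub> w"
        using X.P_coset[OF y ker[OF M]] by blast
      have "(x \<otimes>\<^bsub>X.P\<^esub> y) (ker M) = ker M #>\<^bsub>X.F\<^esub> (v \<otimes>\<^bsub>X.F\<^esub> w)"
        using ker[OF M] normal.rcos_sum[OF X.normal[OF ker[OF M]] v(1) w(1)] v w by (simp add: X.mult_P)
      then have "s (x \<otimes>\<^bsub>X.P\<^esub> y) M = \<sigma> (v \<otimes>\<^bsub>X.F\<^esub> w) M"
        using s_eq[OF M free.m_closed[OF v(1) w(1)]] by blast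
      also have "\<dots> = (\<sigma> v \<otimes>\<^bsub>Y.P\<^esub> \<sigma> w) M" unfolding hom_mult[OF \<sigma>(1) v(1) w(1)] ..
      also have "\<dots> = (s x \<otimes>\<^bsub>Y.P\<^esub> s y) M"
        using M s_eq[of M v x, OF M v] s_eq[of M w y, OF M w] by (simp add: Y.mult_P)
      finally show "s (x \<otimes>\<^bsub>X.P\<^esub> y) M = (s x \<otimes>\<^bsub>Y.P\<^esub> s y) M" .
    qed
  qed (rule s_closed)
  have s_coord: "X.coordinatewise s Y"
    unfolding X.coordinatewise_def
  proof
    fix M assume M: "M \<in> Y.\<I>"
    then show "\<exists>N\<in>X.\<I>. \<forall>x\<in>carrier X.P. \<forall>y\<in>carrier X.P. x N = y N \<longrightarrow> s x M = s y M"
      using ker[OF M] by (intro bexI[of _ "ker M"]) (auto simp: s_def)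
  qed
  have "g (s x) = f x" if x: "x \<in> carrier X.P" for x
  proof -
    have emb: "X.emb ` carrier X.F \<subseteq> carrier X.P" using X.emb_closed by blast
    have "\<exists>c\<in>X.emb ` carrier X.F. c N = x N" if N: "N \<in> X.\<I>" for N
    proof -
      obtain w where w: "w \<in> carrier X.F" "x N = N #>\<^bsub>X.F\<^esub> w" using X.P_coset[OF x N] by blast
      then have "X.emb w N = x N" using X.proj_emb[OF N, of w] by (simp add: X.proj_def)
      then show ?thesis using w(1) by blast
    qed
    then have cl: "x \<in> X.T closure_of (X.emb ` carrier X.F)"
      unfolding X.closure_T[OF emb] using x by simp
    have cont: "continuous_map X.T T (g \<circ> s)"
      by (rule continuous_map_compose[OF coordinatewise_continuous[OF p s_hom s_coord] g(2)])
    have "(g \<circ> s) x = f x"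
      by (rule forall_in_closure_of_eq[OF cl T cont f(2)]) (use s_emb \<sigma>(2) in auto)
    then show ?thesis by simp
  qed
  then show ?thesis using s_hom s_coord by blast
qed

section \<open>Independence of the presentation\<close>

text \<open>Taking \<open>m = 0\<close> in the flow kernel, a relation with a power in \<open>[D, D]\<close> has flow zero.\<close>

theorem quasirational_transfer:
  assumes G: "group G" and P1: "finite_type_presentation G X1 R1 f1"
    and P2: "finite_type_presentation G X2 R2 f2" and qr: "quasirational X1 R1"
  shows "quasirational X2 R2"
proof -
  let ?F1 = "free_group X1" and ?F2 = "free_group X2"
  have f1: "f1 \<in> hom ?F1 G" "f1 \<in> epi ?F1 G" and R1: "R1 = kernel ?F1 G f1"
    using P1 by (auto simp: finite_type_presentation_def epi_def)
  have f2: "f2 \<in> hom ?F2 G" "f2 \<in> epi ?F2 G" and R2: "R2 = kernel ?F2 G f2"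
    using P2 by (auto simp: finite_type_presentation_def epi_def)
  interpret f1: group_hom ?F1 G f1 using f1 G by (simp add: group_hom_def group_hom_axioms_def group_free_group)
  interpret f2: group_hom ?F2 G f2 using f2 G by (simp add: group_hom_def group_hom_axioms_def group_free_group)
  interpret R1: normal R1 ?F1 unfolding R1 by (rule f1.normal_kernel)
  interpret R2: normal R2 ?F2 unfolding R2 by (rule f2.normal_kernel)
  obtain s where s: "s \<in> hom ?F1 ?F2" "\<And>w. w \<in> carrier ?F1 \<Longrightarrow> f2 (s w) = f1 w"
    using free_group_lift[OF G f1(1) group_free_group f2(2)] by blast
  obtain t where t: "t \<in> hom ?F2 ?F1" "\<And>w. w \<in> carrier ?F2 \<Longrightarrow> f1 (t w) = f2 w"
    using free_group_lift[OF G f2(1) group_free_group f1(2)] by blast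
  interpret s: group_hom ?F1 ?F2 s using s by (simp add: group_hom_def group_hom_axioms_def group_free_group)
  interpret t: group_hom ?F2 ?F1 t using t by (simp add: group_hom_def group_hom_axioms_def group_free_group)
  have sR: "s ` R1 \<subseteq> R2"
    unfolding R1 R2 kernel_def by (rule image_subsetI) (use s(2) in simp)
  have tR: "t ` R2 \<subseteq> R1"
    unfolding R1 R2 kernel_def by (rule image_subsetI) (use t(2) in simp)
  show ?thesis
    unfolding quasirational_def Let_def
  proof (intro allI impI)
    fix n p :: nat assume n: "n > 0" and p: "prime p"
    define M1 M2 where "M1 = zassenhaus p ?F1 n" and "M2 = zassenhaus p ?F2 n"
    have M1: "M1 \<subseteq> carrier ?F1" "\<And>f g. f \<in> M1 \<Longrightarrow> g \<in> carrier ?F1 \<Longrightarrow> g \<otimes>\<^bsub>?F1\<^esub> f \<otimes>\<^bsub>?F1\<^esub> inv\<^bsub>?F1\<^esub> g \<in> M1"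
      using zassenhaus_conj[OF p group_free_group] by (auto simp: M1_def zassenhaus_def)
    have M2: "M2 \<subseteq> carrier ?F2" "\<And>f g. f \<in> M2 \<Longrightarrow> g \<in> carrier ?F2 \<Longrightarrow> g \<otimes>\<^bsub>?F2\<^esub> f \<otimes>\<^bsub>?F2\<^esub> inv\<^bsub>?F2\<^esub> g \<in> M2"
      using zassenhaus_conj[OF p group_free_group] by (auto simp: M2_def zassenhaus_def)
    have M2_one: "\<one>\<^bsub>?F2\<^esub> \<in> M2" unfolding M2_def by (rule zassenhaus_one[OF p group_free_group])
    have sM: "s ` M1 \<subseteq> M2" and tM: "t ` M2 \<subseteq> M1"
      using zassenhaus_hom[OF p group_free_group group_free_group s(1)]
        zassenhaus_hom[OF p group_free_group group_free_group t(1)] by (auto simp: M1_def M2_def)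
    define C1 C2 where "C1 = commutator_subgroup ?F1 R1 (R1 <#>\<^bsub>?F1\<^esub> M1)"
      and "C2 = commutator_subgroup ?F2 R2 (R2 <#>\<^bsub>?F2\<^esub> M2)"
    have C1: "C1 \<lhd> ?F1" "C1 \<subseteq> R1" using R1.relation_commutator[OF M1] by (simp_all add: C1_def)
    have C2: "C2 \<lhd> ?F2" "C2 \<subseteq> R2" using R2.relation_commutator[OF M2] by (simp_all add: C2_def)
    interpret C2: normal C2 ?F2 by (rule C2(1))
    have RM1: "R1 <#>\<^bsub>?F1\<^esub> M1 \<subseteq> carrier ?F1" by (rule free.setmult_subset_G[OF R1.subset M1(1)])
    have RM2: "R2 <#>\<^bsub>?F2\<^esub> M2 \<subseteq> carrier ?F2" by (rule free.setmult_subset_G[OF R2.subset M2(1)])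
    have "s ` (R1 <#>\<^bsub>?F1\<^esub> M1) \<subseteq> R2 <#>\<^bsub>?F2\<^esub> M2"
      using sR sM s.hom_mult R1.mem_carrier M1(1) by (fastforce simp: set_mult_def)
    then have sC: "s ` C1 \<subseteq> C2"
      unfolding C1_def C2_def by (rule s.commutator_subgroup_image[OF R1.subset sR RM1])
    have "t ` (R2 <#>\<^bsub>?F2\<^esub> M2) \<subseteq> R1 <#>\<^bsub>?F1\<^esub> M1"
      using tR tM t.hom_mult R2.mem_carrier M2(1) by (fastforce simp: set_mult_def)
    then have tC: "t ` C2 \<subseteq> C1"
      unfolding C1_def C2_def by (rule t.commutator_subgroup_image[OF R2.subset tR RM2])
    have qr1: "r \<in> C1" if "r \<in> R1" "r [^]\<^bsub>?F1\<^esub> (p ^ k) \<in> C1" for r and k :: nat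
      using qr n p that p_torsion_trivial_iff[OF group_free_group R1.subgroup_axioms C1, of p]
      unfolding quasirational_def Let_def C1_def M1_def by blast
    have "r \<in> C2" if r: "r \<in> R2" and rk: "r [^]\<^bsub>?F2\<^esub> (p ^ k) \<in> C2" for r and k :: nat
    proof -
      have rF: "r \<in> carrier ?F2" using R2.mem_carrier[OF r] .
      define e where "e = s \<circ> t"
      have e: "e \<in> hom ?F2 ?F2" unfolding e_def by (rule hom_compose[OF t(1) s(1)])
      have eF: "e x \<in> carrier ?F2" if "x \<in> carrier ?F2" for x using that by (simp add: e_def)
      have eR: "inv\<^bsub>?F2\<^esub> x \<otimes>\<^bsub>?F2\<^esub> e x \<in> R2" if "x \<in> carrier ?F2" for x
      proof -
        have "f2 (e x) = f2 x" using that s(2)[OF t.hom_closed[OF that]] t(2)[OF that] by (simp add: e_def)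
        then have "f2 (inv\<^bsub>?F2\<^esub> x \<otimes>\<^bsub>?F2\<^esub> e x) = \<one>\<^bsub>G\<^esub>"
          by (simp only: f2.hom_mult f2.hom_inv free.inv_closed that eF group.l_inv[OF G] f2.hom_closed)
        moreover have "inv\<^bsub>?F2\<^esub> x \<otimes>\<^bsub>?F2\<^esub> e x \<in> carrier ?F2"
          by (simp only: free.m_closed free.inv_closed that eF)
        ultimately show ?thesis unfolding R2 kernel_def by blast
      qed
      have "t r [^]\<^bsub>?F1\<^esub> (p ^ k) \<in> C1"
        using rk tC t.hom_nat_pow[OF rF, of "p ^ k"] by auto
      then have "t r \<in> C1" using qr1 r tR by blast
      then have er: "e r \<in> C2" using sC by (auto simp: e_def)
      define q where "q w = C2 #>\<^bsub>?F2\<^esub> w" for w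
      have q: "q \<in> hom ?F2 (?F2 Mod C2)" "q ` carrier ?F2 = carrier (?F2 Mod C2)"
        unfolding q_def using C2.r_coset_hom_Mod by (simp_all add: carrier_FactGroup)
      have Q: "group (?F2 Mod C2)" by (rule C2.factorgroup_is_group)
      interpret q: group_hom ?F2 "?F2 Mod C2" q using q Q by (simp add: group_hom_def group_hom_axioms_def group_free_group)
      have q_one: "q w = \<one>\<^bsub>?F2 Mod C2\<^esub> \<longleftrightarrow> w \<in> C2" if "w \<in> carrier ?F2" for w
        unfolding q_def one_FactGroup by (rule C2.coset_eq_self_iff[OF that])
      have comm: "\<forall>r\<in>R2. \<forall>b\<in>R2 <#>\<^bsub>?F2\<^esub> M2.
        q (r \<otimes>\<^bsub>?F2\<^esub> b \<otimes>\<^bsub>?F2\<^esub> inv\<^bsub>?F2\<^esub> r \<otimes>\<^bsub>?F2\<^esub> inv\<^bsub>?F2\<^esub> b) = \<one>\<^bsub>?F2 Mod C2\<^esub>"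
      proof (intro ballI)
        fix r b assume "r \<in> R2" "b \<in> R2 <#>\<^bsub>?F2\<^esub> M2"
        then have "r \<otimes>\<^bsub>?F2\<^esub> b \<otimes>\<^bsub>?F2\<^esub> inv\<^bsub>?F2\<^esub> r \<otimes>\<^bsub>?F2\<^esub> inv\<^bsub>?F2\<^esub> b \<in> C2"
          unfolding C2_def by (rule commutator_subgroup_incl)
        then show "q (r \<otimes>\<^bsub>?F2\<^esub> b \<otimes>\<^bsub>?F2\<^esub> inv\<^bsub>?F2\<^esub> r \<otimes>\<^bsub>?F2\<^esub> inv\<^bsub>?F2\<^esub> b) = \<one>\<^bsub>?F2 Mod C2\<^esub>"
          using q_one[OF C2.mem_carrier] by blast
      qed
      have id: "(\<lambda>w. w) \<in> hom ?F2 ?F2" by (simp add: hom_def)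
      define D where "D = {w \<in> carrier ?F2. \<forall>a\<in>q ` R2. q w \<otimes>\<^bsub>?F2 Mod C2\<^esub> a = a \<otimes>\<^bsub>?F2 Mod C2\<^esub> q w}"
      note core = endomorphism_eq_on_flow_kernel[OF group_free_group Q q id R2.normal_axioms M2(1) M2_one comm D_def]
      interpret schreier_flow X2 D unfolding schreier_flow_def by (rule core(1))
      have RM_D: "b \<in> D" if "b \<in> R2 <#>\<^bsub>?F2\<^esub> M2" for b
        using core(2)[OF subsetD[OF RM2 that] that refl] .
      have R_D: "b \<in> D" if "b \<in> R2" for b
        using RM_D that M2_one R2.mem_carrier[OF that] unfolding set_mult_def by force
      have "C2 \<subseteq> flow_kernel X2 D 0"
        unfolding C2_def
        by (rule free.commutator_subgroup_subset[OF normal_imp_subgroup[OF flow_kernel_normal]])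
          (rule commutator_in_flow_kernel[OF R_D RM_D])
      then have "r [^]\<^bsub>?F2\<^esub> (p ^ k) \<in> flow_kernel X2 D (p ^ k * 0)" using rk by auto
      then have "r \<in> flow_kernel X2 D 0"
        using flow_kernel_root[OF R_D[OF r], of "p ^ k" 0] prime_gt_0_nat[OF p] by simp
      then have "q r = q (e r)"
        using core(3)[OF e eR, of 0 r] Q by (simp add: group.is_monoid monoid.nat_pow_0)
      then have "q r = \<one>\<^bsub>?F2 Mod C2\<^esub>" using q_one[OF eF[OF rF]] er by simp
      then show ?thesis using q_one[OF rF] by blast
    qed
    then have "p_torsion p (?F2\<lparr>carrier := R2\<rparr> Mod C2) = {\<one>\<^bsub>?F2\<lparr>carrier := R2\<rparr> Mod C2\<^esub>}"
      using p_torsion_trivial_iff[OF group_free_group R2.subgroup_axioms C2, of p] by blast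
    then show "p_torsion p (?F2\<lparr>carrier := R2\<rparr> Mod commutator_subgroup ?F2 R2 (R2 <#>\<^bsub>?F2\<^esub> zassenhaus p ?F2 n)) =
        {\<one>\<^bsub>?F2\<lparr>carrier := R2\<rparr> Mod commutator_subgroup ?F2 R2 (R2 <#>\<^bsub>?F2\<^esub> zassenhaus p ?F2 n)\<^esub>}"
      by (simp only: C2_def M2_def)
  qed
qed

theorem pro_p_quasirational_transfer:
  assumes p: "prime p" and H: "pro_p_group p H T"
    and P1: "finite_type_pro_p_presentation p H T X1 R1 f1"
    and P2: "finite_type_pro_p_presentation p H T X2 R2 f2" and qr: "pro_p_quasirational p X1 R1"
  shows "pro_p_quasirational p X2 R2"
proof -
  interpret X: free_pro_p_group p X1 using p by unfold_locales
  interpret Y: free_pro_p_group p X2 using p by unfold_locales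
  have G: "group H" and Hausdorff: "Hausdorff_space T"
    using H by (auto simp: pro_p_group_def profinite_group_def topological_group_def)
  have f1: "f1 \<in> hom X.P H" "f1 \<in> epi X.P H" "continuous_map X.T T f1" and R1: "R1 = kernel X.P H f1"
    and R1_closed: "\<exists>S. R1 = X.T closure_of S"
    using P1 unfolding finite_type_pro_p_presentation_def epi_def by blast+
  have f2: "f2 \<in> hom Y.P H" "f2 \<in> epi Y.P H" "continuous_map Y.T T f2" and R2: "R2 = kernel Y.P H f2"
    and R2_closed: "\<exists>S. R2 = Y.T closure_of S" and X2: "finite X2"
    using P2 unfolding finite_type_pro_p_presentation_def epi_def by blast+
  interpret f1: group_hom X.P H f1 using f1 G X.group_P by (simp add: group_hom_def group_hom_axioms_def)
  interpret f2: group_hom Y.P H f2 using f2 G Y.group_P by (simp add: group_hom_def group_hom_axioms_def)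
  interpret R1: normal R1 X.P unfolding R1 by (rule f1.normal_kernel)
  interpret R2: normal R2 Y.P unfolding R2 by (rule f2.normal_kernel)
  obtain s where s: "s \<in> hom X.P Y.P" "X.coordinatewise s X2" "\<And>x. x \<in> carrier X.P \<Longrightarrow> f2 (s x) = f1 x"
    using free_pro_p_lift[OF p G Hausdorff f1(1,3) f2(2,3)] by blast
  obtain t where t: "t \<in> hom Y.P X.P" "Y.coordinatewise t X1" "\<And>x. x \<in> carrier Y.P \<Longrightarrow> f1 (t x) = f2 x"
    using free_pro_p_lift[OF p G Hausdorff f2(1,3) f1(2,3)] by blast
  have s_cont: "continuous_map X.T Y.T s" by (rule coordinatewise_continuous[OF p s(1,2)])
  have t_cont: "continuous_map Y.T X.T t" by (rule coordinatewise_continuous[OF p t(1,2)])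
  interpret s: group_hom X.P Y.P s using s X.group_P Y.group_P by (simp add: group_hom_def group_hom_axioms_def)
  interpret t: group_hom Y.P X.P t using t X.group_P Y.group_P by (simp add: group_hom_def group_hom_axioms_def)
  have sR: "s ` R1 \<subseteq> R2"
    unfolding R1 R2 kernel_def by (rule image_subsetI) (use s(3) in simp)
  have tR: "t ` R2 \<subseteq> R1"
    unfolding R1 R2 kernel_def by (rule image_subsetI) (use t(3) in simp)
  define e where "e = s \<circ> t"
  have e: "e \<in> hom Y.P Y.P" unfolding e_def by (rule hom_compose[OF t(1) s(1)])
  have eP: "e x \<in> carrier Y.P" if "x \<in> carrier Y.P" for x using hom_in_carrier[OF e that] .
  have eR: "inv\<^bsub>Y.P\<^esub> x \<otimes>\<^bsub>Y.P\<^esub> e x \<in> R2" if "x \<in> carrier Y.P" for x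
  proof -
    have "f2 (e x) = f2 x" using s(3)[OF t.hom_closed[OF that]] t(3)[OF that] by (simp add: e_def)
    then have "f2 (inv\<^bsub>Y.P\<^esub> x \<otimes>\<^bsub>Y.P\<^esub> e x) = \<one>\<^bsub>H\<^esub>"
      by (simp only: f2.hom_mult f2.hom_inv f2.G.inv_closed that eP group.l_inv[OF G] f2.hom_closed)
    moreover have "inv\<^bsub>Y.P\<^esub> x \<otimes>\<^bsub>Y.P\<^esub> e x \<in> carrier Y.P"
      by (simp only: f2.G.m_closed f2.G.inv_closed that eP)
    ultimately show ?thesis unfolding R2 kernel_def by blast
  qed
  have e_coord: "Y.coordinatewise e X2"
    unfolding Y.coordinatewise_def
  proof
    fix M assume M: "M \<in> Y.\<I>"
    from bspec[OF s(2)[unfolded X.coordinatewise_def] M] obtain N where N: "N \<in> X.\<I>"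
      and sN: "\<forall>x\<in>carrier X.P. \<forall>y\<in>carrier X.P. x N = y N \<longrightarrow> s x M = s y M" ..
    from bspec[OF t(2)[unfolded Y.coordinatewise_def] N] obtain L where L: "L \<in> Y.\<I>"
      and tL: "\<forall>x\<in>carrier Y.P. \<forall>y\<in>carrier Y.P. x L = y L \<longrightarrow> t x N = t y N" ..
    have "e x M = e y M" if "x \<in> carrier Y.P" "y \<in> carrier Y.P" "x L = y L" for x y
      using sN[rule_format, OF t.hom_closed[OF that(1)] t.hom_closed[OF that(2)] tL[rule_format, OF that]]
      by (simp add: e_def)
    then show "\<exists>L\<in>Y.\<I>. \<forall>x\<in>carrier Y.P. \<forall>y\<in>carrier Y.P. x L = y L \<longrightarrow> e x M = e y M"
      using L by blast
  qed
  show ?thesis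
    unfolding pro_p_quasirational_def Let_def
  proof (intro allI impI)
    fix n :: nat assume n: "n > 0"
    define M1 M2 where "M1 = pro_p_zassenhaus p X.P X.T n" and "M2 = pro_p_zassenhaus p Y.P Y.T n"
    have M1: "M1 \<subseteq> carrier X.P" "\<And>f g. f \<in> M1 \<Longrightarrow> g \<in> carrier X.P \<Longrightarrow> g \<otimes>\<^bsub>X.P\<^esub> f \<otimes>\<^bsub>X.P\<^esub> inv\<^bsub>X.P\<^esub> g \<in> M1"
      unfolding M1_def by (fact X.zassenhaus_subset) (rule X.zassenhaus_conj)
    have M2: "M2 \<subseteq> carrier Y.P" "\<And>f g. f \<in> M2 \<Longrightarrow> g \<in> carrier Y.P \<Longrightarrow> g \<otimes>\<^bsub>Y.P\<^esub> f \<otimes>\<^bsub>Y.P\<^esub> inv\<^bsub>Y.P\<^esub> g \<in> M2"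
      unfolding M2_def by (fact Y.zassenhaus_subset) (rule Y.zassenhaus_conj)
    have M2_one: "\<one>\<^bsub>Y.P\<^esub> \<in> M2" unfolding M2_def by (rule pro_p_zassenhaus_one[OF p Y.group_P Y.topspace_T])
    have sM: "s ` M1 \<subseteq> M2" and tM: "t ` M2 \<subseteq> M1"
      using pro_p_zassenhaus_hom[OF p X.group_P X.topspace_T Y.group_P Y.topspace_T s(1) s_cont]
        pro_p_zassenhaus_hom[OF p Y.group_P Y.topspace_T X.group_P X.topspace_T t(1) t_cont]
      by (auto simp: M1_def M2_def)
    define B1 B2 where "B1 = commutator_subgroup X.P R1 (R1 <#>\<^bsub>X.P\<^esub> M1)"
      and "B2 = commutator_subgroup Y.P R2 (R2 <#>\<^bsub>Y.P\<^esub> M2)"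
    define C1 C2 where "C1 = X.T closure_of B1" and "C2 = Y.T closure_of B2"
    have B1: "B1 \<lhd> X.P" "B1 \<subseteq> R1" using R1.relation_commutator[OF M1] by (simp_all add: B1_def)
    have B2: "B2 \<lhd> Y.P" "B2 \<subseteq> R2" using R2.relation_commutator[OF M2] by (simp_all add: B2_def)
    have B2P: "B2 \<subseteq> carrier Y.P" using subgroup.subset[OF normal_imp_subgroup[OF B2(1)]] .
    have C1: "C1 \<lhd> X.P" "C1 \<subseteq> R1"
      unfolding C1_def using X.closure_normal[OF B1(1)] R1_closed closure_of_mono[OF B1(2), of X.T] by auto
    have C2: "C2 \<lhd> Y.P" "C2 \<subseteq> R2"
      unfolding C2_def using Y.closure_normal[OF B2(1)] R2_closed closure_of_mono[OF B2(2), of Y.T] by auto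
    interpret C2: normal C2 Y.P by (rule C2(1))
    have C2_closed: "Y.T closure_of C2 = C2" by (simp add: C2_def)
    have C2I: "z \<in> C2" if z: "z \<in> carrier Y.P" "\<And>N. N \<in> Y.\<I> \<Longrightarrow> \<exists>c\<in>C2. c N = z N" for z
    proof -
      have "z \<in> Y.T closure_of C2" unfolding Y.closure_T[OF C2.subset] using z by simp
      then show ?thesis by (simp only: C2_closed)
    qed
    have RM1: "R1 <#>\<^bsub>X.P\<^esub> M1 \<subseteq> carrier X.P" by (rule f1.G.setmult_subset_G[OF R1.subset M1(1)])
    have RM2: "R2 <#>\<^bsub>Y.P\<^esub> M2 \<subseteq> carrier Y.P" by (rule f2.G.setmult_subset_G[OF R2.subset M2(1)])
    have "s ` (R1 <#>\<^bsub>X.P\<^esub> M1) \<subseteq> R2 <#>\<^bsub>Y.P\<^esub> M2"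
      using sR sM s.hom_mult R1.mem_carrier M1(1) by (fastforce simp: set_mult_def)
    then have sB: "s ` B1 \<subseteq> B2"
      unfolding B1_def B2_def by (rule s.commutator_subgroup_image[OF R1.subset sR RM1])
    have sC: "s ` C1 \<subseteq> C2"
      unfolding C1_def C2_def
      by (rule subset_trans[OF continuous_map_image_closure_subset[OF s_cont] closure_of_mono[OF sB]])
    have "t ` (R2 <#>\<^bsub>Y.P\<^esub> M2) \<subseteq> R1 <#>\<^bsub>X.P\<^esub> M1"
      using tR tM t.hom_mult R2.mem_carrier M2(1) by (fastforce simp: set_mult_def)
    then have tB: "t ` B2 \<subseteq> B1"
      unfolding B1_def B2_def by (rule t.commutator_subgroup_image[OF R2.subset tR RM2])
    have tC: "t ` C2 \<subseteq> C1"
      unfolding C1_def C2_def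
      by (rule subset_trans[OF continuous_map_image_closure_subset[OF t_cont] closure_of_mono[OF tB]])
    have "p_torsion p (X.P\<lparr>carrier := R1\<rparr> Mod C1) = {\<one>\<^bsub>X.P\<lparr>carrier := R1\<rparr> Mod C1\<^esub>}"
      using qr[unfolded pro_p_quasirational_def Let_def, rule_format, OF n] by (simp only: C1_def B1_def M1_def)
    then have qr1: "\<forall>r\<in>R1. \<forall>k::nat. r [^]\<^bsub>X.P\<^esub> (p ^ k) \<in> C1 \<longrightarrow> r \<in> C1"
      by (simp only: p_torsion_trivial_iff[OF X.group_P R1.subgroup_axioms C1])
    have "r \<in> C2" if r: "r \<in> R2" and rk: "r [^]\<^bsub>Y.P\<^esub> (p ^ k) \<in> C2" for r and k :: nat
    proof -
      have rP: "r \<in> carrier Y.P" using R2.mem_carrier[OF r] .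
      have "t r [^]\<^bsub>X.P\<^esub> (p ^ k) \<in> C1"
        using rk tC t.hom_nat_pow[OF rP, of "p ^ k"] by auto
      then have "t r \<in> C1" using qr1 imageI[OF r, of t] tR by blast
      then have er: "e r \<in> C2" using sC by (auto simp: e_def)
      have "inv\<^bsub>Y.P\<^esub> r \<otimes>\<^bsub>Y.P\<^esub> e r \<in> C2"
      proof (rule C2I)
        show "inv\<^bsub>Y.P\<^esub> r \<otimes>\<^bsub>Y.P\<^esub> e r \<in> carrier Y.P" using rP eP by simp
        fix N assume N: "N \<in> Y.\<I>"
        show "\<exists>c\<in>C2. c N = (inv\<^bsub>Y.P\<^esub> r \<otimes>\<^bsub>Y.P\<^esub> e r) N"
          by (rule Y.endomorphism_fixes_torsion_modulo[OF X2 R2.normal_axioms M2(1) M2_one B2_def C2_def C2(1) e eR e_coord r rk N])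
      qed
      then have "e r \<otimes>\<^bsub>Y.P\<^esub> inv\<^bsub>Y.P\<^esub> (inv\<^bsub>Y.P\<^esub> r \<otimes>\<^bsub>Y.P\<^esub> e r) \<in> C2" using er by simp
      then show ?thesis
        using rP eP[OF rP] by (simp add: f2.G.inv_mult_group flip: f2.G.m_assoc)
    qed
    then have "p_torsion p (Y.P\<lparr>carrier := R2\<rparr> Mod C2) = {\<one>\<^bsub>Y.P\<lparr>carrier := R2\<rparr> Mod C2\<^esub>}"
      using p_torsion_trivial_iff[OF Y.group_P R2.subgroup_axioms C2, of p] by blast
    then show "p_torsion p (Y.P\<lparr>carrier := R2\<rparr> Mod
          (Y.T closure_of commutator_subgroup Y.P R2 (R2 <#>\<^bsub>Y.P\<^esub> pro_p_zassenhaus p Y.P Y.T n))) =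
        {\<one>\<^bsub>Y.P\<lparr>carrier := R2\<rparr> Mod
          (Y.T closure_of commutator_subgroup Y.P R2 (R2 <#>\<^bsub>Y.P\<^esub> pro_p_zassenhaus p Y.P Y.T n))\<^esub>}"
      by (simp only: C2_def B2_def M2_def)
  qed
qed

theorem mainTheorem2:
  fixes G :: "'g monoid"
    and X\<^sub>1 :: "'x set" and R\<^sub>1 :: "('x \<times> bool) list set" and \<pi>\<^sub>1 :: "('x \<times> bool) list \<Rightarrow> 'g"
    and X\<^sub>2 :: "'y set" and R\<^sub>2 :: "('y \<times> bool) list set" and \<pi>\<^sub>2 :: "('y \<times> bool) list \<Rightarrow> 'g"
    and p :: nat and H :: "'h monoid" and T :: "'h topology"
    and Y\<^sub>1 :: "'u set" and Q\<^sub>1 :: "'u pro_word set" and \<rho>\<^sub>1 :: "'u pro_word \<Rightarrow> 'h"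
    and Y\<^sub>2 :: "'v set" and Q\<^sub>2 :: "'v pro_word set" and \<rho>\<^sub>2 :: "'v pro_word \<Rightarrow> 'h"
  shows
    "(group G \<and>
      finite_type_presentation G X\<^sub>1 R\<^sub>1 \<pi>\<^sub>1 \<and>
      finite_type_presentation G X\<^sub>2 R\<^sub>2 \<pi>\<^sub>2 \<and>
      quasirational X\<^sub>1 R\<^sub>1
        \<longrightarrow> quasirational X\<^sub>2 R\<^sub>2) \<and>
     (prime p \<and> pro_p_group p H T \<and>
      finite_type_pro_p_presentation p H T Y\<^sub>1 Q\<^sub>1 \<rho>\<^sub>1 \<and>
      finite_type_pro_p_presentation p H T Y\<^sub>2 Q\<^sub>2 \<rho>\<^sub>2 \<and>
      pro_p_quasirational p Y\<^sub>1 Q\<^sub>1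
        \<longrightarrow> pro_p_quasirational p Y\<^sub>2 Q\<^sub>2)"
  using quasirational_transfer pro_p_quasirational_transfer by blast

end
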